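(* Let $\mathcal G$ be a locally compact amenable group, $X$ a probability space, and $G$ a group of unitary operators on $L^2(X)$ that act as isometric algebra homomorphisms on $L^\infty(X)$, endowed with a filtration $G_\bullet$ of finite length (so $G$ is nilpotent). Let $g_1,\dots,g_j\in P(\mathcal G,G_\bullet)$ be measurable and let $f_0,\dots,f_j\in L^\infty(X)$ be arbitrary bounded functions. Then for every F\o{}lner net $(\Phi_\alpha)_{\alpha\in A}$ in $\mathcal G$ and any choice of $(a_\alpha)_{\alpha\in A}\subset\mathcal G$ the limit \[ \lim_\alpha \mathbb E_{m\in a_\alpha\Phi_\alpha}\, f_0\cdot g_1(m)f_1\cdots g_j(m)f_j \] exists in $L^2(X)$ and is independent of the F\o{}lner net $(\Phi_\alpha)_{\alpha\in A}$ and the shifts $(a_\alpha)_{\alpha\in A}$.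
   Context: $\mathcal G$ carries a left Haar measure $|\cdot|$ and is not assumed second countable. A net $(\Phi_\alpha)_{\alpha\in A}$ of nonempty compact subsets of $\mathcal G$ (of positive measure) is a F\o{}lner net if for every compact $K\subset\mathcal G$ one has $\lim_\alpha\sup_{l\in K}|l\Phi_\alpha\,\Delta\,\Phi_\alpha|/|\Phi_\alpha|=0$. For a set $I$ of finite positive measure, $\mathbb E_{n\in I}f(n)=\frac1{|I|}\int_{n\in I}f(n)$, integration being with respect to the left Haar measure. A prefiltration $G_\bullet$ is a nested sequence of groups $G_0\ge G_1\ge\dots$ with $[G_i,G_j]\subset G_{i+j}$ for all $i,j\in\mathbb N=\{0,1,\dots\}$; it is a filtration on $G$ if $G_0=G_1=G$. It has length $d\in\mathbb N$ if $G_{d+1}$ is trivial and length $-\infty$ if $G_0$ is trivial. $G_{\bullet+1}$ denotes the prefiltration $(G_{\bullet+1})_i=G_{i+1}$, which has length $d-1$ (meaning $-\infty$ if $d=0$). A map $g:\mathcal G\to G_0$ is $G_\bullet$-polynomial if either $d=-\infty$ (and $g$ is identically the identity) or for all $a,b\in\mathcal G$ the map $n\mapsto g(n)^{-1}g(anb)$ is $G_{\bullet+1}$-polynomial. $P(\mathcal G,G_\bullet)$ is the set of such maps. *)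

theory Defs
  imports
    "HOL-Probability.Essential_Supremum"
    "HOL-Probability.Probability"
    "HOL-Algebra.Bij"
    "HOL-Algebra.Generated_Groups"
begin

section \<open>The acting group\<close>

text \<open>
  The locally compact group is a type of class \<^class>\<open>topological_group_add\<close> and \<^class>\<open>t2_space\<close>
  (Hausdorff). The library writes this class additively, but it does not assume commutativity:
  the product \<open>a n b\<close> is written \<open>a + n + b\<close>, and the left translate \<open>l \<Phi>\<close> is \<open>(+) l ` \<Phi>\<close>.

  Since no countability assumption is made, a Haar measure need not be sigma-finite. We use the
  usual convention for its regularity: outer regular on Borel sets and inner regular on open sets.
\<close>

definition left_haar_measure :: "'g::{topological_group_add, t2_space} measure \<Rightarrow> bool" where
  "left_haar_measure \<mu> \<longleftrightarrow>
     sets \<mu> = sets borel \<and>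
     (\<forall>K. compact K \<longrightarrow> emeasure \<mu> K < \<infinity>) \<and>
     (\<forall>U. open U \<and> U \<noteq> {} \<longrightarrow> emeasure \<mu> U > 0) \<and>
     (\<forall>B \<in> sets borel. emeasure \<mu> B = (INF U \<in> {U. open U \<and> B \<subseteq> U}. emeasure \<mu> U)) \<and>
     (\<forall>U. open U \<longrightarrow> emeasure \<mu> U = (SUP K \<in> {K. compact K \<and> K \<subseteq> U}. emeasure \<mu> K)) \<and>
     (\<forall>a. \<forall>B \<in> sets borel. emeasure \<mu> ((+) a ` B) = emeasure \<mu> B)"

text \<open>
  A group is amenable if \<open>L\<^sup>\<infinity>\<close> of its Haar measure carries a left invariant mean. A mean on
  \<open>L\<^sup>\<infinity>\<close> is given as a functional on bounded Borel functions that ignores locally null ones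
  (every class in \<open>L\<^sup>\<infinity>\<close> has a bounded Borel representative).
\<close>

definition bounded_borel :: "('g::topological_space \<Rightarrow> real) set" where
  "bounded_borel = {\<phi> \<in> borel_measurable borel. bounded (range \<phi>)}"

definition left_invariant_mean ::
    "'g::{topological_group_add, t2_space} measure \<Rightarrow> (('g \<Rightarrow> real) \<Rightarrow> real) \<Rightarrow> bool" where
  "left_invariant_mean \<mu> mean \<longleftrightarrow>
     (\<forall>\<phi> \<in> bounded_borel. \<forall>\<psi> \<in> bounded_borel. mean (\<lambda>n. \<phi> n + \<psi> n) = mean \<phi> + mean \<psi>) \<and>
     (\<forall>\<phi> \<in> bounded_borel. \<forall>c. mean (\<lambda>n. c * \<phi> n) = c * mean \<phi>) \<and>
     (\<forall>\<phi> \<in> bounded_borel. (\<forall>n. 0 \<le> \<phi> n) \<longrightarrow> 0 \<le> mean \<phi>) \<and>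
     mean (\<lambda>n. 1) = 1 \<and>
     (\<forall>\<phi> \<in> bounded_borel. (\<forall>K. compact K \<longrightarrow> (AE n in \<mu>. n \<in> K \<longrightarrow> \<phi> n = 0)) \<longrightarrow> mean \<phi> = 0) \<and>
     (\<forall>\<phi> \<in> bounded_borel. \<forall>a. mean (\<lambda>n. \<phi> (a + n)) = mean \<phi>)"

definition amenable :: "'g::{topological_group_add, t2_space} measure \<Rightarrow> bool" where
  "amenable \<mu> \<longleftrightarrow> (\<exists>mean. left_invariant_mean \<mu> mean)"

section \<open>Nets and Foelner nets\<close>

definition directed_set :: "'i set \<Rightarrow> ('i \<Rightarrow> 'i \<Rightarrow> bool) \<Rightarrow> bool" where
  "directed_set A rel \<longleftrightarrow>
     A \<noteq> {} \<and>
     (\<forall>\<alpha> \<in> A. rel \<alpha> \<alpha>) \<and>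
     (\<forall>\<alpha> \<in> A. \<forall>\<beta> \<in> A. \<forall>\<gamma> \<in> A. rel \<alpha> \<beta> \<and> rel \<beta> \<gamma> \<longrightarrow> rel \<alpha> \<gamma>) \<and>
     (\<forall>\<alpha> \<in> A. \<forall>\<beta> \<in> A. \<exists>\<gamma> \<in> A. rel \<alpha> \<gamma> \<and> rel \<beta> \<gamma>)"

text \<open>The filter of tails: limits along a net are limits with respect to it.\<close>

definition net_filter :: "'i set \<Rightarrow> ('i \<Rightarrow> 'i \<Rightarrow> bool) \<Rightarrow> 'i filter" where
  "net_filter A rel = (INF \<alpha> \<in> A. principal {\<beta> \<in> A. rel \<alpha> \<beta>})"

text \<open>The supremum is taken in \<^typ>\<open>ennreal\<close>, where it is 0 for empty \<open>K\<close>.\<close>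

definition folner_net ::
    "'g::{topological_group_add, t2_space} measure \<Rightarrow> 'i set \<Rightarrow> ('i \<Rightarrow> 'i \<Rightarrow> bool) \<Rightarrow> ('i \<Rightarrow> 'g set) \<Rightarrow> bool"
  where
  "folner_net \<mu> A rel \<Phi> \<longleftrightarrow>
     directed_set A rel \<and>
     (\<forall>\<alpha> \<in> A. compact (\<Phi> \<alpha>) \<and> \<Phi> \<alpha> \<noteq> {} \<and> emeasure \<mu> (\<Phi> \<alpha>) > 0) \<and>
     (\<forall>K. compact K \<longrightarrow>
        ((\<lambda>\<alpha>. SUP l \<in> K. emeasure \<mu> (sym_diff ((+) l ` \<Phi> \<alpha>) (\<Phi> \<alpha>)) / emeasure \<mu> (\<Phi> \<alpha>)) \<longlongrightarrow> 0)
          (net_filter A rel))"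

section \<open>The spaces \<open>L\<^sup>2\<close> and \<open>L\<^sup>\<infinity>\<close> of a measure space\<close>

text \<open>
  Elements are almost-everywhere classes of measurable complex functions, represented as sets of
  functions. Operations on classes are computed with the representatives chosen by \<open>rep\<close>; up to
  almost-everywhere equality, and hence as classes, numbers or norms, the results do not depend on
  this choice.
\<close>

definition ae_class :: "'x measure \<Rightarrow> ('x \<Rightarrow> complex) \<Rightarrow> ('x \<Rightarrow> complex) set" where
  "ae_class M f = {h \<in> borel_measurable M. AE x in M. h x = f x}"

definition rep :: "('x \<Rightarrow> complex) set \<Rightarrow> 'x \<Rightarrow> complex" where
  "rep u = (SOME f. f \<in> u)"

definition L2 :: "'x measure \<Rightarrow> ('x \<Rightarrow> complex) set set" where
  "L2 M = ae_class M ` {f \<in> borel_measurable M. integrable M (\<lambda>x. (cmod (f x))\<^sup>2)}"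

definition Linf :: "'x measure \<Rightarrow> ('x \<Rightarrow> complex) set set" where
  "Linf M = ae_class M ` {f \<in> borel_measurable M. esssup M (\<lambda>x. ereal (cmod (f x))) < \<infinity>}"

definition cl_add :: "'x measure \<Rightarrow> ('x \<Rightarrow> complex) set \<Rightarrow> ('x \<Rightarrow> complex) set \<Rightarrow> ('x \<Rightarrow> complex) set" where
  "cl_add M u v = ae_class M (\<lambda>x. rep u x + rep v x)"

definition cl_scale :: "'x measure \<Rightarrow> complex \<Rightarrow> ('x \<Rightarrow> complex) set \<Rightarrow> ('x \<Rightarrow> complex) set" where
  "cl_scale M c u = ae_class M (\<lambda>x. c * rep u x)"

definition cl_mult :: "'x measure \<Rightarrow> ('x \<Rightarrow> complex) set \<Rightarrow> ('x \<Rightarrow> complex) set \<Rightarrow> ('x \<Rightarrow> complex) set" where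
  "cl_mult M u v = ae_class M (\<lambda>x. rep u x * rep v x)"

definition L2_inner :: "'x measure \<Rightarrow> ('x \<Rightarrow> complex) set \<Rightarrow> ('x \<Rightarrow> complex) set \<Rightarrow> complex" where
  "L2_inner M u v = (\<integral>x. rep u x * cnj (rep v x) \<partial>M)"

definition L2_dist :: "'x measure \<Rightarrow> ('x \<Rightarrow> complex) set \<Rightarrow> ('x \<Rightarrow> complex) set \<Rightarrow> real" where
  "L2_dist M u v = sqrt (\<integral>x. (cmod (rep u x - rep v x))\<^sup>2 \<partial>M)"

definition Linf_norm :: "'x measure \<Rightarrow> ('x \<Rightarrow> complex) set \<Rightarrow> ereal" where
  "Linf_norm M u = esssup M (\<lambda>x. ereal (cmod (rep u x)))"

section \<open>Groups of operators\<close>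

type_synonym 'x operator = "('x \<Rightarrow> complex) set \<Rightarrow> ('x \<Rightarrow> complex) set"

text \<open>
  Operators on \<open>L2 M\<close> are extensional functions, so that they form a group inside
  \<^term>\<open>BijGroup (L2 M)\<close>, whose product is composition.
\<close>

definition unitary_operator :: "'x measure \<Rightarrow> 'x operator \<Rightarrow> bool" where
  "unitary_operator M T \<longleftrightarrow>
     T \<in> Bij (L2 M) \<and>
     (\<forall>u \<in> L2 M. \<forall>v \<in> L2 M. T (cl_add M u v) = cl_add M (T u) (T v)) \<and>
     (\<forall>u \<in> L2 M. \<forall>c. T (cl_scale M c u) = cl_scale M c (T u)) \<and>
     (\<forall>u \<in> L2 M. \<forall>v \<in> L2 M. L2_inner M (T u) (T v) = L2_inner M u v)"

definition isometric_algebra_hom_Linf :: "'x measure \<Rightarrow> 'x operator \<Rightarrow> bool" where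
  "isometric_algebra_hom_Linf M T \<longleftrightarrow>
     (\<forall>u \<in> Linf M. T u \<in> Linf M) \<and>
     (\<forall>u \<in> Linf M. \<forall>v \<in> Linf M. T (cl_add M u v) = cl_add M (T u) (T v)) \<and>
     (\<forall>u \<in> Linf M. \<forall>c. T (cl_scale M c u) = cl_scale M c (T u)) \<and>
     (\<forall>u \<in> Linf M. \<forall>v \<in> Linf M. T (cl_mult M u v) = cl_mult M (T u) (T v)) \<and>
     (\<forall>u \<in> Linf M. Linf_norm M (T u) = Linf_norm M u)"

definition operator_group :: "'x measure \<Rightarrow> 'x operator set \<Rightarrow> bool" where
  "operator_group M G \<longleftrightarrow>
     subgroup G (BijGroup (L2 M)) \<and>
     (\<forall>T \<in> G. unitary_operator M T \<and> isometric_algebra_hom_Linf M T)"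

section \<open>Filtrations and polynomial maps\<close>

text \<open>All groups of a prefiltration are subgroups of an ambient group \<open>H\<close>.\<close>

definition commutator_subgroup :: "('t, 'b) monoid_scheme \<Rightarrow> 't set \<Rightarrow> 't set \<Rightarrow> 't set" where
  "commutator_subgroup H A B =
     generate H (\<Union>x \<in> A. \<Union>y \<in> B. {x \<otimes>\<^bsub>H\<^esub> y \<otimes>\<^bsub>H\<^esub> inv\<^bsub>H\<^esub> x \<otimes>\<^bsub>H\<^esub> inv\<^bsub>H\<^esub> y})"

definition prefiltration :: "('t, 'b) monoid_scheme \<Rightarrow> (nat \<Rightarrow> 't set) \<Rightarrow> bool" where
  "prefiltration H Gs \<longleftrightarrow>
     (\<forall>i. subgroup (Gs i) H) \<and>
     (\<forall>i. Gs (Suc i) \<subseteq> Gs i) \<and>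
     (\<forall>i j. commutator_subgroup H (Gs i) (Gs j) \<subseteq> Gs (i + j))"

definition group_filtration :: "('t, 'b) monoid_scheme \<Rightarrow> 't set \<Rightarrow> (nat \<Rightarrow> 't set) \<Rightarrow> bool" where
  "group_filtration H G Gs \<longleftrightarrow> prefiltration H Gs \<and> Gs 0 = G \<and> Gs 1 = G"

text \<open>The second disjunct is length minus infinity.\<close>

definition finite_length :: "('t, 'b) monoid_scheme \<Rightarrow> (nat \<Rightarrow> 't set) \<Rightarrow> bool" where
  "finite_length H Gs \<longleftrightarrow> (\<exists>d. Gs (d + 1) = {\<one>\<^bsub>H\<^esub>}) \<or> Gs 0 = {\<one>\<^bsub>H\<^esub>}"

text \<open>
  The recursion on the length of \<open>Gs\<close> is rendered as an inductive predicate: it ends when the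
  prefiltration has length minus infinity, that is, when its first group is trivial. The shifted
  prefiltration is \<open>\<lambda>i. Gs (i + 1)\<close>.
\<close>

inductive polynomial_map ::
    "('t, 'b) monoid_scheme \<Rightarrow> (nat \<Rightarrow> 't set) \<Rightarrow> ('g::group_add \<Rightarrow> 't) \<Rightarrow> bool" for H where
  trivial: "polynomial_map H Gs g" if "Gs 0 = {\<one>\<^bsub>H\<^esub>}" and "\<forall>n. g n = \<one>\<^bsub>H\<^esub>"
| derivative: "polynomial_map H Gs g"
    if "\<forall>n. g n \<in> Gs 0"
    and "\<forall>a b. polynomial_map H (\<lambda>i. Gs (i + 1)) (\<lambda>n. inv\<^bsub>H\<^esub> (g n) \<otimes>\<^bsub>H\<^esub> g (a + n + b))"

section \<open>Measurability and averages\<close>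

text \<open>
  A map into \<open>L2 M\<close> is measurable in the sense of Bochner if on every compact set it is
  almost everywhere a limit of simple functions, and a map into the operators is measurable if
  all its orbit maps are. If \<open>L2 M\<close> is separable this is the same as weak measurability;
  otherwise weak measurability is not inherited by the pointwise products that are averaged below.
\<close>

definition L2_measurable ::
    "'x measure \<Rightarrow> 'g::topological_space measure \<Rightarrow> ('g \<Rightarrow> ('x \<Rightarrow> complex) set) \<Rightarrow> bool" where
  "L2_measurable M \<mu> F \<longleftrightarrow>
     (\<forall>K. compact K \<longrightarrow>
        (\<exists>s :: nat \<Rightarrow> 'g \<Rightarrow> ('x \<Rightarrow> complex) set.
           (\<forall>i. simple_function \<mu> (s i) \<and> (\<forall>n. s i n \<in> L2 M)) \<and>
           (AE n in \<mu>. n \<in> K \<longrightarrow> (\<lambda>i. L2_dist M (s i n) (F n)) \<longlonglongrightarrow> 0)))"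

definition operator_measurable ::
    "'x measure \<Rightarrow> 'g::topological_space measure \<Rightarrow> ('g \<Rightarrow> 'x operator) \<Rightarrow> bool" where
  "operator_measurable M \<mu> g \<longleftrightarrow> (\<forall>u \<in> L2 M. L2_measurable M \<mu> (\<lambda>n. g n u))"

text \<open>
  The average of \<open>F\<close> over \<open>I\<close>, an element of \<open>L2 M\<close>. The vector-valued integral is determined by
  its inner products with all elements of \<open>L2 M\<close>; for the bounded measurable \<open>F\<close> considered here
  this is the Bochner integral. The completion is needed because such \<open>F\<close> is Borel only up to null
  sets.
\<close>

definition is_average ::
    "'x measure \<Rightarrow> 'g measure \<Rightarrow> 'g set \<Rightarrow> ('g \<Rightarrow> ('x \<Rightarrow> complex) set) \<Rightarrow> ('x \<Rightarrow> complex) set \<Rightarrow> bool" where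
  "is_average M \<mu> I F v \<longleftrightarrow>
     v \<in> L2 M \<and>
     (\<forall>h \<in> L2 M.
        set_integrable (completion \<mu>) I (\<lambda>n. L2_inner M (F n) h) \<and>
        L2_inner M v h =
          of_real (1 / measure \<mu> I) * set_lebesgue_integral (completion \<mu>) I (\<lambda>n. L2_inner M (F n) h))"

definition average ::
    "'x measure \<Rightarrow> 'g measure \<Rightarrow> 'g set \<Rightarrow> ('g \<Rightarrow> ('x \<Rightarrow> complex) set) \<Rightarrow> ('x \<Rightarrow> complex) set" where
  "average M \<mu> I F = (THE v. is_average M \<mu> I F v)"

text \<open>\<open>multi_product M f g j m\<close> is the product of \<open>f 0\<close> and of \<open>g i m (f i)\<close> for \<open>1 \<le> i \<le> j\<close>.\<close>

primrec multi_product ::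
    "'x measure \<Rightarrow> (nat \<Rightarrow> ('x \<Rightarrow> complex) set) \<Rightarrow> (nat \<Rightarrow> 'g \<Rightarrow> 'x operator) \<Rightarrow> nat \<Rightarrow> 'g
       \<Rightarrow> ('x \<Rightarrow> complex) set" where
  "multi_product M f g 0 m = f 0"
| "multi_product M f g (Suc j) m = cl_mult M (multi_product M f g j m) (g (Suc j) m (f (Suc j)))"

text \<open>\<open>L\<close> is the limit in \<open>L2 M\<close> of the averages of \<open>F\<close> over the translates \<open>a \<alpha> + \<Phi> \<alpha>\<close>.\<close>

definition averages_converge ::
    "'x measure \<Rightarrow> 'g::plus measure \<Rightarrow> ('g \<Rightarrow> ('x \<Rightarrow> complex) set) \<Rightarrow> 'i set \<Rightarrow> ('i \<Rightarrow> 'i \<Rightarrow> bool)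
       \<Rightarrow> ('i \<Rightarrow> 'g set) \<Rightarrow> ('i \<Rightarrow> 'g) \<Rightarrow> ('x \<Rightarrow> complex) set \<Rightarrow> bool" where
  "averages_converge M \<mu> F A rel \<Phi> a L \<longleftrightarrow>
     ((\<lambda>\<alpha>. L2_dist M (average M \<mu> ((+) (a \<alpha>) ` \<Phi> \<alpha>) F) L) \<longlongrightarrow> 0) (net_filter A rel)"

end

theory Submission imports Defs begin

text \<open>
  The averages are shown to form a Cauchy net, by a finitary argument in the style of Walsh and Tao. For
  the limit to be the same for all Foelner nets and all shifts, it suffices that any two averages that are
  sufficiently invariant, namely up to some \<open>\<delta>\<close> under the translations from some compact set, are close
  to each other; the \<open>\<delta>\<close> and the compact set may depend on the data of the problem, but not on the
  averages. The limit then exists by completeness (\<open>averages_limit\<close>), and the averages in a Foelner net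
  eventually satisfy any given demand for invariance (\<open>folner_net_converge\<close>).

  Preparations. Polynomial maps form a group (\<open>pmap_mult\<close>, \<open>pmap_inv\<close>), and the measurable ones are
  strongly continuous (\<open>measurable_polynomial_strongly_continuous\<close>). Hence all averages exist, and they
  are approximated by finite sums, uniformly over compact sets of translations (\<open>quadrature\<close>). This
  replaces all exchanges of integrals, which would be delicate as the Haar measure need not be sigma-finite.

  Metastability. If invariance did not force closeness, one could choose pairs of averages that are far
  apart one after the other, each nearly invariant under all arguments that the earlier pairs involve.
  Such a sequence is called a chain. It is therefore enough to show that a chain whose length exceeds some
  bound contains a pair of averages that are close (\<open>metastable_all\<close>). This is proved by induction on the
  complexity of the system of maps \<open>1, g\<^sub>1, \<dots>, g\<^sub>j\<close>. The complexity is the number of reductions that make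
  the system trivial, where a reduction removes a map \<open>g\<close> and adds the brackets
  \<open>n \<mapsto> g n (g (a + n + b))\<^sup>-\<^sup>1 h (a + n + b)\<close> of \<open>g\<close> with the remaining maps \<open>h\<close>. As a bracket differs from \<open>h\<close> by a
  derivative, the number of reductions is finite, and bounded in terms of the number of maps, by the
  polynomial exhaustion argument (\<open>bounded_cplx_all\<close>).

  The induction step. Let \<open>P n \<cdot> g n \<phi>\<close> be the product to be averaged, with \<open>P n\<close> a product along the
  remaining maps. The square of the norm of an average of \<open>P n \<cdot> g n u\<close> is a pairing of \<open>u\<close> with a dual
  function \<open>\<sigma>\<close>, namely an average of \<open>(g n)\<^sup>-\<^sup>1\<close> applied to the product of a fixed function with the conjugate
  of \<open>P n\<close> (\<open>average_pairing\<close>). By near invariance the average may be translated by an earlier argument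
  \<open>l\<close>, which shows that \<open>g l \<sigma>\<close> is, for all such \<open>l\<close>, an average of products along the brackets at \<open>l\<close>;
  such \<open>\<sigma>\<close> are called structured (\<open>dual_structured\<close>). An energy decrement argument splits \<open>\<phi>\<close> into a
  combination of structured functions with bounded coefficients and a remainder that is nearly orthogonal
  to the functions structured at the next stage (\<open>energy_decomposition\<close>). The remainder contributes little
  to the averages. A structured function in place of \<open>\<phi>\<close> leads to averages of products along the reduced
  system, to which the induction hypothesis applies (\<open>structured_gap_sum_le\<close>).
\<close>

section \<open>Square-integrable functions\<close>

definition sq_int :: "'x measure \<Rightarrow> ('x \<Rightarrow> complex) set" where
  "sq_int M = {f \<in> borel_measurable M. integrable M (\<lambda>x. (cmod (f x))\<^sup>2)}"

definition ip :: "'x measure \<Rightarrow> ('x \<Rightarrow> complex) \<Rightarrow> ('x \<Rightarrow> complex) \<Rightarrow> complex" where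
  "ip M f g = (\<integral>x. f x * cnj (g x) \<partial>M)"

definition nrm :: "'x measure \<Rightarrow> ('x \<Rightarrow> complex) \<Rightarrow> real" where
  "nrm M f = sqrt (\<integral>x. (cmod (f x))\<^sup>2 \<partial>M)"

definition bdd :: "'x measure \<Rightarrow> real \<Rightarrow> ('x \<Rightarrow> complex) set" where
  "bdd M C = {f \<in> borel_measurable M. AE x in M. cmod (f x) \<le> C}"

lemma borel_measurable_cnj [measurable (raw)]:
  "f \<in> borel_measurable M \<Longrightarrow> (\<lambda>x. cnj (f x)) \<in> borel_measurable M"
  by (rule borel_measurable_continuous_on[of cnj]) (auto intro: continuous_intros)

lemma sq_intI: "f \<in> borel_measurable M \<Longrightarrow> integrable M (\<lambda>x. (cmod (f x))\<^sup>2) \<Longrightarrow> f \<in> sq_int M"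
  by (simp add: sq_int_def)

lemma bddI: "f \<in> borel_measurable M \<Longrightarrow> AE x in M. cmod (f x) \<le> C \<Longrightarrow> f \<in> bdd M C"
  by (simp add: bdd_def)

lemma sq_intD [measurable_dest, simp]: "f \<in> sq_int M \<Longrightarrow> f \<in> borel_measurable M"
  and sq_intD2: "f \<in> sq_int M \<Longrightarrow> integrable M (\<lambda>x. (cmod (f x))\<^sup>2)"
  by (auto simp: sq_int_def)

lemma bddD [measurable_dest]: "f \<in> bdd M C \<Longrightarrow> f \<in> borel_measurable M"
  and bdd_AE: "f \<in> bdd M C \<Longrightarrow> AE x in M. cmod (f x) \<le> C"
  by (auto simp: bdd_def)

lemma sq_int_prod:
  assumes "f \<in> sq_int M" "g \<in> sq_int M"
  shows "integrable M (\<lambda>x. f x * g x)" "integrable M (\<lambda>x. cmod (f x) * cmod (g x))"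
proof -
  have i: "integrable M (\<lambda>x. (cmod (f x))\<^sup>2 + (cmod (g x))\<^sup>2)"
    using assms by (auto intro: sq_intD2)
  have b: "a * b \<le> a\<^sup>2 + b\<^sup>2" if "a \<ge> 0" "b \<ge> 0" for a b :: real
    using sum_squares_bound[of a b] mult_nonneg_nonneg[OF that] by linarith
  show "integrable M (\<lambda>x. f x * g x)" "integrable M (\<lambda>x. cmod (f x) * cmod (g x))"
    using assms by (auto intro!: Bochner_Integration.integrable_bound[OF i] simp: norm_mult b)
qed

lemma sq_int_cnj: "f \<in> sq_int M \<Longrightarrow> (\<lambda>x. cnj (f x)) \<in> sq_int M"
  by (intro sq_intI borel_measurable_cnj) (auto dest: sq_intD2)

lemma sq_int_ip: "f \<in> sq_int M \<Longrightarrow> g \<in> sq_int M \<Longrightarrow> integrable M (\<lambda>x. f x * cnj (g x))"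
  by (intro sq_int_prod sq_int_cnj)

lemma sq_int_cmult: "f \<in> sq_int M \<Longrightarrow> (\<lambda>x. c * f x) \<in> sq_int M"
  by (intro sq_intI) (auto simp: norm_mult power_mult_distrib dest: sq_intD2)

lemma sq_int_zero: "(\<lambda>x. 0) \<in> sq_int M"
  by (intro sq_intI) (auto dest: sq_intD2)

lemma sq_int_add:
  assumes "f \<in> sq_int M" "g \<in> sq_int M"
  shows "(\<lambda>x. f x + g x) \<in> sq_int M"
proof -
  have i: "integrable M (\<lambda>x. (cmod (f x))\<^sup>2 + (cmod (g x))\<^sup>2 + 2 * (cmod (f x) * cmod (g x)))"
    using assms sq_int_prod(2)[OF assms] by (auto intro!: sq_intD2)
  have b: "(cmod (z + w))\<^sup>2 \<le> (cmod z)\<^sup>2 + (cmod w)\<^sup>2 + 2 * (cmod z * cmod w)" for z w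
    using power_mono[OF norm_triangle_ineq[of z w], of 2] by (simp add: power2_sum)
  have "integrable M (\<lambda>x. (cmod (f x + g x))\<^sup>2)"
    using assms b by (auto intro!: Bochner_Integration.integrable_bound[OF i])
  then show ?thesis using assms by (intro sq_intI) (auto dest: sq_intD2)
qed

lemma sq_int_minus: "f \<in> sq_int M \<Longrightarrow> (\<lambda>x. - f x) \<in> sq_int M"
  using sq_int_cmult[of f M "-1"] by simp

lemma sq_int_diff: "f \<in> sq_int M \<Longrightarrow> g \<in> sq_int M \<Longrightarrow> (\<lambda>x. f x - g x) \<in> sq_int M"
  using sq_int_add[of f M "\<lambda>x. - g x"] sq_int_minus[of g M] by simp

lemma sq_int_sum: "(\<And>t. t \<in> T \<Longrightarrow> F t \<in> sq_int M) \<Longrightarrow> (\<lambda>x. \<Sum>t\<in>T. c t * F t x) \<in> sq_int M"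
proof (induction T rule: infinite_finite_induct)
  case (insert a T)
  then have "(\<lambda>x. c a * F a x + (\<Sum>t\<in>T. c t * F t x)) \<in> sq_int M"
    by (intro sq_int_add sq_int_cmult) auto
  with insert show ?case by simp
qed (simp_all add: sq_int_zero)

lemma ip_cnj: "ip M g f = cnj (ip M f g)"
proof -
  have "ip M g f = (\<integral>x. cnj (f x * cnj (g x)) \<partial>M)" unfolding ip_def by (simp add: mult.commute)
  then show ?thesis unfolding ip_def by (simp only: Bochner_Integration.integral_cnj)
qed

lemma ip_add_left:
  "f \<in> sq_int M \<Longrightarrow> g \<in> sq_int M \<Longrightarrow> h \<in> sq_int M \<Longrightarrow>
    ip M (\<lambda>x. f x + g x) h = ip M f h + ip M g h"
  unfolding ip_def by (simp add: distrib_right sq_int_ip)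

lemma ip_diff_left:
  "f \<in> sq_int M \<Longrightarrow> g \<in> sq_int M \<Longrightarrow> h \<in> sq_int M \<Longrightarrow>
    ip M (\<lambda>x. f x - g x) h = ip M f h - ip M g h"
  unfolding ip_def by (simp add: left_diff_distrib sq_int_ip)

lemma ip_cmult_left: "ip M (\<lambda>x. c * f x) h = c * ip M f h"
  unfolding ip_def by (simp add: mult.assoc)

lemma ip_zero_left: "ip M (\<lambda>x. 0) h = 0"
  unfolding ip_def by simp

lemma ip_sum_left:
  assumes "h \<in> sq_int M"
  shows "(\<And>t. t \<in> T \<Longrightarrow> F t \<in> sq_int M) \<Longrightarrow>
    ip M (\<lambda>x. \<Sum>t\<in>T. c t * F t x) h = (\<Sum>t\<in>T. c t * ip M (F t) h)"
proof (induction T rule: infinite_finite_induct)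
  case (insert a T)
  have "ip M (\<lambda>x. \<Sum>t\<in>insert a T. c t * F t x) h = ip M (\<lambda>x. c a * F a x + (\<Sum>t\<in>T. c t * F t x)) h"
    using insert by simp
  also have "\<dots> = ip M (\<lambda>x. c a * F a x) h + ip M (\<lambda>x. \<Sum>t\<in>T. c t * F t x) h"
    using insert by (intro ip_add_left assms sq_int_cmult sq_int_sum) auto
  finally show ?case using insert by (simp add: ip_cmult_left)
qed (auto simp: ip_zero_left)

lemma ip_diff_right:
  "f \<in> sq_int M \<Longrightarrow> g \<in> sq_int M \<Longrightarrow> h \<in> sq_int M \<Longrightarrow>
    ip M h (\<lambda>x. f x - g x) = ip M h f - ip M h g"
  by (subst (1 2 3) ip_cnj) (simp add: ip_diff_left)

lemma ip_cmult_right: "ip M h (\<lambda>x. c * f x) = cnj c * ip M h f"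
  by (subst (1 2) ip_cnj) (simp add: ip_cmult_left)

lemma ip_cong_AE:
  assumes "AE x in M. f x = f' x" "AE x in M. g x = g' x"
    "f \<in> borel_measurable M" "f' \<in> borel_measurable M" "g \<in> borel_measurable M" "g' \<in> borel_measurable M"
  shows "ip M f g = ip M f' g'"
  unfolding ip_def using assms by (intro integral_cong_AE) auto

lemma nrm_nonneg [simp]: "nrm M f \<ge> 0"
  by (simp add: nrm_def)

lemma nrm_sq: "(nrm M f)\<^sup>2 = (\<integral>x. (cmod (f x))\<^sup>2 \<partial>M)"
  by (simp add: nrm_def)

lemma ip_self: "ip M f f = of_real ((nrm M f)\<^sup>2)"
  unfolding nrm_sq ip_def by (simp add: complex_norm_square[symmetric] del: of_real_power)

lemma nrm_zero [simp]: "nrm M (\<lambda>x. 0) = 0"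
  by (simp add: nrm_def)

lemma nrm_cmult: "nrm M (\<lambda>x. c * f x) = cmod c * nrm M f"
  by (simp add: nrm_def norm_mult power_mult_distrib real_sqrt_mult)

lemma nrm_minus_commute: "nrm M (\<lambda>x. f x - g x) = nrm M (\<lambda>x. g x - f x)"
  by (simp add: nrm_def norm_minus_commute)

lemma nrm_eq_0_AE:
  assumes "f \<in> sq_int M" "nrm M f = 0"
  shows "AE x in M. f x = 0"
proof -
  have "(\<integral>x. (cmod (f x))\<^sup>2 \<partial>M) = 0" using assms nrm_sq[of M f] by simp
  then have "AE x in M. (cmod (f x))\<^sup>2 = 0"
    using integral_nonneg_eq_0_iff_AE[OF sq_intD2[OF assms(1)]] by simp
  then show ?thesis by simp
qed

lemma nrm_mono_AE:
  assumes "f \<in> borel_measurable M" "g \<in> sq_int M" "C \<ge> 0" "AE x in M. cmod (f x) \<le> C * cmod (g x)"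
  shows "f \<in> sq_int M" "nrm M f \<le> C * nrm M g"
proof -
  have le: "AE x in M. (cmod (f x))\<^sup>2 \<le> C\<^sup>2 * (cmod (g x))\<^sup>2"
    using assms(4) by eventually_elim (metis norm_ge_zero power_mono power_mult_distrib)
  have i: "integrable M (\<lambda>x. C\<^sup>2 * (cmod (g x))\<^sup>2)" using assms by (auto intro: sq_intD2)
  have j: "integrable M (\<lambda>x. (cmod (f x))\<^sup>2)"
    using assms le by (auto intro!: Bochner_Integration.integrable_bound[OF i])
  then show "f \<in> sq_int M" using assms by (auto intro!: sq_intI)
  have "(nrm M f)\<^sup>2 \<le> (\<integral>x. C\<^sup>2 * (cmod (g x))\<^sup>2 \<partial>M)"
    unfolding nrm_sq by (rule integral_mono_AE[OF j i le])
  also have "\<dots> = (C * nrm M g)\<^sup>2" by (simp add: nrm_sq power_mult_distrib)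
  finally show "nrm M f \<le> C * nrm M g" using assms by (auto intro: power2_le_imp_le)
qed

lemma nrm_cong_AE: "AE x in M. f x = g x \<Longrightarrow> f \<in> borel_measurable M \<Longrightarrow> g \<in> borel_measurable M \<Longrightarrow>
    nrm M f = nrm M g"
  unfolding nrm_def by (intro arg_cong[of _ _ sqrt] integral_cong_AE) auto

lemma cauchy_schwarz_abs:
  assumes f: "f \<in> sq_int M" and g: "g \<in> sq_int M"
  shows "(\<integral>x. cmod (f x) * cmod (g x) \<partial>M) \<le> nrm M f * nrm M g"
proof (cases "nrm M f = 0 \<or> nrm M g = 0")
  case True
  then have "AE x in M. cmod (f x) * cmod (g x) = 0"
    using nrm_eq_0_AE[OF f] nrm_eq_0_AE[OF g] by auto
  then have "(\<integral>x. cmod (f x) * cmod (g x) \<partial>M) = (\<integral>x. 0 \<partial>M)"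
    using assms by (intro integral_cong_AE) auto
  then show ?thesis by simp
next
  case False
  define s where "s = nrm M g / nrm M f"
  have pos: "nrm M f > 0" "nrm M g > 0"
    using False nrm_nonneg[of M f] nrm_nonneg[of M g] by linarith+
  then have s: "s > 0" by (simp add: s_def)
  have "a * b \<le> (s * a\<^sup>2 + b\<^sup>2 / s) / 2" for a b :: real
  proof -
    have "0 \<le> (s * a - b)\<^sup>2 / s" using s by simp
    also have "\<dots> = s * a\<^sup>2 + b\<^sup>2 / s - 2 * (a * b)" using s
      by (simp add: power2_diff field_simps power2_eq_square)
    finally show ?thesis by simp
  qed
  then have "(\<integral>x. cmod (f x) * cmod (g x) \<partial>M) \<le> (\<integral>x. (s * (cmod (f x))\<^sup>2 + (cmod (g x))\<^sup>2 / s) / 2 \<partial>M)"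
    using sq_intD2[OF f] sq_intD2[OF g] by (intro integral_mono sq_int_prod assms) auto
  also have "\<dots> = (s * (nrm M f)\<^sup>2 + (nrm M g)\<^sup>2 / s) / 2"
    using assms by (simp add: nrm_sq sq_intD2)
  also have "\<dots> = nrm M f * nrm M g"
    using pos by (simp add: s_def power2_eq_square field_simps)
  finally show ?thesis .
qed

lemma cauchy_schwarz:
  assumes "f \<in> sq_int M" "g \<in> sq_int M"
  shows "cmod (ip M f g) \<le> nrm M f * nrm M g"
proof -
  have "cmod (ip M f g) \<le> (\<integral>x. cmod (f x * cnj (g x)) \<partial>M)"
    unfolding ip_def by (rule integral_norm_bound)
  also have "\<dots> = (\<integral>x. cmod (f x) * cmod (g x) \<partial>M)" by (simp add: norm_mult)
  finally show ?thesis using cauchy_schwarz_abs[OF assms] by linarith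
qed

lemma nrm_triangle:
  assumes "f \<in> sq_int M" "g \<in> sq_int M"
  shows "nrm M (\<lambda>x. f x + g x) \<le> nrm M f + nrm M g"
proof -
  have b: "(cmod (z + w))\<^sup>2 \<le> (cmod z)\<^sup>2 + (cmod w)\<^sup>2 + 2 * (cmod z * cmod w)" for z w
    using power_mono[OF norm_triangle_ineq[of z w], of 2] by (simp add: power2_sum)
  have "(nrm M (\<lambda>x. f x + g x))\<^sup>2 \<le>
      (\<integral>x. (cmod (f x))\<^sup>2 + (cmod (g x))\<^sup>2 + 2 * (cmod (f x) * cmod (g x)) \<partial>M)"
    unfolding nrm_sq using b sq_int_prod(2)[OF assms] sq_intD2[OF assms(1)] sq_intD2[OF assms(2)]
    by (intro integral_mono sq_intD2[OF sq_int_add] assms) auto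
  also have "\<dots> = (nrm M f)\<^sup>2 + (nrm M g)\<^sup>2 + 2 * (\<integral>x. cmod (f x) * cmod (g x) \<partial>M)"
    using assms sq_int_prod(2)[OF assms] by (simp add: nrm_sq sq_intD2)
  also have "\<dots> \<le> (nrm M f + nrm M g)\<^sup>2"
    using cauchy_schwarz_abs[OF assms] by (simp add: power2_sum)
  finally show ?thesis by (rule power2_le_imp_le) simp
qed

lemma nrm_triangle_diff:
  assumes "f \<in> sq_int M" "g \<in> sq_int M" "h \<in> sq_int M"
  shows "nrm M (\<lambda>x. f x - h x) \<le> nrm M (\<lambda>x. f x - g x) + nrm M (\<lambda>x. g x - h x)"
  using nrm_triangle[of "\<lambda>x. f x - g x" M "\<lambda>x. g x - h x"] assms by (simp add: sq_int_diff)

lemma nrm_diff_le: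
  assumes "f \<in> sq_int M" "g \<in> sq_int M"
  shows "nrm M (\<lambda>x. f x - g x) \<le> nrm M f + nrm M g"
  using nrm_triangle[of f M "\<lambda>x. - 1 * g x"] nrm_cmult[of M "-1" g] assms by (simp add: sq_int_minus)

lemma nrm_sum_le:
  "(\<And>t. t \<in> T \<Longrightarrow> F t \<in> sq_int M) \<Longrightarrow>
    nrm M (\<lambda>x. \<Sum>t\<in>T. c t * F t x) \<le> (\<Sum>t\<in>T. cmod (c t) * nrm M (F t))"
proof (induction T rule: infinite_finite_induct)
  case (insert a T)
  have "nrm M (\<lambda>x. \<Sum>t\<in>insert a T. c t * F t x) = nrm M (\<lambda>x. c a * F a x + (\<Sum>t\<in>T. c t * F t x))"
    using insert by simp
  also have "\<dots> \<le> nrm M (\<lambda>x. c a * F a x) + nrm M (\<lambda>x. \<Sum>t\<in>T. c t * F t x)"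
    using insert by (intro nrm_triangle sq_int_cmult sq_int_sum) auto
  also have "\<dots> \<le> cmod (c a) * nrm M (F a) + (\<Sum>t\<in>T. cmod (c t) * nrm M (F t))"
    using insert by (simp add: nrm_cmult)
  finally show ?case using insert by simp
qed auto

text \<open>A vector is bounded by its pairings, because it may be paired with itself.\<close>

lemma nrm_le_if_ip_le:
  assumes v: "v \<in> sq_int M" and B: "0 \<le> B"
    and le: "\<And>h. h \<in> sq_int M \<Longrightarrow> cmod (ip M v h) \<le> B * nrm M h"
  shows "nrm M v \<le> B"
proof -
  have "cmod (ip M v v) = nrm M v * nrm M v" unfolding ip_self norm_of_real by (simp add: power2_eq_square)
  then have "nrm M v * nrm M v \<le> B * nrm M v" using le[OF v] by simp
  then have "nrm M v \<le> B" if "nrm M v > 0" using that by (rule mult_right_le_imp_le)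
  then show ?thesis using nrm_nonneg[of M v] B by linarith
qed

lemma ip_eq_imp_AE:
  assumes "v \<in> sq_int M" "w \<in> sq_int M" and eq: "\<And>h. h \<in> sq_int M \<Longrightarrow> ip M v h = ip M w h"
  shows "AE x in M. v x = w x"
proof -
  have s: "(\<lambda>x. v x - w x) \<in> sq_int M" using assms by (simp add: sq_int_diff)
  have "ip M (\<lambda>x. v x - w x) (\<lambda>x. v x - w x) = 0"
    using assms s by (simp add: ip_diff_left)
  then have "nrm M (\<lambda>x. v x - w x) = 0" by (simp add: ip_self)
  from nrm_eq_0_AE[OF s this] show ?thesis by simp
qed

subsection \<open>Bounded functions\<close>

lemma bdd_mono: "f \<in> bdd M C \<Longrightarrow> C \<le> D \<Longrightarrow> f \<in> bdd M D"
  unfolding bdd_def by (auto elim: eventually_mono)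

lemma bdd_mult:
  assumes "f \<in> bdd M C" "g \<in> bdd M D" "C \<ge> 0"
  shows "(\<lambda>x. f x * g x) \<in> bdd M (C * D)"
proof (rule bddI)
  show "AE x in M. cmod (f x * g x) \<le> C * D"
    using bdd_AE[OF assms(1)] bdd_AE[OF assms(2)]
  proof eventually_elim
    case (elim x)
    then show ?case unfolding norm_mult using assms(3) by (rule mult_mono) simp
  qed
qed (intro borel_measurable_times bddD[OF assms(1)] bddD[OF assms(2)])

lemma bdd_mult_sq_int:
  assumes "f \<in> bdd M C" "g \<in> sq_int M" "C \<ge> 0"
  shows "(\<lambda>x. f x * g x) \<in> sq_int M" "nrm M (\<lambda>x. f x * g x) \<le> C * nrm M g"
proof -
  have "AE x in M. cmod (f x * g x) \<le> C * cmod (g x)"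
    using bdd_AE[OF assms(1)] by eventually_elim (simp add: norm_mult mult_right_mono)
  moreover have "(\<lambda>x. f x * g x) \<in> borel_measurable M"
    using bddD[OF assms(1)] sq_intD[OF assms(2)] by (rule borel_measurable_times)
  ultimately show "(\<lambda>x. f x * g x) \<in> sq_int M" "nrm M (\<lambda>x. f x * g x) \<le> C * nrm M g"
    using nrm_mono_AE assms by blast+
qed

lemma bdd_cnj:
  assumes "f \<in> bdd M C"
  shows "(\<lambda>x. cnj (f x)) \<in> bdd M C"
  using bdd_AE[OF assms] by (intro bddI borel_measurable_cnj bddD[OF assms]) simp

lemma bdd_add:
  assumes "f \<in> bdd M C" "g \<in> bdd M D"
  shows "(\<lambda>x. f x + g x) \<in> bdd M (C + D)"
proof -
  have "AE x in M. cmod (f x + g x) \<le> C + D"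
    using bdd_AE[OF assms(1)] bdd_AE[OF assms(2)] by eventually_elim (rule norm_triangle_mono)
  then show ?thesis using assms by (auto intro!: bddI)
qed

lemma bdd_cmult:
  assumes "f \<in> bdd M C"
  shows "(\<lambda>x. c * f x) \<in> bdd M (cmod c * C)"
proof -
  have "AE x in M. cmod (c * f x) \<le> cmod c * C"
    using bdd_AE[OF assms] by eventually_elim (simp add: norm_mult mult_left_mono)
  then show ?thesis using assms by (auto intro!: bddI)
qed

lemma bdd_diff: "f \<in> bdd M C \<Longrightarrow> g \<in> bdd M D \<Longrightarrow> (\<lambda>x. f x - g x) \<in> bdd M (C + D)"
  using bdd_add[of f M C "\<lambda>x. -1 * g x" D] bdd_cmult[of g M D "-1"] by simp

lemma bdd_const: "cmod c \<le> C \<Longrightarrow> (\<lambda>x. c) \<in> bdd M C"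
  by (auto intro!: bddI dest: bdd_AE)

lemma bdd_sum: "(\<And>t. t \<in> T \<Longrightarrow> F t \<in> bdd M 1) \<Longrightarrow>
    (\<lambda>x. \<Sum>t\<in>T. c t * F t x) \<in> bdd M (\<Sum>t\<in>T. cmod (c t))"
proof (induction T rule: infinite_finite_induct)
  case (insert a T)
  have "(\<lambda>x. c a * F a x) \<in> bdd M (cmod (c a) * 1)" using insert by (intro bdd_cmult) auto
  from bdd_add[OF this insert.IH] insert show ?case by simp
qed (auto intro: bdd_const)

lemma bdd_prod: "(\<And>t. t \<in> T \<Longrightarrow> F t \<in> bdd M 1) \<Longrightarrow> (\<lambda>x. \<Prod>t\<in>T. F t x) \<in> bdd M 1"
proof (induction T rule: infinite_finite_induct)
  case (insert a T)
  then have "(\<lambda>x. F a x * (\<Prod>t\<in>T. F t x)) \<in> bdd M (1 * 1)" by (intro bdd_mult) auto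
  with insert show ?case by simp
qed (auto intro: bdd_const)

lemma nrm_mult_diff_le:
  assumes "f \<in> bdd M C" "f' \<in> sq_int M" "g \<in> sq_int M" "g' \<in> bdd M D"
    "g' \<in> sq_int M" "f \<in> sq_int M" "C \<ge> 0" "D \<ge> 0"
  shows "nrm M (\<lambda>x. f x * g x - f' x * g' x) \<le>
    C * nrm M (\<lambda>x. g x - g' x) + D * nrm M (\<lambda>x. f x - f' x)"
proof -
  have *: "(\<lambda>x. f x * (g x - g' x)) \<in> sq_int M" "nrm M (\<lambda>x. f x * (g x - g' x)) \<le> C * nrm M (\<lambda>x. g x - g' x)"
     "(\<lambda>x. g' x * (f x - f' x)) \<in> sq_int M" "nrm M (\<lambda>x. g' x * (f x - f' x)) \<le> D * nrm M (\<lambda>x. f x - f' x)"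
    using assms by (auto intro!: bdd_mult_sq_int sq_int_diff)
  have "(\<lambda>x. f x * g x - f' x * g' x) = (\<lambda>x. f x * (g x - g' x) + g' x * (f x - f' x))"
    by (auto simp: algebra_simps)
  then show ?thesis using nrm_triangle[OF *(1,3)] *(2,4) by simp
qed

context prob_space
begin

lemma one_sq_int: "(\<lambda>x. 1) \<in> sq_int M"
  by (intro sq_intI) (auto dest: sq_intD2)

lemma nrm_one: "nrm M (\<lambda>x. 1) = 1"
  by (simp add: nrm_def prob_space)

lemma bdd_nonneg:
  assumes "f \<in> bdd M C"
  shows "C \<ge> 0"
proof -
  have "AE x in M. 0 \<le> C"
    using bdd_AE[OF assms] by eventually_elim (rule order_trans[OF norm_ge_zero])
  then show ?thesis by simp
qed

lemma bdd_sq_int: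
  assumes "f \<in> bdd M C"
  shows "f \<in> sq_int M" "nrm M f \<le> C"
proof -
  have "(\<lambda>x. f x * 1) \<in> sq_int M" "nrm M (\<lambda>x. f x * 1) \<le> C * nrm M (\<lambda>x. 1)"
    by (rule bdd_mult_sq_int[OF assms one_sq_int bdd_nonneg[OF assms]])+
  then show "f \<in> sq_int M" "nrm M f \<le> C" by (simp_all only: nrm_one mult_1_right)
qed

text \<open>Test against the phase of \<open>v\<close>, cut off to the set where the modulus of \<open>v\<close> exceeds \<open>C\<close>.\<close>

lemma bdd_if_ip_le:
  assumes v: "v \<in> sq_int M" and C: "C \<ge> 0"
    and le: "\<And>h. h \<in> bdd M 1 \<Longrightarrow> cmod (ip M v h) \<le> C * (\<integral>x. cmod (h x) \<partial>M)"
  shows "v \<in> bdd M C"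
proof -
  have [measurable]: "v \<in> borel_measurable M" using v by simp
  define h where "h x = (if cmod (v x) > C then sgn (v x) else 0)" for x
  have hm [measurable]: "h \<in> borel_measurable M" unfolding h_def sgn_div_norm scaleR_conv_of_real by measurable
  have hb: "h \<in> bdd M 1" using hm by (auto intro!: bddI simp: h_def norm_sgn)
  have vh: "v x * cnj (h x) = of_real (if cmod (v x) > C then cmod (v x) else 0)" for x
  proof -
    have "v x * cnj (v x) = of_real (cmod (v x)) * of_real (cmod (v x))"
      by (simp add: complex_norm_square[symmetric] power2_eq_square[symmetric])
    then show ?thesis by (auto simp: h_def sgn_div_norm divide_simps scaleR_conv_of_real)
  qed
  have ih: "integrable M (\<lambda>x. cmod (h x))"
    by (rule Bochner_Integration.integrable_bound[of M "\<lambda>x. 1::real"]) (auto simp: h_def norm_sgn)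
  have iv: "integrable M (\<lambda>x. if cmod (v x) > C then cmod (v x) else 0)"
    by (rule Bochner_Integration.integrable_bound[of M "\<lambda>x. cmod (v x)"])
      (use sq_int_prod(2)[OF v one_sq_int] in auto)
  have "ip M v h = of_real (\<integral>x. (if cmod (v x) > C then cmod (v x) else 0) \<partial>M)"
    unfolding ip_def vh by (rule integral_complex_of_real)
  then have "(\<integral>x. (if cmod (v x) > C then cmod (v x) else 0) \<partial>M) \<le> (\<integral>x. C * cmod (h x) \<partial>M)"
    using le[OF hb] by (simp add: integral_nonneg_AE)
  then have "(\<integral>x. (if cmod (v x) > C then cmod (v x) else 0) - C * cmod (h x) \<partial>M) \<le> 0"
    using ih iv by simp
  moreover have nn: "AE x in M. 0 \<le> (if cmod (v x) > C then cmod (v x) else 0) - C * cmod (h x)"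
    using C by (auto simp: h_def norm_sgn)
  ultimately have "(\<integral>x. (if cmod (v x) > C then cmod (v x) else 0) - C * cmod (h x) \<partial>M) = 0"
    using integral_nonneg_AE[OF nn] by linarith
  then have "AE x in M. (if cmod (v x) > C then cmod (v x) else 0) - C * cmod (h x) = 0"
    using integral_nonneg_eq_0_iff_AE[OF _ nn] ih iv by simp
  then have "AE x in M. cmod (v x) \<le> C"
  proof eventually_elim
    case (elim x)
    then show ?case using C by (auto simp: h_def norm_sgn split: if_splits)
  qed
  then show ?thesis using v by (auto intro!: bddI)
qed

text \<open>The Riesz--Fischer theorem: the pointwise limit of a suitable subsequence is the limit.\<close>

lemma L2_complete:
  assumes X: "\<And>n. X n \<in> sq_int M"
    and cauchy: "\<And>e. e > 0 \<Longrightarrow> \<exists>N. \<forall>i\<ge>N. \<forall>k\<ge>N. nrm M (\<lambda>x. X i x - X k x) < e"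
  shows "\<exists>f \<in> sq_int M. (\<lambda>n. nrm M (\<lambda>x. X n x - f x)) \<longlonglongrightarrow> 0"
proof -
  have [measurable]: "X n \<in> borel_measurable M" for n using X by simp
  have int1: "integrable M (X n)" for n
    using sq_int_prod(1)[OF X one_sq_int] by simp
  have l1: "\<exists>N. \<forall>i\<ge>N. \<forall>k\<ge>N. (LINT x|M. norm (X i x - X k x)) < e" if e: "e > 0" for e
  proof -
    obtain N where N: "\<forall>i\<ge>N. \<forall>k\<ge>N. nrm M (\<lambda>x. X i x - X k x) < e" using cauchy[OF e] by blast
    have "(LINT x|M. norm (X i x - X k x)) \<le> nrm M (\<lambda>x. X i x - X k x)" for i k
      using cauchy_schwarz_abs[OF sq_int_diff[OF X X] one_sq_int] by (simp add: nrm_one)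
    then show ?thesis using N by (meson le_less_trans)
  qed
  obtain r where r: "strict_mono r" and ae: "AE x in M. Cauchy (\<lambda>i. X (r i) x)"
    by (rule cauchy_L1_AE_cauchy_subseq[OF int1 l1])
  define f where "f x = lim (\<lambda>i. X (r i) x)" for x
  have [measurable]: "f \<in> borel_measurable M" unfolding f_def by measurable
  have conv: "AE x in M. (\<lambda>i. X (r i) x) \<longlonglongrightarrow> f x"
    using ae unfolding f_def by (auto simp: Cauchy_convergent_iff convergent_LIMSEQ_iff)
  have fat: "(\<lambda>x. X n x - f x) \<in> sq_int M \<and> nrm M (\<lambda>x. X n x - f x) \<le> e"
    if e: "e > 0" and N: "\<forall>i\<ge>N. \<forall>k\<ge>N. nrm M (\<lambda>x. X i x - X k x) < e" and n: "n \<ge> N" for e N n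
  proof -
    have "(\<integral>\<^sup>+x. ennreal ((cmod (X n x - f x))\<^sup>2) \<partial>M) =
        (\<integral>\<^sup>+x. liminf (\<lambda>i. ennreal ((cmod (X n x - X (r i) x))\<^sup>2)) \<partial>M)"
    proof (rule nn_integral_cong_AE, use conv in eventually_elim)
      case (elim x)
      have "(\<lambda>i. ennreal ((cmod (X n x - X (r i) x))\<^sup>2)) \<longlonglongrightarrow> ennreal ((cmod (X n x - f x))\<^sup>2)"
        by (intro tendsto_ennrealI tendsto_intros elim)
      then show ?case by (simp add: lim_imp_Liminf[symmetric])
    qed
    also have "\<dots> \<le> liminf (\<lambda>i. \<integral>\<^sup>+x. ennreal ((cmod (X n x - X (r i) x))\<^sup>2) \<partial>M)"
      by (rule nn_integral_liminf) auto
    also have "\<dots> \<le> ennreal (e\<^sup>2)"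
    proof (rule Liminf_le)
      have "eventually (\<lambda>i. i \<ge> N) sequentially" by (rule eventually_ge_at_top)
      then show "\<forall>\<^sub>F i in sequentially. (\<integral>\<^sup>+x. ennreal ((cmod (X n x - X (r i) x))\<^sup>2) \<partial>M) \<le> ennreal (e\<^sup>2)"
      proof eventually_elim
        case (elim i)
        have "(\<integral>\<^sup>+x. ennreal ((cmod (X n x - X (r i) x))\<^sup>2) \<partial>M) = ennreal ((nrm M (\<lambda>x. X n x - X (r i) x))\<^sup>2)"
          unfolding nrm_sq by (rule nn_integral_eq_integral) (auto intro!: sq_intD2 sq_int_diff X)
        moreover have "nrm M (\<lambda>x. X n x - X (r i) x) < e"
          using N n elim seq_suble[OF r, of i] by (meson le_trans)
        ultimately show ?case using e by (auto intro!: ennreal_leI power_mono)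
      qed
    qed simp
    finally have le: "(\<integral>\<^sup>+x. ennreal ((cmod (X n x - f x))\<^sup>2) \<partial>M) \<le> ennreal (e\<^sup>2)" .
    have i: "integrable M (\<lambda>x. (cmod (X n x - f x))\<^sup>2)"
      by (rule integrableI_bounded) (use le in \<open>auto simp: top.not_eq_extremum intro: le_less_trans\<close>)
    then have "(\<lambda>x. X n x - f x) \<in> sq_int M" by (auto intro!: sq_intI)
    moreover have "(nrm M (\<lambda>x. X n x - f x))\<^sup>2 \<le> e\<^sup>2"
      using le unfolding nrm_sq by (subst (asm) nn_integral_eq_integral[OF i]) (auto simp: ennreal_le_iff)
    ultimately show ?thesis using e by (auto intro: power2_le_imp_le)
  qed
  obtain N1 where "\<forall>i\<ge>N1. \<forall>k\<ge>N1. nrm M (\<lambda>x. X i x - X k x) < 1" using cauchy[of 1] by auto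
  from fat[OF _ this order_refl] have "(\<lambda>x. X N1 x - f x) \<in> sq_int M" by simp
  from sq_int_diff[OF X[of N1] this] have f: "f \<in> sq_int M" by simp
  have "(\<lambda>n. nrm M (\<lambda>x. X n x - f x)) \<longlonglongrightarrow> 0"
  proof (rule LIMSEQ_I)
    fix e :: real assume "e > 0"
    then obtain N where N: "\<forall>i\<ge>N. \<forall>k\<ge>N. nrm M (\<lambda>x. X i x - X k x) < e/2" using cauchy[of "e/2"] by auto
    have "norm (nrm M (\<lambda>x. X n x - f x) - 0) < e" if "n \<ge> N" for n
      using fat[OF _ N that] \<open>e > 0\<close> by simp
    then show "\<exists>N. \<forall>n\<ge>N. norm (nrm M (\<lambda>x. X n x - f x) - 0) < e" by blast
  qed
  with f show ?thesis by blast
qed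

end

section \<open>Operators as maps of functions\<close>

text \<open>
  Operators map classes to classes, but products and conjugates are computed pointwise. Therefore
  \<open>act M T\<close> sends a function to a chosen representative of the image of its class; identities between
  such representatives hold almost everywhere.
\<close>

definition act :: "'x measure \<Rightarrow> 'x operator \<Rightarrow> ('x \<Rightarrow> complex) \<Rightarrow> 'x \<Rightarrow> complex" where
  "act M T f = rep (T (ae_class M f))"

lemma ae_class_cong:
  assumes "AE x in M. f x = g x"
  shows "ae_class M f = ae_class M g"
proof -
  have "(AE x in M. h x = f x) \<longleftrightarrow> (AE x in M. h x = g x)" for h
    by (rule eventually_cong[OF assms]) simp
  then show ?thesis by (simp add: ae_class_def)
qed

lemma rep_ae_class:
  assumes "f \<in> borel_measurable M"
  shows "rep (ae_class M f) \<in> borel_measurable M" "AE x in M. rep (ae_class M f) x = f x"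
proof -
  have "f \<in> ae_class M f" using assms by (simp add: ae_class_def)
  then have "rep (ae_class M f) \<in> ae_class M f" unfolding rep_def by (rule someI[of "\<lambda>h. h \<in> ae_class M f"])
  then show "rep (ae_class M f) \<in> borel_measurable M" "AE x in M. rep (ae_class M f) x = f x"
    by (auto simp: ae_class_def)
qed

lemma ae_class_rep: "f \<in> borel_measurable M \<Longrightarrow> ae_class M (rep (ae_class M f)) = ae_class M f"
  using rep_ae_class(2) by (rule ae_class_cong)

lemma sq_int_cong_AE:
  assumes "f \<in> sq_int M" "g \<in> borel_measurable M" "AE x in M. g x = f x"
  shows "g \<in> sq_int M"
proof -
  have "AE x in M. cmod (g x) \<le> 1 * cmod (f x)" using assms(3) by eventually_elim simp
  then show ?thesis using nrm_mono_AE(1)[OF assms(2,1), of 1] by simp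
qed

lemma rep_class_sq_int: "f \<in> sq_int M \<Longrightarrow> rep (ae_class M f) \<in> sq_int M"
  using sq_int_cong_AE rep_ae_class sq_intD by blast

lemma class_L2: "f \<in> sq_int M \<Longrightarrow> ae_class M f \<in> L2 M"
  unfolding L2_def using sq_intD sq_intD2 by blast

lemma L2_obtain:
  assumes "u \<in> L2 M"
  obtains f where "f \<in> sq_int M" "u = ae_class M f"
  using assms unfolding L2_def sq_int_def by blast

lemma L2_rep:
  assumes "u \<in> L2 M"
  shows "rep u \<in> sq_int M" "ae_class M (rep u) = u"
  proof -
  obtain f where "f \<in> sq_int M" "u = ae_class M f" using assms by (rule L2_obtain)
  then show "rep u \<in> sq_int M" "ae_class M (rep u) = u" by (simp_all add: rep_class_sq_int ae_class_rep)
qed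

lemma class_Linf:
  assumes "f \<in> bdd M C"
  shows "ae_class M f \<in> Linf M"
proof -
  have "esssup M (\<lambda>x. ereal (cmod (f x))) \<le> ereal C"
    using bddD[OF assms] bdd_AE[OF assms] by (intro esssup_I) auto
  then have "esssup M (\<lambda>x. ereal (cmod (f x))) < \<infinity>" by (rule le_less_trans) simp
  then show ?thesis unfolding Linf_def using bddD[OF assms] by blast
qed

lemma (in prob_space) Linf_bdd:
  assumes "u \<in> Linf M"
  obtains C where "C > 0" "rep u \<in> bdd M C" "ae_class M (rep u) = u"
proof -
  obtain f where f: "f \<in> borel_measurable M" and e: "esssup M (\<lambda>x. ereal (cmod (f x))) < \<infinity>"
    and u: "u = ae_class M f"
    using assms unfolding Linf_def by blast
  obtain C where C: "esssup M (\<lambda>x. ereal (cmod (f x))) < ereal C"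
    using e by (metis ereal_dense2)
  have "AE x in M. ereal (cmod (f x)) \<le> esssup M (\<lambda>x. ereal (cmod (f x)))" by (rule esssup_AE)
  then have "AE x in M. cmod (rep u x) \<le> max C 1"
    using rep_ae_class(2)[OF f] unfolding u
  proof eventually_elim
    case (elim x)
    then have "ereal (cmod (f x)) < ereal C" using C by (meson le_less_trans)
    then show ?case using elim by simp
  qed
  then have "rep u \<in> bdd M (max C 1)" using rep_ae_class(1)[OF f] unfolding u by (intro bddI)
  then show thesis using that[of "max C 1"] ae_class_rep[OF f] u by simp
qed

lemma Linf_norm_le_iff:
  assumes "f \<in> borel_measurable M" 
  shows "Linf_norm M (ae_class M f) \<le> ereal C \<longleftrightarrow> f \<in> bdd M C"
proof
  let ?e = "esssup M (\<lambda>x. ereal (cmod (rep (ae_class M f) x)))"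
  assume "Linf_norm M (ae_class M f) \<le> ereal C"
  then have le: "?e \<le> ereal C" by (simp add: Linf_norm_def)
  have "AE x in M. ereal (cmod (rep (ae_class M f) x)) \<le> ?e" by (rule esssup_AE)
  then have "AE x in M. cmod (f x) \<le> C"
    using rep_ae_class(2)[OF assms]
  proof eventually_elim
    case (elim x)
    then have "ereal (cmod (f x)) \<le> ereal C" using le by (metis order_trans)
    then show ?case by simp
  qed
  then show "f \<in> bdd M C" using assms by (intro bddI)
next
  assume f: "f \<in> bdd M C"
  have "AE x in M. ereal (cmod (rep (ae_class M f) x)) \<le> ereal C"
    using rep_ae_class(2)[OF assms] bdd_AE[OF f] by eventually_elim simp
  then show "Linf_norm M (ae_class M f) \<le> ereal C"
    unfolding Linf_norm_def using rep_ae_class(1)[OF assms] by (intro esssup_I) auto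
qed

lemma cl_add_class:
  assumes "f \<in> borel_measurable M" "g \<in> borel_measurable M"
  shows "cl_add M (ae_class M f) (ae_class M g) = ae_class M (\<lambda>x. f x + g x)"
  unfolding cl_add_def
  by (rule ae_class_cong, use rep_ae_class(2)[OF assms(1)] rep_ae_class(2)[OF assms(2)] in eventually_elim) simp

lemma cl_mult_class:
  assumes "f \<in> borel_measurable M" "g \<in> borel_measurable M"
  shows "cl_mult M (ae_class M f) (ae_class M g) = ae_class M (\<lambda>x. f x * g x)"
  unfolding cl_mult_def
  by (rule ae_class_cong, use rep_ae_class(2)[OF assms(1)] rep_ae_class(2)[OF assms(2)] in eventually_elim) simp

lemma cl_scale_class:
  assumes "f \<in> borel_measurable M"
  shows "cl_scale M c (ae_class M f) = ae_class M (\<lambda>x. c * f x)"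
  unfolding cl_scale_def by (rule ae_class_cong, use rep_ae_class(2)[OF assms(1)] in eventually_elim) simp

lemma L2_inner_class:
  assumes "f \<in> borel_measurable M" "g \<in> borel_measurable M"
  shows "L2_inner M (ae_class M f) (ae_class M g) = ip M f g"
proof -
  have "L2_inner M (ae_class M f) (ae_class M g) = ip M (rep (ae_class M f)) (rep (ae_class M g))"
    by (simp add: L2_inner_def ip_def)
  also have "\<dots> = ip M f g" by (intro ip_cong_AE rep_ae_class assms)
  finally show ?thesis .
qed

lemma L2_dist_class:
  assumes "f \<in> borel_measurable M" "g \<in> borel_measurable M"
  shows "L2_dist M (ae_class M f) (ae_class M g) = nrm M (\<lambda>x. f x - g x)"
proof -
  have "AE x in M. rep (ae_class M f) x - rep (ae_class M g) x = f x - g x"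
    using rep_ae_class(2)[OF assms(1)] rep_ae_class(2)[OF assms(2)] by eventually_elim simp
  then have "nrm M (\<lambda>x. rep (ae_class M f) x - rep (ae_class M g) x) = nrm M (\<lambda>x. f x - g x)"
    using rep_ae_class(1)[OF assms(1)] rep_ae_class(1)[OF assms(2)] assms by (intro nrm_cong_AE) auto
  then show ?thesis by (simp add: L2_dist_def nrm_def)
qed

locale operator_system = prob_space M for M :: "'x measure" +
  fixes G :: "'x operator set"
  assumes operator_group: "operator_group M G"
begin

abbreviation "H \<equiv> BijGroup (L2 M)"

sublocale H: group H by (rule group_BijGroup)

lemma G_subgroup: "subgroup G H" and G_unitary: "T \<in> G \<Longrightarrow> unitary_operator M T"
  and G_hom: "T \<in> G \<Longrightarrow> isometric_algebra_hom_Linf M T"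
  using operator_group by (auto simp: operator_group_def)

lemma G_closed [simp]: "T \<in> G \<Longrightarrow> S \<in> G \<Longrightarrow> T \<otimes>\<^bsub>H\<^esub> S \<in> G" "T \<in> G \<Longrightarrow> inv\<^bsub>H\<^esub> T \<in> G" "\<one>\<^bsub>H\<^esub> \<in> G"
  "T \<in> G \<Longrightarrow> T \<in> carrier H"
  using G_subgroup by (auto simp: subgroup.m_closed subgroup.m_inv_closed subgroup.one_closed subgroup.mem_carrier)

lemma G_L2: "T \<in> G \<Longrightarrow> u \<in> L2 M \<Longrightarrow> T u \<in> L2 M"
  using G_unitary[of T] Bij_imp_funcset[of T "L2 M"] unfolding unitary_operator_def by blast

lemma act_sq_int: "T \<in> G \<Longrightarrow> f \<in> sq_int M \<Longrightarrow> act M T f \<in> sq_int M"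
  unfolding act_def by (rule L2_rep(1)[OF G_L2[OF _ class_L2]])

lemma act_meas: "T \<in> G \<Longrightarrow> f \<in> sq_int M \<Longrightarrow> act M T f \<in> borel_measurable M"
  by (intro sq_intD act_sq_int)

lemma class_act: "T \<in> G \<Longrightarrow> f \<in> sq_int M \<Longrightarrow> ae_class M (act M T f) = T (ae_class M f)"
  unfolding act_def by (rule L2_rep(2)[OF G_L2[OF _ class_L2]])

lemma act_cong_AE: "AE x in M. f x = g x \<Longrightarrow> act M T f = act M T g"
  unfolding act_def by (simp add: ae_class_cong)

lemma act_AE_I:
  assumes "T (ae_class M f) = ae_class M h" "h \<in> borel_measurable M"
  shows "AE x in M. act M T f x = h x"
  unfolding act_def assms(1) using rep_ae_class(2)[OF assms(2)] .

lemma act_mult_op: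
  assumes "T \<in> G" "S \<in> G" "f \<in> sq_int M"
  shows "act M (T \<otimes>\<^bsub>H\<^esub> S) f = act M T (act M S f)"
proof -
  have "T \<in> Bij (L2 M)" "S \<in> Bij (L2 M)" using G_unitary assms by (auto simp: unitary_operator_def)
  then have "(T \<otimes>\<^bsub>H\<^esub> S) (ae_class M f) = T (S (ae_class M f))"
    using class_L2[OF assms(3)] by (simp add: BijGroup_def compose_def)
  then show ?thesis unfolding act_def[of M T] act_def[of M "T \<otimes>\<^bsub>H\<^esub> S"]
    using class_act[OF assms(2,3)] by simp
qed

lemma act_one:
  assumes "f \<in> sq_int M"
  shows "AE x in M. act M \<one>\<^bsub>H\<^esub> f x = f x"
  using class_L2[OF assms] assms by (intro act_AE_I) (auto simp: BijGroup_def)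

lemma act_inv:
  assumes "T \<in> G" "f \<in> sq_int M"
  shows "AE x in M. act M T (act M (inv\<^bsub>H\<^esub> T) f) x = f x"
    "AE x in M. act M (inv\<^bsub>H\<^esub> T) (act M T f) x = f x"
  using act_one[OF assms(2)] act_mult_op[of T "inv\<^bsub>H\<^esub> T" f] act_mult_op[of "inv\<^bsub>H\<^esub> T" T f] assms
  by (simp_all add: H.r_inv H.l_inv)

lemma act_add:
  assumes "T \<in> G" "f \<in> sq_int M" "g \<in> sq_int M"
  shows "AE x in M. act M T (\<lambda>x. f x + g x) x = act M T f x + act M T g x"
proof (rule act_AE_I)
  have "T (cl_add M (ae_class M f) (ae_class M g)) = cl_add M (T (ae_class M f)) (T (ae_class M g))"
    using G_unitary[OF assms(1)] class_L2[OF assms(2)] class_L2[OF assms(3)] by (simp add: unitary_operator_def)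
  then show "T (ae_class M (\<lambda>x. f x + g x)) = ae_class M (\<lambda>x. act M T f x + act M T g x)"
    using assms by (simp add: cl_add_class class_act[symmetric] act_sq_int)
qed (intro borel_measurable_add act_meas assms)

lemma act_cmult:
  assumes "T \<in> G" "f \<in> sq_int M"
  shows "AE x in M. act M T (\<lambda>x. c * f x) x = c * act M T f x"
proof (rule act_AE_I)
  have "T (cl_scale M c (ae_class M f)) = cl_scale M c (T (ae_class M f))"
    using G_unitary[OF assms(1)] class_L2[OF assms(2)] by (simp add: unitary_operator_def)
  then show "T (ae_class M (\<lambda>x. c * f x)) = ae_class M (\<lambda>x. c * act M T f x)"
    using assms by (simp add: cl_scale_class class_act[symmetric] act_sq_int)
qed (intro sq_intD[OF sq_int_cmult] act_sq_int assms)

lemma act_ip: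
  assumes "T \<in> G" "f \<in> sq_int M" "g \<in> sq_int M"
  shows "ip M (act M T f) (act M T g) = ip M f g"
proof -
  have "L2_inner M (T (ae_class M f)) (T (ae_class M g)) = L2_inner M (ae_class M f) (ae_class M g)"
    using G_unitary[OF assms(1)] class_L2[OF assms(2)] class_L2[OF assms(3)] by (simp add: unitary_operator_def)
  then show ?thesis
    using assms by (simp add: class_act[symmetric] L2_inner_class act_sq_int)
qed

lemma act_bdd:
  assumes "T \<in> G" "f \<in> bdd M C"
  shows "act M T f \<in> bdd M C"
proof -
  have f: "f \<in> sq_int M" using bdd_sq_int assms by blast
  have "Linf_norm M (ae_class M (act M T f)) = Linf_norm M (ae_class M f)"
    using G_hom[OF assms(1)] class_Linf[OF assms(2)] class_act[OF assms(1) f]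
    by (simp add: isometric_algebra_hom_Linf_def)
  then show ?thesis using Linf_norm_le_iff[of f M C] Linf_norm_le_iff[of "act M T f" M C] assms f
    by (simp add: act_sq_int)
qed

lemma act_mult:
  assumes "T \<in> G" "f \<in> bdd M C" "g \<in> bdd M D"
  shows "AE x in M. act M T (\<lambda>x. f x * g x) x = act M T f x * act M T g x"
proof (rule act_AE_I)
  have s: "f \<in> sq_int M" "g \<in> sq_int M" using bdd_sq_int assms by blast+
  have "T (cl_mult M (ae_class M f) (ae_class M g)) = cl_mult M (T (ae_class M f)) (T (ae_class M g))"
    using G_hom[OF assms(1)] class_Linf[OF assms(2)] class_Linf[OF assms(3)]
    by (simp add: isometric_algebra_hom_Linf_def)
  then show "T (ae_class M (\<lambda>x. f x * g x)) = ae_class M (\<lambda>x. act M T f x * act M T g x)"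
    using assms s by (simp add: cl_mult_class class_act[symmetric] act_sq_int)
  show "(\<lambda>x. act M T f x * act M T g x) \<in> borel_measurable M" 
    using assms s by (intro borel_measurable_times act_meas)
qed

text \<open>The image of \<open>1\<close> is idempotent, hence an indicator function, and has the norm of \<open>1\<close>.\<close>

lemma act_one_fun:
  assumes T: "T \<in> G"
  shows "AE x in M. act M T (\<lambda>x. 1) x = 1"
proof -
  let ?w = "act M T (\<lambda>x. 1)"
  have w: "?w \<in> sq_int M" using T one_sq_int by (rule act_sq_int)
  have c: "(\<lambda>x::'x. 1) \<in> bdd M 1" by (rule bdd_const) simp
  have "AE x in M. ?w x = ?w x * ?w x" using act_mult[OF T c c] by simp
  then have idem: "AE x in M. ?w x = 0 \<or> ?w x = 1" by eventually_elim (metis mult_cancel_right1)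
  have "(nrm M ?w)\<^sup>2 = 1"
    using act_ip[OF T one_sq_int one_sq_int] unfolding ip_self of_real_eq_iff by (simp add: nrm_one)
  then have "(\<integral>x. 1 - (cmod (?w x))\<^sup>2 \<partial>M) = 0"
    using sq_intD2[OF w] by (simp add: nrm_sq prob_space)
  moreover have nn: "AE x in M. 0 \<le> 1 - (cmod (?w x))\<^sup>2"
    using idem by eventually_elim auto
  ultimately have "AE x in M. 1 - (cmod (?w x))\<^sup>2 = 0"
    using integral_nonneg_eq_0_iff_AE[OF _ nn] sq_intD2[OF w] by simp
  then show ?thesis using idem by eventually_elim auto
qed

text \<open>
  Pairing \<open>T f \<cdot> T g\<close> with \<open>T 1 = 1\<close> shows that \<open>T g\<close> and the conjugate of \<open>T (cnj g)\<close> have the same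
  integral against every \<open>T f\<close>, that is, against every bounded function.
\<close>

lemma act_cnj:
  assumes T: "T \<in> G" and g: "g \<in> bdd M C"
  shows "AE x in M. act M T (\<lambda>x. cnj (g x)) x = cnj (act M T g x)"
proof -
  let ?g' = "\<lambda>x. cnj (g x)"
  define w where "w x = cnj (act M T ?g' x) - act M T g x" for x
  have g': "?g' \<in> bdd M C" using g by (rule bdd_cnj)
  have wb: "w \<in> bdd M (C + C)" unfolding w_def
    by (intro bdd_diff bdd_cnj act_bdd T g g')
  define f where "f = act M (inv\<^bsub>H\<^esub> T) (\<lambda>x. cnj (w x))"
  have fb: "f \<in> bdd M (C + C)" unfolding f_def using T wb by (intro act_bdd bdd_cnj) auto
  have sq: "f \<in> sq_int M" "g \<in> sq_int M" "?g' \<in> sq_int M" "w \<in> sq_int M" "(\<lambda>x. f x * g x) \<in> sq_int M"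
      "(\<lambda>x. cnj (w x)) \<in> sq_int M"
    using fb g g' wb bdd_sq_int bdd_mult_sq_int[OF fb _ bdd_nonneg[OF fb]] bdd_cnj[OF wb] by blast+
  have meas: "act M T f \<in> borel_measurable M" "act M T g \<in> borel_measurable M" "act M T ?g' \<in> borel_measurable M"
    using T sq by (simp_all add: act_meas)
  have Tf: "AE x in M. act M T f x = cnj (w x)" unfolding f_def using act_inv(1)[OF T sq(6)] .
  have eqs: "AE x in M. act M T f x * act M T g x = act M T (\<lambda>x. f x * g x) x" "AE x in M. 1 = act M T (\<lambda>x. 1) x"
    using act_mult[OF T fb g] act_one_fun[OF T] by (auto elim: eventually_mono)
  have "ip M (\<lambda>x. act M T f x * act M T g x) (\<lambda>x. 1) = ip M (act M T (\<lambda>x. f x * g x)) (act M T (\<lambda>x. 1))"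
    using eqs borel_measurable_times[OF meas(1,2)] sq T one_sq_int
    by (intro ip_cong_AE) (simp_all add: act_meas)
  also have "\<dots> = ip M (\<lambda>x. f x * g x) (\<lambda>x. 1)" using act_ip T sq one_sq_int by blast
  also have "\<dots> = ip M f ?g'" by (simp add: ip_def)
  also have "\<dots> = ip M (act M T f) (act M T ?g')" using act_ip T sq by simp
  finally have "(\<integral>x. act M T f x * act M T g x \<partial>M) = (\<integral>x. act M T f x * cnj (act M T ?g' x) \<partial>M)"
    by (simp add: ip_def)
  then have "(\<integral>x. act M T f x * w x \<partial>M) = 0"
    unfolding w_def right_diff_distrib using T sq
    by (subst Bochner_Integration.integral_diff) (auto intro!: sq_int_prod sq_int_cnj act_sq_int)
  moreover have "(\<integral>x. act M T f x * w x \<partial>M) = ip M w w"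
    unfolding ip_def using Tf meas sq by (intro integral_cong_AE) (auto simp: mult.commute)
  ultimately have "nrm M w = 0" by (simp add: ip_self)
  from nrm_eq_0_AE[OF sq(4) this] show ?thesis unfolding w_def by eventually_elim (simp add: complex_eq_iff)
qed

lemma act_nrm: "T \<in> G \<Longrightarrow> f \<in> sq_int M \<Longrightarrow> nrm M (act M T f) = nrm M f"
  using act_ip[of T f f] unfolding ip_self of_real_eq_iff by (simp add: power2_eq_iff_nonneg)

lemma act_diff:
  assumes "T \<in> G" "f \<in> sq_int M" "g \<in> sq_int M"
  shows "AE x in M. act M T (\<lambda>x. f x - g x) x = act M T f x - act M T g x"
proof -
  have "AE x in M. act M T (\<lambda>x. f x + (-1) * g x) x = act M T f x + act M T (\<lambda>x. (-1) * g x) x"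
    using assms by (intro act_add sq_int_cmult)
  then show ?thesis using act_cmult[OF assms(1,3), of "-1"] by eventually_elim simp
qed

lemma act_nrm_diff:
  assumes "T \<in> G" "f \<in> sq_int M" "g \<in> sq_int M"
  shows "nrm M (\<lambda>x. act M T f x - act M T g x) = nrm M (\<lambda>x. f x - g x)"
proof -
  have "nrm M (\<lambda>x. act M T f x - act M T g x) = nrm M (act M T (\<lambda>x. f x - g x))"
    using act_diff[OF assms] assms by (intro nrm_cong_AE) (auto simp: act_sq_int sq_int_diff)
  then show ?thesis using assms by (simp add: act_nrm sq_int_diff)
qed

lemma act_sum:
  assumes "T \<in> G"
  shows "(\<And>t. t \<in> I \<Longrightarrow> F t \<in> sq_int M) \<Longrightarrow>
    AE x in M. act M T (\<lambda>x. \<Sum>t\<in>I. c t * F t x) x = (\<Sum>t\<in>I. c t * act M T (F t) x)"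
proof (induction I rule: infinite_finite_induct)
  case (insert a I)
  have "AE x in M. act M T (\<lambda>x. c a * F a x + (\<Sum>t\<in>I. c t * F t x)) x =
      act M T (\<lambda>x. c a * F a x) x + act M T (\<lambda>x. \<Sum>t\<in>I. c t * F t x) x"
    using insert by (intro act_add assms sq_int_cmult sq_int_sum) auto
  moreover have "AE x in M. act M T (\<lambda>x. c a * F a x) x = c a * act M T (F a) x"
    using insert by (intro act_cmult assms) auto
  moreover have "AE x in M. act M T (\<lambda>x. \<Sum>t\<in>I. c t * F t x) x = (\<Sum>t\<in>I. c t * act M T (F t) x)"
    using insert by simp
  ultimately have "AE x in M. act M T (\<lambda>x. c a * F a x + (\<Sum>t\<in>I. c t * F t x)) x =
      c a * act M T (F a) x + (\<Sum>t\<in>I. c t * act M T (F t) x)"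
    by eventually_elim simp
  then show ?case using insert by simp
qed (use act_cmult[OF assms sq_int_zero, of 0] in simp_all)

lemma act_prod:
  assumes "T \<in> G"
  shows "(\<And>t. t \<in> I \<Longrightarrow> F t \<in> bdd M 1) \<Longrightarrow>
    AE x in M. act M T (\<lambda>x. \<Prod>t\<in>I. F t x) x = (\<Prod>t\<in>I. act M T (F t) x)"
proof (induction I rule: infinite_finite_induct)
  case (insert a I)
  have "AE x in M. act M T (\<lambda>x. F a x * (\<Prod>t\<in>I. F t x)) x = act M T (F a) x * act M T (\<lambda>x. \<Prod>t\<in>I. F t x) x"
    using insert by (intro act_mult[where C=1 and D=1] assms bdd_prod) auto
  moreover have "AE x in M. act M T (\<lambda>x. \<Prod>t\<in>I. F t x) x = (\<Prod>t\<in>I. act M T (F t) x)"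
    using insert by simp
  ultimately have "AE x in M. act M T (\<lambda>x. F a x * (\<Prod>t\<in>I. F t x)) x = act M T (F a) x * (\<Prod>t\<in>I. act M T (F t) x)"
    by eventually_elim simp
  then show ?case using insert by simp
qed (use act_one_fun[OF assms] in simp_all)

end

section \<open>Polynomial maps form a group\<close>

locale polynomial_maps = group H for H :: "('t, 'b) monoid_scheme" (structure) +
  fixes Gs :: "nat \<Rightarrow> 't set" and len :: nat
  assumes prefilt: "prefiltration H Gs" and Gs_len: "Gs len = {\<one>}"
begin

lemma Gs_subgroup: "subgroup (Gs i) H"
  using prefilt by (simp add: prefiltration_def)

lemma Gs_closed [simp]:
  "x \<in> Gs i \<Longrightarrow> y \<in> Gs i \<Longrightarrow> x \<otimes> y \<in> Gs i" "x \<in> Gs i \<Longrightarrow> inv x \<in> Gs i" "\<one> \<in> Gs i"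
  by (rule subgroup.m_closed[OF Gs_subgroup] subgroup.m_inv_closed[OF Gs_subgroup]
      subgroup.one_closed[OF Gs_subgroup]; assumption?)+

lemma Gs_carrier: "x \<in> Gs i \<Longrightarrow> x \<in> carrier H"
  using Gs_subgroup[of i] by (rule subgroup.mem_carrier)

lemma Gs_mono:
  assumes "i \<le> k"
  shows "Gs k \<subseteq> Gs i"
proof -
  have "Gs (Suc n) \<subseteq> Gs n" for n using prefilt unfolding prefiltration_def by blast
  then show ?thesis using assms by (rule lift_Suc_antimono_le)
qed

lemma Gs_trivial: "len \<le> t \<Longrightarrow> Gs t = {\<one>}"
  using Gs_mono[of len t] Gs_len Gs_closed(3)[of t] by blast

lemma Gs_comm:
  assumes "x \<in> Gs i" "y \<in> Gs k"
  shows "x \<otimes> y \<otimes> inv x \<otimes> inv y \<in> Gs (i + k)"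
proof -
  have "x \<otimes> y \<otimes> inv x \<otimes> inv y \<in> commutator_subgroup H (Gs i) (Gs k)"
    unfolding commutator_subgroup_def using assms by (intro generate.incl) blast
  then show ?thesis using prefilt unfolding prefiltration_def by blast
qed

definition pmap :: "nat \<Rightarrow> ('g::group_add \<Rightarrow> 't) set" where
  "pmap t = {g. polynomial_map H (\<lambda>i. Gs (i + t)) g}"

definition deriv_map :: "'g::group_add \<Rightarrow> 'g \<Rightarrow> ('g \<Rightarrow> 't) \<Rightarrow> 'g \<Rightarrow> 't" where
  "deriv_map a b g n = inv (g n) \<otimes> g (a + n + b)"

lemma pmap_trivial: "len \<le> t \<Longrightarrow> \<forall>n. g n = \<one> \<Longrightarrow> g \<in> pmap t"
  unfolding pmap_def using Gs_trivial[of t] by (intro CollectI polynomial_map.trivial) simp_all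

lemma pmap_value:
  assumes "g \<in> pmap t"
  shows "g n \<in> Gs t"
proof -
  have "polynomial_map H (\<lambda>i. Gs (i + t)) g" using assms by (simp add: pmap_def)
  then show ?thesis by cases simp_all
qed

lemma pmap_derivI:
  assumes "\<And>n. g n \<in> Gs t" "\<And>a b. deriv_map a b g \<in> pmap (Suc t)"
  shows "g \<in> pmap t"
proof -
  have "polynomial_map H (\<lambda>i. Gs (i + t)) g"
    using assms by (intro polynomial_map.derivative) (simp_all add: pmap_def deriv_map_def[abs_def])
  then show ?thesis by (simp add: pmap_def)
qed

lemma pmap_deriv:
  assumes "g \<in> pmap t"
  shows "deriv_map a b g \<in> pmap (Suc t)"
proof -
  have "polynomial_map H (\<lambda>i. Gs (i + t)) g" using assms by (simp add: pmap_def)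
  then show ?thesis
  proof cases
    case trivial
    then have "Gs (Suc t) = {\<one>}" using Gs_mono[of t "Suc t"] Gs_closed(3)[of "Suc t"] by auto
    then show ?thesis using trivial
      by (simp add: pmap_def deriv_map_def[abs_def] polynomial_map.trivial)
  next
    case derivative
    then show ?thesis by (simp add: pmap_def deriv_map_def[abs_def])
  qed
qed

text \<open>
  Closure of the polynomial maps under products, inverses and commutators, with the levels that
  these operations should have. That differentiation raises the level is checked on the generating
  operations; by descending induction on the level all members then turn out to be polynomial.
\<close>

inductive pcl :: "nat \<Rightarrow> ('g::group_add \<Rightarrow> 't) \<Rightarrow> bool" where
  base: "g \<in> pmap a \<Longrightarrow> pcl a g"
| mult: "pcl a g \<Longrightarrow> pcl a h \<Longrightarrow> pcl a (\<lambda>n. g n \<otimes> h n)"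
| inv: "pcl a g \<Longrightarrow> pcl a (\<lambda>n. inv (g n))"
| comm: "pcl a g \<Longrightarrow> pcl b h \<Longrightarrow> pcl (a + b) (\<lambda>n. g n \<otimes> h n \<otimes> inv (g n) \<otimes> inv (h n))"
| Suc: "pcl (Suc a) g \<Longrightarrow> pcl a g"

lemma pcl_mono:
  assumes "pcl k g" "i \<le> k"
  shows "pcl i g"
  using assms(2,1) by (induction rule: inc_induct) (auto intro: pcl.Suc)

lemma pcl_value: "pcl a g \<Longrightarrow> g n \<in> Gs a"
proof (induction rule: pcl.induct)
  case (Suc a g)
  then show ?case using Gs_mono[of a "Suc a"] by auto
next
  case (base g a)
  then show ?case by (rule pmap_value)
qed (simp_all add: Gs_comm)

lemma cancel:
  assumes "x \<in> carrier H" "z \<in> carrier H"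
  shows "inv x \<otimes> (x \<otimes> z) = z" "x \<otimes> (inv x \<otimes> z) = z"
  using assms by (simp_all add: m_assoc[symmetric])

lemma pcl_carrier: "pcl a g \<Longrightarrow> g n \<in> carrier H"
  by (rule Gs_carrier[OF pcl_value])

text \<open>Conjugation preserves the level, because it multiplies by a commutator.\<close>

lemma pcl_conj:
  assumes g: "pcl a g" and h: "pcl b h"
  shows "pcl b (\<lambda>n. g n \<otimes> h n \<otimes> inv (g n))"
proof -
  have "pcl b (\<lambda>n. (g n \<otimes> h n \<otimes> inv (g n) \<otimes> inv (h n)) \<otimes> h n)"
    by (intro pcl.mult pcl_mono[OF pcl.comm[OF g h]] h) simp
  moreover have "g n \<in> carrier H" "h n \<in> carrier H" for n
    by (rule pcl_carrier[OF g] pcl_carrier[OF h])+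
  ultimately show ?thesis by (simp add: m_assoc)
qed

text \<open>
  The derivative of a product, an inverse or a commutator is a product of conjugates of derivatives and
  of commutators one of whose entries is a derivative; by induction these have the next level.
\<close>

lemma pcl_deriv: "pcl t g \<Longrightarrow> pcl (Suc t) (deriv_map a b g)"
proof (induction rule: pcl.induct)
  case (base g t)
  then show ?case by (intro pcl.base pmap_deriv)
next
  case (mult t g h)
  have [simp]: "g n \<in> carrier H" "h n \<in> carrier H" for n
    by (rule pcl_carrier[OF mult.hyps(1)] pcl_carrier[OF mult.hyps(2)])+
  have eq: "deriv_map a b (\<lambda>n. g n \<otimes> h n) =
      (\<lambda>n. inv (h n) \<otimes> deriv_map a b g n \<otimes> inv (inv (h n)) \<otimes> deriv_map a b h n)"
    by (intro ext) (simp add: deriv_map_def m_assoc cancel inv_mult_group)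
  show ?case unfolding eq
    by (rule pcl.mult[OF pcl_conj[OF pcl.inv[OF mult.hyps(2)] mult.IH(1)] mult.IH(2)])
next
  case (inv t g)
  have [simp]: "g n \<in> carrier H" for n
    by (rule pcl_carrier[OF inv.hyps(1)])
  have eq: "deriv_map a b (\<lambda>n. inv (g n)) = (\<lambda>n. g n \<otimes> inv (deriv_map a b g n) \<otimes> inv (g n))"
    by (intro ext) (simp add: deriv_map_def m_assoc cancel inv_mult_group)
  show ?case unfolding eq
    by (rule pcl_conj[OF inv.hyps pcl.inv[OF inv.IH]])
next
  case (comm s g t h)
  have [simp]: "g n \<in> carrier H" "h n \<in> carrier H" for n
    by (rule pcl_carrier[OF comm.hyps(1)] pcl_carrier[OF comm.hyps(2)])+
  let ?A = "deriv_map a b g" and ?B = "deriv_map a b h"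
  let ?g' = "\<lambda>n. g n \<otimes> ?A n"
  have eq: "deriv_map a b (\<lambda>n. g n \<otimes> h n \<otimes> inv (g n) \<otimes> inv (h n)) =
      (\<lambda>n. h n \<otimes> (g n \<otimes> (inv (h n) \<otimes> ?A n \<otimes> inv (inv (h n)) \<otimes> inv (?A n)) \<otimes> inv (g n)) \<otimes> inv (h n)
      \<otimes> (h n \<otimes> (?g' n \<otimes> ?B n \<otimes> inv (?g' n) \<otimes> inv (?B n)) \<otimes> inv (h n)))"
    by (intro ext) (simp add: deriv_map_def m_assoc cancel inv_mult_group)
  have g': "pcl s ?g'" by (rule pcl.mult[OF comm.hyps(1) pcl.Suc[OF comm.IH(1)]])
  have "pcl (Suc (s + t)) (\<lambda>n. h n \<otimes> (g n \<otimes> (inv (h n) \<otimes> ?A n \<otimes> inv (inv (h n)) \<otimes> inv (?A n)) \<otimes> inv (g n)) \<otimes> inv (h n))"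
    using pcl_conj[OF comm.hyps(2) pcl_conj[OF comm.hyps(1)
        pcl.comm[OF pcl.inv[OF comm.hyps(2)] comm.IH(1)]]] by (simp add: add.commute)
  moreover have "pcl (Suc (s + t)) (\<lambda>n. h n \<otimes> (?g' n \<otimes> ?B n \<otimes> inv (?g' n) \<otimes> inv (?B n)) \<otimes> inv (h n))"
    using pcl_conj[OF comm.hyps(2) pcl.comm[OF g' comm.IH(2)]] by simp
  ultimately have "pcl (Suc (s + t)) (\<lambda>n. h n \<otimes> (g n \<otimes> (inv (h n) \<otimes> ?A n \<otimes> inv (inv (h n)) \<otimes> inv (?A n)) \<otimes> inv (g n)) \<otimes> inv (h n)
      \<otimes> (h n \<otimes> (?g' n \<otimes> ?B n \<otimes> inv (?g' n) \<otimes> inv (?B n)) \<otimes> inv (h n)))"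
    by (rule pcl.mult)
  then show ?case unfolding eq .
next
  case (Suc t g)
  show ?case by (rule pcl.Suc[OF Suc.IH])
qed

lemma pcl_imp_pmap: "pcl t g \<Longrightarrow> g \<in> pmap t"
proof (induction "len - t" arbitrary: t g)
  case 0
  have "g n = \<one>" for n using pcl_value[OF 0(2), of n] Gs_trivial[of t] 0 by simp
  with 0 show ?case by (intro pmap_trivial) simp_all
next
  case (Suc k)
  have "deriv_map a b g \<in> pmap (Suc t)" for a b
    using Suc(2) by (intro Suc(1) pcl_deriv[OF Suc(3)]) simp
  with pcl_value[OF Suc(3)] show ?case by (rule pmap_derivI)
qed

text \<open>The Lazard--Leibman theorem.\<close>

theorem pmap_mult: "g \<in> pmap t \<Longrightarrow> h \<in> pmap t \<Longrightarrow> (\<lambda>n. g n \<otimes> h n) \<in> pmap t"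
  by (rule pcl_imp_pmap[OF pcl.mult[OF pcl.base pcl.base]])

theorem pmap_inv: "g \<in> pmap t \<Longrightarrow> (\<lambda>n. inv (g n)) \<in> pmap t"
  by (rule pcl_imp_pmap[OF pcl.inv[OF pcl.base]])

lemma pmap_Suc: "g \<in> pmap (Suc t) \<Longrightarrow> g \<in> pmap t"
  by (rule pcl_imp_pmap[OF pcl.Suc[OF pcl.base]])

lemma pmap_one: "(\<lambda>n. \<one>) \<in> pmap t"
proof (cases "len \<le> t")
  case False
  have "pcl len (\<lambda>n. \<one>)" by (rule pcl.base[OF pmap_trivial]) simp_all
  then show ?thesis by (rule pcl_imp_pmap[OF pcl_mono]) (use False in simp)
qed (simp add: pmap_trivial)

end

section \<open>Neighbourhoods of compact sets in a topological group\<close>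

lemma open_add_split:
  fixes x y :: "'g::topological_group_add"
  assumes "open U" "x + y \<in> U"
  obtains A B where "open A" "x \<in> A" "open B" "y \<in> B" "\<And>a b. a \<in> A \<Longrightarrow> b \<in> B \<Longrightarrow> a + b \<in> U"
proof -
  have "\<forall>\<^sub>F p in nhds x \<times>\<^sub>F nhds y. fst p + snd p \<in> U"
    using tendsto_add_Pair[of x y] assms by (rule topological_tendstoD)
  then obtain P Q where "eventually P (nhds x)" "eventually Q (nhds y)"
    and PQ: "\<And>a b. P a \<Longrightarrow> Q b \<Longrightarrow> a + b \<in> U"
    unfolding eventually_prod_filter by force
  obtain A where "open A" "x \<in> A" "\<forall>a\<in>A. P a"
    using \<open>eventually P (nhds x)\<close> unfolding eventually_nhds by blast
  moreover obtain B where "open B" "y \<in> B" "\<forall>b\<in>B. Q b"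
    using \<open>eventually Q (nhds y)\<close> unfolding eventually_nhds by blast
  ultimately show thesis using that[of A B] PQ by simp
qed

text \<open>The tube lemma.\<close>

lemma compact_tube:
  fixes P :: "'g::topological_space \<Rightarrow> 'h::topological_space \<Rightarrow> bool"
  assumes "compact L"
    and loc: "\<And>l. l \<in> L \<Longrightarrow> \<exists>A W. open A \<and> l \<in> A \<and> open W \<and> b \<in> W \<and> (\<forall>a\<in>A. \<forall>n\<in>W. P a n)"
  shows "\<exists>W. open W \<and> b \<in> W \<and> (\<forall>l\<in>L. \<forall>n\<in>W. P l n)"
proof -
  have "\<forall>l\<in>L. \<exists>A W. open A \<and> l \<in> A \<and> open W \<and> b \<in> W \<and> (\<forall>a\<in>A. \<forall>n\<in>W. P a n)"
    using loc by blast
  then obtain A W where AW: "\<And>l. l \<in> L \<Longrightarrow> open (A l) \<and> l \<in> A l \<and> open (W l) \<and> b \<in> W l \<and> (\<forall>a\<in>A l. \<forall>n\<in>W l. P a n)"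
    by metis
  obtain L' where L': "L' \<subseteq> L" "finite L'" "L \<subseteq> (\<Union>l\<in>L'. A l)"
    by (rule compactE_image[OF assms(1), of L A]) (use AW in auto)
  have "open (\<Inter>l\<in>L'. W l)" using L' AW by (intro open_INT) auto
  moreover have "b \<in> (\<Inter>l\<in>L'. W l)" using L' AW by auto
  moreover have "\<forall>l\<in>L. \<forall>n\<in>(\<Inter>l\<in>L'. W l). P l n"
  proof (intro ballI)
    fix l n assume "l \<in> L" "n \<in> (\<Inter>l\<in>L'. W l)"
    moreover then obtain l' where "l' \<in> L'" "l \<in> A l'" using L' by blast
    ultimately show "P l n" using AW[of l'] L' by blast
  qed
  ultimately show ?thesis by blast
qed

lemma compact_add_open:
  fixes C :: "'g::topological_group_add set"
  assumes "compact C" "open U" "C \<subseteq> U"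
  shows "\<exists>V. open V \<and> 0 \<in> V \<and> (\<forall>a\<in>V. \<forall>n\<in>C. a + n \<in> U)"
proof -
  have "\<exists>W. open W \<and> 0 \<in> W \<and> (\<forall>n\<in>C. \<forall>a\<in>W. a + n \<in> U)"
  proof (rule compact_tube[OF assms(1)])
    fix n assume "n \<in> C"
    then have "0 + n \<in> U" using assms by auto
    from open_add_split[OF assms(2) this] obtain A B where "open A" "0 \<in> A" "open B" "n \<in> B"
      "\<And>a b. a \<in> A \<Longrightarrow> b \<in> B \<Longrightarrow> a + b \<in> U" by blast
    then show "\<exists>B A. open B \<and> n \<in> B \<and> open A \<and> 0 \<in> A \<and> (\<forall>n\<in>B. \<forall>a\<in>A. a + n \<in> U)" by blast
  qed
  then show ?thesis by blast
qed

lemma continuous_add_left: "continuous_on UNIV (\<lambda>n::'g::topological_group_add. a + n)"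
  by (intro continuous_intros)

lemma borel_add_left [measurable]: "(\<lambda>n::'g::topological_group_add. a + n) \<in> borel_measurable borel"
  by (rule borel_measurable_continuous_onI[OF continuous_add_left])

lemma compact_translate: "compact K \<Longrightarrow> compact ((+) (a::'g::topological_group_add) ` K)"
  using continuous_on_subset[OF continuous_add_left, of K a] by (intro compact_continuous_image) auto

section \<open>Regularity of Haar measure\<close>

locale haar =
  fixes \<mu> :: "'g::{topological_group_add, t2_space} measure"
  assumes haar: "left_haar_measure \<mu>"
begin

lemma sets_mu [measurable_cong, simp]: "sets \<mu> = sets borel"
  using haar by (simp add: left_haar_measure_def)

lemma space_mu [simp]: "space \<mu> = UNIV"
  using sets_eq_imp_space_eq[OF sets_mu] by simp

lemma compact_finite: "compact K \<Longrightarrow> emeasure \<mu> K < \<infinity>"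
  and open_pos: "open U \<Longrightarrow> U \<noteq> {} \<Longrightarrow> emeasure \<mu> U > 0"
  and outer: "B \<in> sets borel \<Longrightarrow> emeasure \<mu> B = (INF U \<in> {U. open U \<and> B \<subseteq> U}. emeasure \<mu> U)"
  and invariant: "B \<in> sets borel \<Longrightarrow> emeasure \<mu> ((+) a ` B) = emeasure \<mu> B"
  using haar unfolding left_haar_measure_def by blast+

lemma emeasure_vimage_translate:
  assumes "B \<in> sets borel"
  shows "{n. a + n \<in> B} \<in> sets borel" "emeasure \<mu> {n. a + n \<in> B} = emeasure \<mu> B"
proof -
  have "(\<lambda>n. a + n) -` B \<inter> space borel \<in> sets borel" using assms by measurable
  then show "{n. a + n \<in> B} \<in> sets borel" by (simp add: vimage_def)
  have "{n. a + n \<in> B} = (+) (- a) ` B"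
  proof safe
    fix n assume "a + n \<in> B"
    then have "- a + (a + n) \<in> (+) (- a) ` B" by (rule imageI)
    then show "n \<in> (+) (- a) ` B" by (simp add: add.assoc[symmetric])
  qed (simp add: add.assoc[symmetric])
  then show "emeasure \<mu> {n. a + n \<in> B} = emeasure \<mu> B" using invariant[OF assms] by simp
qed

lemma outer_approx:
  assumes "B \<in> sets borel" "emeasure \<mu> B < \<infinity>" "0 < \<eta>"
  obtains U where "open U" "B \<subseteq> U" "emeasure \<mu> (U - B) \<le> ennreal \<eta>"
proof -
  obtain r where r: "emeasure \<mu> B = ennreal r" "r \<ge> 0"
    using assms(2) by (cases "emeasure \<mu> B") auto
  have "emeasure \<mu> B < emeasure \<mu> B + ennreal \<eta>"
    using assms(3) r by (simp add: ennreal_plus[symmetric] ennreal_less_iff del: ennreal_plus)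
  then obtain U where U: "open U" "B \<subseteq> U" "emeasure \<mu> U < emeasure \<mu> B + ennreal \<eta>"
    unfolding outer[OF assms(1)] INF_less_iff by blast
  have "emeasure \<mu> (U - B) = emeasure \<mu> U - emeasure \<mu> B"
    using U assms by (intro emeasure_Diff) auto
  also have "\<dots> \<le> ennreal \<eta>" using U(3) unfolding ennreal_minus_le_iff by (simp add: less_imp_le r)
  finally show thesis using that U by blast
qed

text \<open>Remove from \<open>K\<close> an open set that approximates \<open>K - B\<close> from outside.\<close>

lemma inner_approx:
  assumes "B \<in> sets borel" "B \<subseteq> K" "compact K" "0 < \<eta>"
  obtains C where "compact C" "C \<subseteq> B" "emeasure \<mu> (B - C) \<le> ennreal \<eta>"
proof -
  have K: "K \<in> sets borel" using compact_imp_closed[OF assms(3)] by simp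
  have "emeasure \<mu> (K - B) < \<infinity>"
    using emeasure_mono[of "K - B" K \<mu>] compact_finite[OF assms(3)] K assms(1)
    by (simp add: order.strict_trans1)
  then obtain U where U: "open U" "K - B \<subseteq> U" "emeasure \<mu> (U - (K - B)) \<le> ennreal \<eta>"
    using outer_approx[of "K - B" \<eta>] K assms by auto
  have "emeasure \<mu> (B - (K - U)) \<le> emeasure \<mu> (U - (K - B))"
    using U(1) K assms(1,2) by (intro emeasure_mono) auto
  then have "emeasure \<mu> (B - (K - U)) \<le> ennreal \<eta>" using U(3) by (rule order_trans)
  moreover have "compact (K - U)" using assms(3) U(1) by (rule compact_diff)
  ultimately show thesis using that[of "K - U"] U(2) by blast
qed

end

lemma L2_dist_nrm: "L2_dist M u v = nrm M (\<lambda>x. rep u x - rep v x)"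
  by (simp add: L2_dist_def nrm_def)

lemma L2_dist_triangle:
  assumes "u \<in> L2 M" "v \<in> L2 M" "w \<in> L2 M"
  shows "L2_dist M u w \<le> L2_dist M u v + L2_dist M v w"
  unfolding L2_dist_nrm using assms by (intro nrm_triangle_diff L2_rep)

lemma L2_dist_commute: "L2_dist M u v = L2_dist M v u"
  unfolding L2_dist_nrm by (rule nrm_minus_commute)

text \<open>
  On a compact set of almost full measure, made of finitely many disjoint compact pieces, \<open>\<psi>\<close> is nearly
  constant on each piece, and a small translation moves points out of their piece only on a set of small measure.
\<close>

lemma (in haar) translation_continuous_in_measure:
  assumes meas: "L2_measurable M \<mu> \<psi>" and \<psi>: "\<And>n. \<psi> n \<in> L2 M"
    and K: "compact K" and \<epsilon>: "0 < \<epsilon>" and \<eta>: "0 < \<eta>"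
  shows "\<exists>V. open V \<and> 0 \<in> V \<and> (\<forall>a\<in>V. \<exists>Bad\<in>sets borel. emeasure \<mu> Bad \<le> ennreal \<eta> \<and>
    (\<forall>n\<in>K - Bad. L2_dist M (\<psi> (a + n)) (\<psi> n) \<le> \<epsilon>))"
proof -
  let ?d = "L2_dist M"
  obtain s :: "nat \<Rightarrow> 'g \<Rightarrow> _" where s0: "\<forall>i. simple_function \<mu> (s i) \<and> (\<forall>n. s i n \<in> L2 M)"
    and lim: "AE n in \<mu>. n \<in> K \<longrightarrow> (\<lambda>i. ?d (s i n) (\<psi> n)) \<longlonglongrightarrow> 0"
    using meas[unfolded L2_measurable_def, rule_format, OF K] by (elim exE conjE)
  have s: "simple_function \<mu> (s i)" "s i n \<in> L2 M" for i n using s0 by simp_all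
  have Kb [measurable]: "K \<in> sets borel" using compact_imp_closed[OF K] by simp
  have dm: "(\<lambda>n. ?d (s k n) (s l n)) \<in> borel_measurable \<mu>" for k l
    by (rule borel_measurable_simple_function[OF simple_function_compose2[OF s(1) s(1)]])
  \<comment> \<open>Egorov: outside \<open>B i\<close> and a null set, \<open>s i\<close> is uniformly close to \<open>\<psi>\<close>.\<close>
  define B where "B i = {n \<in> K. \<exists>k\<ge>i. \<exists>l\<ge>i. \<epsilon> / 4 < ?d (s k n) (s l n)}" for i
  have B [measurable]: "B i \<in> sets borel" for i
  proof -
    have "{n \<in> space \<mu>. \<epsilon> / 4 < ?d (s k n) (s l n)} \<in> sets borel" for k l
      using borel_measurable_less[OF borel_measurable_const dm] by (simp only: sets_mu)
    then have "(\<Union>k\<in>{i..}. \<Union>l\<in>{i..}. {n \<in> space \<mu>. \<epsilon> / 4 < ?d (s k n) (s l n)}) \<inter> K \<in> sets borel"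
      by (intro sets.Int Kb sets.countable_UN'') simp_all
    also have "(\<Union>k\<in>{i..}. \<Union>l\<in>{i..}. {n \<in> space \<mu>. \<epsilon> / 4 < ?d (s k n) (s l n)}) \<inter> K = B i"
      unfolding B_def space_mu by blast
    finally show ?thesis .
  qed
  obtain N where N': "\<And>n. n \<in> space \<mu> - N \<Longrightarrow> n \<in> K \<longrightarrow> (\<lambda>i. ?d (s i n) (\<psi> n)) \<longlonglongrightarrow> 0"
    and N: "N \<in> null_sets \<mu>"
    using AE_E3[OF lim] by blast
  have limN: "(\<lambda>i. ?d (s i n) (\<psi> n)) \<longlonglongrightarrow> 0" if "n \<in> K - N" for n
    using N'[of n] that by simp
  have Nb [measurable]: "N \<in> sets borel" using N by (simp add: null_sets_def)
  have "(\<Inter>i. B i) \<subseteq> N"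
  proof
    fix n assume n: "n \<in> (\<Inter>i. B i)"
    show "n \<in> N"
    proof (rule ccontr)
      assume "n \<notin> N"
      then have "(\<lambda>i. ?d (s i n) (\<psi> n)) \<longlonglongrightarrow> 0" by (intro limN DiffI) (use INT_D[OF n UNIV_I, of 0] in \<open>simp_all add: B_def\<close>)
      then have "\<forall>\<^sub>F i in sequentially. ?d (s i n) (\<psi> n) < \<epsilon> / 8"
        by (rule order_tendstoD) (use \<epsilon> in simp)
      then obtain i where i: "\<And>k. k \<ge> i \<Longrightarrow> ?d (s k n) (\<psi> n) < \<epsilon> / 8"
        unfolding eventually_sequentially by blast
      obtain k l where kl: "k \<ge> i" "l \<ge> i" "\<epsilon> / 4 < ?d (s k n) (s l n)"
        using INT_D[OF n UNIV_I, of i] unfolding B_def by blast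
      have "?d (s k n) (s l n) \<le> ?d (s k n) (\<psi> n) + ?d (s l n) (\<psi> n)"
        using L2_dist_triangle[OF s(2)[of k n] \<psi>[of n] s(2)[of l n]] by (simp add: L2_dist_commute)
      then show False using i[OF kl(1)] i[OF kl(2)] kl(3) by linarith
    qed
  qed
  then have "emeasure \<mu> (\<Inter>i. B i) \<le> emeasure \<mu> N" by (rule emeasure_mono) (simp add: Nb)
  then have "emeasure \<mu> (\<Inter>i. B i) = 0" using null_setsD1[OF N] by simp
  moreover have "(\<lambda>i. emeasure \<mu> (B i)) \<longlonglongrightarrow> emeasure \<mu> (\<Inter>i. B i)"
  proof (rule Lim_emeasure_decseq)
    show "range B \<subseteq> sets \<mu>" using B by auto
    show "decseq B"
    proof (rule decseq_SucI)
      show "B (Suc i) \<subseteq> B i" for i unfolding B_def using Suc_leD by blast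
    qed
    show "emeasure \<mu> (B i) \<noteq> \<infinity>" for i
    proof -
      have "B i \<subseteq> K" unfolding B_def by blast
      then have "emeasure \<mu> (B i) \<le> emeasure \<mu> K" by (rule emeasure_mono) (simp add: Kb)
      then show ?thesis using compact_finite[OF K] by (auto simp: top_unique)
    qed
  qed
  ultimately have "(\<lambda>i. emeasure \<mu> (B i)) \<longlonglongrightarrow> 0" by simp
  then have "\<forall>\<^sub>F i in sequentially. emeasure \<mu> (B i) < ennreal (\<eta> / 4)"
    by (rule order_tendstoD) (use \<eta> in simp)
  then obtain i where i: "emeasure \<mu> (B i) < ennreal (\<eta> / 4)"
    unfolding eventually_sequentially by blast
  define R where "R = K - B i - N"
  have Rb: "R \<in> sets borel" unfolding R_def by (intro sets.Diff Kb B Nb)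
  have R: "?d (s i n) (\<psi> n) \<le> \<epsilon> / 4" if n: "n \<in> R" for n
  proof -
    have "(\<lambda>l. \<epsilon> / 4 + ?d (s l n) (\<psi> n)) \<longlonglongrightarrow> \<epsilon> / 4 + 0"
      using n by (intro tendsto_intros limN) (auto simp: R_def)
    moreover have "\<forall>l\<ge>i. ?d (s i n) (\<psi> n) \<le> \<epsilon> / 4 + ?d (s l n) (\<psi> n)"
    proof (intro allI impI)
      fix l assume "l \<ge> i"
      moreover have "n \<in> K" "n \<notin> B i" using n by (simp_all add: R_def)
      ultimately have "?d (s i n) (s l n) \<le> \<epsilon> / 4" unfolding B_def using not_less by blast
      then show "?d (s i n) (\<psi> n) \<le> \<epsilon> / 4 + ?d (s l n) (\<psi> n)"
        using L2_dist_triangle[OF s(2)[of i n] s(2)[of l n] \<psi>[of n]] by linarith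
    qed
    ultimately have "?d (s i n) (\<psi> n) \<le> \<epsilon> / 4 + 0" by (intro LIMSEQ_le_const) blast+
    then show ?thesis by simp
  qed
  define vals where "vals = range (s i)"
  have vals: "finite vals" using simple_functionD(1)[OF s(1)[of i]] by (simp add: vals_def)
  define \<eta>' where "\<eta>' = \<eta> / (4 * (card vals + 1))"
  have \<eta>': "\<eta>' > 0" using \<eta> by (simp add: \<eta>'_def)
  define Rv where "Rv v = R \<inter> {n. s i n = v}" for v
  have Rv [measurable]: "Rv v \<in> sets borel" for v
  proof -
    have "s i -` {v} \<inter> space \<mu> \<in> sets \<mu>" by (rule simple_functionD(2)[OF s(1)])
    then have "{n. s i n = v} \<in> sets borel" by (simp add: vimage_def)
    then show ?thesis unfolding Rv_def by (rule sets.Int[OF Rb])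
  qed
  \<comment> \<open>The compact pieces: \<open>s i\<close> has the value \<open>v\<close> on \<open>C v\<close>.\<close>
  have "\<forall>v. \<exists>C. compact C \<and> C \<subseteq> Rv v \<and> emeasure \<mu> (Rv v - C) \<le> ennreal \<eta>'"
  proof
    fix v
    have "Rv v \<subseteq> K" by (auto simp: Rv_def R_def)
    from inner_approx[OF Rv this K \<eta>'] obtain C where
      "compact C" "C \<subseteq> Rv v" "emeasure \<mu> (Rv v - C) \<le> ennreal \<eta>'" .
    then show "\<exists>C. compact C \<and> C \<subseteq> Rv v \<and> emeasure \<mu> (Rv v - C) \<le> ennreal \<eta>'" by blast
  qed
  from choice[OF this] obtain C where C: "\<And>v. compact (C v)" "\<And>v. C v \<subseteq> Rv v" "\<And>v. emeasure \<mu> (Rv v - C v) \<le> ennreal \<eta>'"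
    by blast
  define CC where "CC = (\<Union>v\<in>vals. C v)"
  have CC: "compact CC" unfolding CC_def using vals C by (intro compact_UN) auto
  have CCb [measurable]: "CC \<in> sets borel" using compact_imp_closed[OF CC] by simp
  have Cb [measurable]: "C v \<in> sets borel" for v using compact_imp_closed[OF C(1)] by simp
  have KCC: "emeasure \<mu> (K - CC) \<le> ennreal (\<eta> / 2)"
  proof -
    have "K - CC \<subseteq> (B i \<union> N) \<union> (\<Union>v\<in>vals. Rv v - C v)"
    proof
      fix n assume "n \<in> K - CC"
      then have "n \<in> K" "n \<notin> C (s i n)" by (auto simp: CC_def vals_def)
      then have "n \<in> B i \<union> N \<or> n \<in> Rv (s i n) - C (s i n)" by (auto simp: Rv_def R_def)
      then show "n \<in> (B i \<union> N) \<union> (\<Union>v\<in>vals. Rv v - C v)" by (auto simp: vals_def)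
    qed
    moreover have m: "B i \<union> N \<in> sets \<mu>" "(\<Union>v\<in>vals. Rv v - C v) \<in> sets \<mu>"
      using vals by (simp_all add: sets.Un B Nb sets.finite_UN sets.Diff Rv Cb)
    ultimately have "emeasure \<mu> (K - CC) \<le> emeasure \<mu> ((B i \<union> N) \<union> (\<Union>v\<in>vals. Rv v - C v))"
      by (metis emeasure_mono sets.Un)
    also have "\<dots> \<le> emeasure \<mu> (B i \<union> N) + emeasure \<mu> (\<Union>v\<in>vals. Rv v - C v)"
      using m by (rule emeasure_subadditive)
    also have "\<dots> \<le> (emeasure \<mu> (B i) + emeasure \<mu> N) + (\<Sum>v\<in>vals. emeasure \<mu> (Rv v - C v))"
    proof (rule add_mono)
      show "emeasure \<mu> (B i \<union> N) \<le> emeasure \<mu> (B i) + emeasure \<mu> N"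
        by (rule emeasure_subadditive) (simp_all add: B Nb)
      have "(\<lambda>v. Rv v - C v) ` vals \<subseteq> sets \<mu>" using Rv Cb by (simp add: image_subset_iff sets.Diff)
      then show "emeasure \<mu> (\<Union>v\<in>vals. Rv v - C v) \<le> (\<Sum>v\<in>vals. emeasure \<mu> (Rv v - C v))"
        using vals by (intro emeasure_subadditive_finite)
    qed
    also have "\<dots> \<le> (ennreal (\<eta> / 4) + 0) + (\<Sum>v\<in>vals. ennreal \<eta>')"
      using i N C(3) by (intro add_mono sum_mono) (auto simp: null_sets_def)
    also have "(\<Sum>v\<in>vals. ennreal \<eta>') = ennreal (\<Sum>v\<in>vals. \<eta>')"
      using \<eta>' by (intro sum_ennreal) simp
    also have "ennreal (\<eta> / 4) + 0 + ennreal (\<Sum>v\<in>vals. \<eta>') = ennreal (\<eta> / 4 + card vals * \<eta>')"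
      using \<eta> \<eta>' by (simp add: ennreal_plus)
    also have "\<dots> \<le> ennreal (\<eta> / 2)"
      using \<eta> by (intro ennreal_leI) (simp add: \<eta>'_def field_simps)
    finally show ?thesis .
  qed
  \<comment> \<open>A translation that keeps the pieces within \<open>U\<close> and apart from each other can only fail by moving a point from \<open>CC\<close> into \<open>U - CC\<close>.\<close>
  have "0 < \<eta> / 2" using \<eta> by simp
  from outer_approx[OF CCb compact_finite[OF CC] this]
  obtain U where U: "open U" "CC \<subseteq> U" "emeasure \<mu> (U - CC) \<le> ennreal (\<eta> / 2)" .
  have "\<forall>v\<in>vals. \<exists>V. open V \<and> 0 \<in> V \<and> (\<forall>a\<in>V. \<forall>n\<in>C v. a + n \<in> U - (\<Union>w\<in>vals - {v}. C w))"
  proof (intro ballI compact_add_open[OF C(1)])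
    fix v assume that: "v \<in> vals"
    have "compact (\<Union>w\<in>vals - {v}. C w)" using vals C by (intro compact_UN) auto
    then show "open (U - (\<Union>w\<in>vals - {v}. C w))" using U(1) by (intro open_Diff compact_imp_closed)
    have "C v \<inter> C w = {}" if "w \<noteq> v" for w 
    proof -
      have "Rv v \<inter> Rv w = {}" using that by (auto simp: Rv_def)
      then show ?thesis using C(2)[of v] C(2)[of w] by blast
    qed
    then have "\<forall>w\<in>vals - {v}. C v \<inter> C w = {}" by simp
    then have "C v \<inter> (\<Union>w\<in>vals - {v}. C w) = {}" by blast
    moreover have "C v \<subseteq> CC" unfolding CC_def using that by (rule UN_upper)
    ultimately show "C v \<subseteq> U - (\<Union>w\<in>vals - {v}. C w)" using U(2) by blast
  qed
  from bchoice[OF this] obtain W where W0: "\<forall>v\<in>vals. open (W v) \<and> 0 \<in> W v \<and>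
      (\<forall>a\<in>W v. \<forall>n\<in>C v. a + n \<in> U - (\<Union>w\<in>vals - {v}. C w))"
    by (elim exE)
  note W = bspec[OF W0]
  define V where "V = (\<Inter>v\<in>vals. W v)"
  have "open V" unfolding V_def using vals W0 by (intro open_INT ballI) simp_all
  moreover have "0 \<in> V" unfolding V_def using W0 by simp
  moreover have "\<exists>Bad\<in>sets borel. emeasure \<mu> Bad \<le> ennreal \<eta> \<and>
      (\<forall>n\<in>K - Bad. ?d (\<psi> (a + n)) (\<psi> n) \<le> \<epsilon>)" if a: "a \<in> V" for a
  proof (intro bexI conjI ballI)
    define E where "E = CC - {n. a + n \<in> CC}"
    define E' where "E' = {n. a + n \<in> U - CC}"
    have UCC: "U - CC \<in> sets borel" using U(1) CCb by (intro sets.Diff) simp_all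
    have Eb: "E \<in> sets \<mu>" unfolding E_def sets_mu
      by (intro sets.Diff CCb emeasure_vimage_translate(1))
    have Eb': "E' \<in> sets \<mu>" unfolding E'_def sets_mu by (rule emeasure_vimage_translate(1)[OF UCC])
    have KCb: "K - CC \<in> sets \<mu>" unfolding sets_mu by (rule sets.Diff[OF Kb CCb])
    show "(K - CC) \<union> E \<in> sets borel" using sets.Un[OF KCb Eb] by simp
    have "E \<subseteq> E'"
    proof
      fix n assume n: "n \<in> E"
      then obtain v where "v \<in> vals" "n \<in> C v" unfolding CC_def E_def by blast
      then have "a + n \<in> U" using W[of v] a unfolding V_def by blast
      then show "n \<in> E'" using n unfolding E_def E'_def by blast
    qed
    then have "emeasure \<mu> E \<le> emeasure \<mu> E'" using Eb' by (rule emeasure_mono)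
    also have "\<dots> = emeasure \<mu> (U - CC)" unfolding E'_def by (rule emeasure_vimage_translate(2)[OF UCC])
    finally have E: "emeasure \<mu> E \<le> ennreal (\<eta> / 2)" using U(3) by (rule order_trans)
    have "emeasure \<mu> ((K - CC) \<union> E) \<le> emeasure \<mu> (K - CC) + emeasure \<mu> E"
      by (rule emeasure_subadditive[OF KCb Eb])
    also have "\<dots> \<le> ennreal (\<eta> / 2) + ennreal (\<eta> / 2)" using KCC E by (rule add_mono)
    also have "\<dots> = ennreal \<eta>" using \<eta> by (simp flip: ennreal_plus)
    finally show "emeasure \<mu> ((K - CC) \<union> E) \<le> ennreal \<eta>" .
    fix n assume n: "n \<in> K - ((K - CC) \<union> E)"
    then obtain v where v: "v \<in> vals" "n \<in> C v" unfolding CC_def by blast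
    have "a + n \<in> U - (\<Union>w\<in>vals - {v}. C w)" using W[OF v(1)] a v unfolding V_def by blast
    moreover have "a + n \<in> CC" using n unfolding E_def by blast
    ultimately have an: "a + n \<in> C v" unfolding CC_def by blast
    have "s i n = v" "n \<in> R" "s i (a + n) = v" "a + n \<in> R" using C(2)[of v] v an by (auto simp: Rv_def)
    then have "?d (s i n) (\<psi> n) \<le> \<epsilon> / 4" "?d (s i n) (\<psi> (a + n)) \<le> \<epsilon> / 4" using R[of n] R[of "a + n"] by simp_all
    then show "?d (\<psi> (a + n)) (\<psi> n) \<le> \<epsilon>"
      using L2_dist_triangle[OF \<psi>[of "a + n"] s(2)[of i n] \<psi>[of n]] \<epsilon> by (simp add: L2_dist_commute)
  qed
  ultimately show ?thesis by blast
qed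

section \<open>Measurable polynomial maps are continuous\<close>

locale polynomial_system = operator_system M G + haar \<mu> + polynomial_maps "BijGroup (L2 M)" Gs len
  for M :: "'x measure" and G :: "'x operator set"
    and \<mu> :: "'g::{topological_group_add, t2_space} measure"
    and Gs :: "nat \<Rightarrow> 'x operator set" and len :: nat +
  assumes Gs_0: "Gs 0 = G"
    and loc_compact: "locally_compact_space (euclidean :: 'g topology)"
begin

definition strongly_continuous :: "('g \<Rightarrow> 'x operator) \<Rightarrow> bool" where
  "strongly_continuous g \<longleftrightarrow> (\<forall>n. g n \<in> G) \<and>
    (\<forall>u\<in>sq_int M. \<forall>n0. ((\<lambda>n. nrm M (\<lambda>x. act M (g n) u x - act M (g n0) u x)) \<longlongrightarrow> 0) (nhds n0))"

lemma pmap_G: "g \<in> pmap t \<Longrightarrow> g n \<in> G"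
  using pmap_value[of g t n] Gs_mono[of 0 t] Gs_0 by auto

definition move :: "('x \<Rightarrow> complex) \<Rightarrow> 'x operator \<Rightarrow> real" where
  "move u T = nrm M (\<lambda>x. act M T u x - u x)"

lemma move_one:
  assumes "u \<in> sq_int M"
  shows "move u \<one>\<^bsub>H\<^esub> = 0"
proof -
  have "move u \<one>\<^bsub>H\<^esub> = nrm M (\<lambda>x. 0)" unfolding move_def
  proof (rule nrm_cong_AE)
    show "AE x in M. act M \<one>\<^bsub>H\<^esub> u x - u x = 0" using act_one[OF assms] by eventually_elim simp
  qed (intro sq_intD sq_int_diff sq_int_zero act_sq_int assms G_closed)+
  then show ?thesis by simp
qed

lemma move_mult:
  assumes "T \<in> G" "S \<in> G" "u \<in> sq_int M"
  shows "move u (T \<otimes>\<^bsub>H\<^esub> S) \<le> move u S + move u T"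
proof -
  have s: "act M S u \<in> sq_int M" using assms by (simp add: act_sq_int)
  have "move u (T \<otimes>\<^bsub>H\<^esub> S) \<le> nrm M (\<lambda>x. act M T (act M S u) x - act M T u x) + move u T"
    unfolding move_def act_mult_op[OF assms] using assms s by (intro nrm_triangle_diff act_sq_int)
  then show ?thesis unfolding act_nrm_diff[OF assms(1) s assms(3)] by (simp add: move_def)
qed

lemma move_inv_mult:
  assumes "T \<in> G" "S \<in> G" "u \<in> sq_int M"
  shows "move u (inv\<^bsub>H\<^esub> T \<otimes>\<^bsub>H\<^esub> S) = nrm M (\<lambda>x. act M S u x - act M T u x)"
proof -
  have s: "act M S u \<in> sq_int M" "inv\<^bsub>H\<^esub> T \<in> G" using assms by (simp_all add: act_sq_int)
  have "nrm M (\<lambda>x. act M S u x - act M T u x)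
      = nrm M (\<lambda>x. act M T (act M (inv\<^bsub>H\<^esub> T) (act M S u)) x - act M T u x)"
  proof (rule nrm_cong_AE)
    show "AE x in M. act M S u x - act M T u x =
        act M T (act M (inv\<^bsub>H\<^esub> T) (act M S u)) x - act M T u x"
      using act_inv(1)[OF assms(1) s(1)] by eventually_elim simp
  qed (intro sq_intD sq_int_diff act_sq_int assms s)+
  also have "\<dots> = nrm M (\<lambda>x. act M (inv\<^bsub>H\<^esub> T) (act M S u) x - u x)"
    using act_nrm_diff[OF assms(1) act_sq_int[OF s(2,1)] assms(3)] .
  finally show ?thesis unfolding move_def act_mult_op[OF s(2) assms(2,3)] by simp
qed

lemma move_inv:
  assumes "T \<in> G" "u \<in> sq_int M"
  shows "move u (inv\<^bsub>H\<^esub> T) = move u T"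
proof -
  have "move u (inv\<^bsub>H\<^esub> T) = move u (inv\<^bsub>H\<^esub> T \<otimes>\<^bsub>H\<^esub> \<one>\<^bsub>H\<^esub>)" using assms by simp
  also have "\<dots> = nrm M (\<lambda>x. act M \<one>\<^bsub>H\<^esub> u x - act M T u x)" using assms by (intro move_inv_mult) auto
  also have "\<dots> = nrm M (\<lambda>x. u x - act M T u x)"
  proof (rule nrm_cong_AE)
    show "AE x in M. act M \<one>\<^bsub>H\<^esub> u x - act M T u x = u x - act M T u x"
      using act_one[OF assms(2)] by eventually_elim simp
  qed (intro sq_intD sq_int_diff act_sq_int assms G_closed)+
  finally show ?thesis unfolding move_def by (simp add: nrm_minus_commute)
qed

text \<open>
  The value of a polynomial map at a point is a product of its values, or their inverses, at the other
  vertices of a cube whose dimension exceeds the degree. The edges of the cube can be chosen so that these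
  vertices avoid the exceptional set. A product of operators that hardly move \<open>u\<close> hardly moves \<open>u\<close>, so the
  movement of other vectors does not enter.
\<close>

lemma polynomial_small_movement:
  "\<forall>n0 U. open U \<longrightarrow> n0 \<in> U \<longrightarrow> (\<exists>\<eta>>0. \<forall>t k Bad u \<epsilon>. len \<le> t + r \<longrightarrow> k \<in> pmap t \<longrightarrow> u \<in> sq_int M \<longrightarrow>
    Bad \<in> sets borel \<longrightarrow> emeasure \<mu> Bad \<le> ennreal \<eta> \<longrightarrow> 0 \<le> \<epsilon> \<longrightarrow> (\<forall>n\<in>U - Bad. move u (k n) \<le> \<epsilon>) \<longrightarrow>
    move u (k n0) \<le> 3 ^ r * \<epsilon>)"
proof (induction r)
  case 0
  have base: "move u (k n0) \<le> \<epsilon>" if "len \<le> t" "k \<in> pmap t" "u \<in> sq_int M" "0 \<le> \<epsilon>" for t k u n0 \<epsilon>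
  proof -
    have "k n0 = \<one>\<^bsub>H\<^esub>" using pmap_value[OF that(2), of n0] Gs_trivial[OF that(1)] by simp
    then show ?thesis using that by (simp add: move_one)
  qed
  show ?case by (intro allI impI exI[of _ "1::real"] conjI zero_less_one) (simp add: base)
next
  case (Suc r)
  show ?case
  proof (intro allI impI)
    fix n0 :: 'g and U :: "'g set"
    assume U: "open U" "n0 \<in> U"
    have "0 + n0 \<in> U" using U by simp
    from open_add_split[OF U(1) this] obtain W U' where W: "open W" "0 \<in> W" and U': "open U'" "n0 \<in> U'"
      and WU: "\<And>x n. x \<in> W \<Longrightarrow> n \<in> U' \<Longrightarrow> x + n \<in> U" by blast
    from Suc.IH[rule_format, OF U'] obtain \<eta>1 where \<eta>1: "\<eta>1 > 0"
      and IH: "\<And>t k Bad u \<epsilon>. len \<le> t + r \<Longrightarrow> k \<in> pmap t \<Longrightarrow> u \<in> sq_int M \<Longrightarrow>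
        Bad \<in> sets borel \<Longrightarrow> emeasure \<mu> Bad \<le> ennreal \<eta>1 \<Longrightarrow> 0 \<le> \<epsilon> \<Longrightarrow> (\<forall>n\<in>U' - Bad. move u (k n) \<le> \<epsilon>) \<Longrightarrow>
        move u (k n0) \<le> 3 ^ r * \<epsilon>" by blast
    \<comment> \<open>The edge of the cube will lead from \<open>n0\<close> to a point of \<open>Y\<close> outside the exceptional set.\<close>
    define Y where "Y = {y. y + - n0 \<in> W}"
    have "continuous_on UNIV (\<lambda>y. y + - n0)" by (intro continuous_intros)
    then have "open Y" unfolding Y_def using W(1) open_vimage[of W "\<lambda>y. y + - n0"] by (simp add: vimage_def)
    moreover have "n0 \<in> Y" using W(2) by (simp add: Y_def)
    ultimately have "emeasure \<mu> Y > 0" using open_pos[of Y] by blast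
    then obtain z where z: "0 < z" "z < emeasure \<mu> Y" using dense by blast
    define \<eta>2 where "\<eta>2 = enn2real z"
    have "z < \<top>" using z(2) by (rule less_le_trans) simp
    then have \<eta>2: "\<eta>2 > 0" "ennreal \<eta>2 < emeasure \<mu> Y"
      using z by (simp_all add: \<eta>2_def enn2real_positive_iff)
    define \<eta> where "\<eta> = min \<eta>2 (\<eta>1 / 2)"
    have "\<eta> > 0" using \<eta>1 \<eta>2 by (simp add: \<eta>_def)
    moreover have "move u (k n0) \<le> 3 ^ Suc r * \<epsilon>"
      if A: "len \<le> t + Suc r" "k \<in> pmap t" "u \<in> sq_int M" "Bad \<in> sets borel"
        "emeasure \<mu> Bad \<le> ennreal \<eta>" "0 \<le> \<epsilon>" "\<forall>n\<in>U - Bad. move u (k n) \<le> \<epsilon>" for t k Bad u \<epsilon>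
    proof -
      have kG: "k n \<in> G" for n by (rule pmap_G[OF A(2)])
      have "emeasure \<mu> Bad < emeasure \<mu> Y"
      proof -
        have "ennreal \<eta> \<le> ennreal \<eta>2" by (rule ennreal_leI) (simp add: \<eta>_def)
        with A(5) have "emeasure \<mu> Bad \<le> ennreal \<eta>2" by (rule order_trans)
        then show ?thesis using \<eta>2(2) by (rule le_less_trans)
      qed
      then have "\<not> Y \<subseteq> Bad" using emeasure_mono[of Y Bad \<mu>] A(4) by auto
      then obtain y where y: "y \<in> Y" "y \<notin> Bad" by blast
      define x where "x = y + - n0"
      have x: "x \<in> W" "x + n0 = y" using y by (simp_all add: x_def Y_def add.assoc)
      \<comment> \<open>The derivative \<open>k1\<close> moves \<open>u\<close> by at most \<open>2 \<epsilon>\<close>, and \<open>k n0\<close> is \<open>k y\<close> times the inverse of \<open>k1 n0\<close>; this gives the factor 3.\<close>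
      define k1 where "k1 = deriv_map x 0 k"
      have k1: "k1 \<in> pmap (Suc t)" unfolding k1_def by (rule pmap_deriv[OF A(2)])
      have k1G: "k1 n \<in> G" for n by (rule pmap_G[OF k1])
      have k1n: "k1 n = inv\<^bsub>H\<^esub> (k n) \<otimes>\<^bsub>H\<^esub> k (x + n)" for n by (simp add: k1_def deriv_map_def)
      define Bad' where "Bad' = Bad \<union> {n. x + n \<in> Bad}"
      have tr: "{n. x + n \<in> Bad} \<in> sets borel" "emeasure \<mu> {n. x + n \<in> Bad} = emeasure \<mu> Bad"
        using emeasure_vimage_translate[OF A(4)] by simp_all
      have "emeasure \<mu> Bad' \<le> emeasure \<mu> Bad + emeasure \<mu> {n. x + n \<in> Bad}"
        unfolding Bad'_def using tr(1) A(4) by (intro emeasure_subadditive) simp_all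
      also have "\<dots> \<le> ennreal (\<eta>1 / 2) + ennreal (\<eta>1 / 2)"
      proof -
        have "emeasure \<mu> Bad \<le> ennreal (\<eta>1 / 2)"
          using A(5) by (rule order_trans) (simp add: \<eta>_def ennreal_leI)
        then show ?thesis unfolding tr(2) by (intro add_mono)
      qed
      also have "\<dots> = ennreal \<eta>1" using \<eta>1 by (simp flip: ennreal_plus)
      finally have "emeasure \<mu> Bad' \<le> ennreal \<eta>1" .
      moreover have "move u (k1 n) \<le> 2 * \<epsilon>" if n: "n \<in> U' - Bad'" for n
      proof -
        have "0 + n \<in> U" "x + n \<in> U" using n W(2) x(1) by (intro WU; simp)+
        then have "move u (k n) \<le> \<epsilon>" "move u (k (x + n)) \<le> \<epsilon>"
          using n A(7) by (simp_all add: Bad'_def)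
        then show ?thesis
          using move_mult[of "inv\<^bsub>H\<^esub> (k n)" "k (x + n)" u] move_inv[OF kG[of n] A(3)] kG A(3)
          unfolding k1n by simp
      qed
      moreover have "Bad' \<in> sets borel" unfolding Bad'_def using tr(1) A(4) by (rule sets.Un[rotated])
      ultimately have "move u (k1 n0) \<le> 3 ^ r * (2 * \<epsilon>)"
        using IH[of "Suc t" k1 u Bad' "2 * \<epsilon>"] k1 A(1,3,6) by simp
      moreover have "move u (k y) \<le> \<epsilon>"
        using y A(7) WU[OF x(1) U'(2)] x(2) by simp
      moreover have "move u (k n0) \<le> move u (inv\<^bsub>H\<^esub> (k1 n0)) + move u (k y)"
      proof -
        have "k n0 = k y \<otimes>\<^bsub>H\<^esub> inv\<^bsub>H\<^esub> (k1 n0)"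
          unfolding k1n x(2) using kG by (simp add: H.inv_mult_group cancel)
        then show ?thesis using move_mult[of "k y" "inv\<^bsub>H\<^esub> (k1 n0)" u] kG k1G A(3) by simp
      qed
      ultimately have "move u (k n0) \<le> 3 ^ r * (2 * \<epsilon>) + \<epsilon>"
        using move_inv[OF k1G[of n0] A(3)] by linarith
      also have "\<dots> \<le> 3 ^ r * (2 * \<epsilon>) + 3 ^ r * \<epsilon>" using mult_right_mono[of 1 "3 ^ r" \<epsilon>] A(6) by (simp add: mult.commute)
      also have "\<dots> = 3 ^ Suc r * \<epsilon>" by simp
      finally show ?thesis .
    qed
    ultimately show "\<exists>\<eta>>0. \<forall>t k Bad u \<epsilon>. len \<le> t + Suc r \<longrightarrow> k \<in> pmap t \<longrightarrow> u \<in> sq_int M \<longrightarrow>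
      Bad \<in> sets borel \<longrightarrow> emeasure \<mu> Bad \<le> ennreal \<eta> \<longrightarrow> 0 \<le> \<epsilon> \<longrightarrow> (\<forall>n\<in>U - Bad. move u (k n) \<le> \<epsilon>) \<longrightarrow>
      move u (k n0) \<le> 3 ^ Suc r * \<epsilon>" by blast
  qed
qed

text \<open>
  By continuity of translations in measure, the derivative of \<open>g\<close> in a small direction hardly moves \<open>u\<close> off a
  small set. As the derivative is polynomial, it hardly moves \<open>u\<close> at any point.
\<close>

theorem measurable_polynomial_strongly_continuous:
  assumes g: "g \<in> pmap 0" and meas: "operator_measurable M \<mu> g"
  shows "strongly_continuous g"
  unfolding strongly_continuous_def
proof (intro conjI allI ballI)
  show gG: "g n \<in> G" for n by (rule pmap_G[OF g])
  fix u n0 assume u: "u \<in> sq_int M"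
  show "((\<lambda>n. nrm M (\<lambda>x. act M (g n) u x - act M (g n0) u x)) \<longlongrightarrow> 0) (nhds n0)"
  proof (rule tendstoI)
    fix e :: real assume e: "0 < e"
    define \<epsilon> where "\<epsilon> = e / (2 * 3 ^ len)"
    have \<epsilon>: "\<epsilon> > 0" "3 ^ len * \<epsilon> < e" using e by (simp_all add: \<epsilon>_def)
    have "\<exists>U K. open U \<and> compact K \<and> n0 \<in> U \<and> U \<subseteq> K"
      using loc_compact unfolding locally_compact_space_def by simp
    then obtain U K where U: "open U" "compact K" "n0 \<in> U" "U \<subseteq> K" by blast
    from polynomial_small_movement[of len, rule_format, OF U(1,3)] obtain \<eta> where \<eta>: "\<eta> > 0"
      and small: "\<And>t k Bad u \<epsilon>. len \<le> t + len \<Longrightarrow> k \<in> pmap t \<Longrightarrow> u \<in> sq_int M \<Longrightarrow>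
        Bad \<in> sets borel \<Longrightarrow> emeasure \<mu> Bad \<le> ennreal \<eta> \<Longrightarrow> 0 \<le> \<epsilon> \<Longrightarrow> (\<forall>n\<in>U - Bad. move u (k n) \<le> \<epsilon>) \<Longrightarrow>
        move u (k n0) \<le> 3 ^ len * \<epsilon>" by blast
    let ?\<psi> = "\<lambda>n. g n (ae_class M u)"
    have "L2_measurable M \<mu> ?\<psi>" using meas class_L2[OF u] by (simp add: operator_measurable_def)
    moreover have "?\<psi> n \<in> L2 M" for n using G_L2[OF gG class_L2[OF u]] .
    ultimately obtain V where V: "open V" "0 \<in> V"
      and Vs: "\<And>a. a \<in> V \<Longrightarrow> \<exists>Bad\<in>sets borel. emeasure \<mu> Bad \<le> ennreal \<eta> \<and>
        (\<forall>n\<in>K - Bad. L2_dist M (?\<psi> (a + n)) (?\<psi> n) \<le> \<epsilon>)"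
      using translation_continuous_in_measure[of M ?\<psi> K \<epsilon> \<eta>] U(2) \<epsilon>(1) \<eta> by blast
    have dist: "L2_dist M (?\<psi> (a + n)) (?\<psi> n) = nrm M (\<lambda>x. act M (g (a + n)) u x - act M (g n) u x)" for a n
      by (simp add: L2_dist_nrm act_def)
    have mv: "move u (deriv_map a 0 g n) = nrm M (\<lambda>x. act M (g (a + n)) u x - act M (g n) u x)" for a n
      unfolding deriv_map_def using move_inv_mult[OF gG gG u] by simp
    have near: "nrm M (\<lambda>x. act M (g (a + n0)) u x - act M (g n0) u x) < e" if a: "a \<in> V" for a
    proof -
      obtain Bad where Bad: "Bad \<in> sets borel" "emeasure \<mu> Bad \<le> ennreal \<eta>"
        "\<forall>n\<in>K - Bad. L2_dist M (?\<psi> (a + n)) (?\<psi> n) \<le> \<epsilon>" using Vs[OF a] by blast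
      have "\<forall>n\<in>U - Bad. move u (deriv_map a 0 g n) \<le> \<epsilon>"
        using Bad(3) U(4) unfolding mv dist by blast
      then have "move u (deriv_map a 0 g n0) \<le> 3 ^ len * \<epsilon>"
        using small[of "Suc 0" "deriv_map a 0 g" u Bad \<epsilon>] pmap_deriv[OF g, of a 0] u Bad(1,2) \<epsilon>(1) by simp
      then show ?thesis using \<epsilon>(2) unfolding mv by simp
    qed
    have "((\<lambda>n. n + - n0) \<longlongrightarrow> n0 + - n0) (nhds n0)" by (intro tendsto_add tendsto_const filterlim_ident)
    then have "\<forall>\<^sub>F n in nhds n0. n + - n0 \<in> V"
      by (rule topological_tendstoD) (use V in simp_all)
    then show "\<forall>\<^sub>F n in nhds n0. dist (nrm M (\<lambda>x. act M (g n) u x - act M (g n0) u x)) 0 < e"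
    proof eventually_elim
      case (elim n)
      from near[OF this] show ?case by (simp add: add.assoc)
    qed
  qed
qed

end

section \<open>Averages of continuous vector-valued functions\<close>

definition cont_bdd :: "'x measure \<Rightarrow> ('g::topological_space \<Rightarrow> 'x \<Rightarrow> complex) \<Rightarrow> real \<Rightarrow> bool" where
  "cont_bdd M F B \<longleftrightarrow> (\<forall>n. F n \<in> sq_int M) \<and> (\<forall>n. nrm M (F n) \<le> B) \<and>
    (\<forall>n0. ((\<lambda>n. nrm M (\<lambda>x. F n x - F n0 x)) \<longlongrightarrow> 0) (nhds n0))"

lemma cont_bdd_sq_int: "cont_bdd M F B \<Longrightarrow> F n \<in> sq_int M"
  and cont_bdd_nrm: "cont_bdd M F B \<Longrightarrow> nrm M (F n) \<le> B"
  and cont_bdd_cont: "cont_bdd M F B \<Longrightarrow> ((\<lambda>n. nrm M (\<lambda>x. F n x - F n0 x)) \<longlongrightarrow> 0) (nhds n0)"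
  by (simp_all add: cont_bdd_def)

lemma cont_bddI:
  assumes "\<And>n. F n \<in> sq_int M" "\<And>n. nrm M (F n) \<le> B"
    "\<And>n0. ((\<lambda>n. nrm M (\<lambda>x. F n x - F n0 x)) \<longlongrightarrow> 0) (nhds n0)"
  shows "cont_bdd M F B"
  using assms by (simp add: cont_bdd_def)

lemma cont_bdd_nonneg: "cont_bdd M F B \<Longrightarrow> 0 \<le> B"
  by (rule order_trans[OF nrm_nonneg cont_bdd_nrm])

text \<open>Continuity is usually shown by comparison with functions that tend to zero.\<close>

lemma tendsto_0_le:
  fixes f g :: "'b \<Rightarrow> real"
  assumes "(g \<longlongrightarrow> 0) F" "\<And>x. 0 \<le> f x" "\<And>x. f x \<le> g x"
  shows "(f \<longlongrightarrow> 0) F"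
  by (rule tendsto_sandwich[OF _ _ tendsto_const assms(1)]) (simp_all add: assms)

lemma cont_bdd_translate:
  fixes F :: "'g::topological_group_add \<Rightarrow> _"
  assumes "cont_bdd M F B"
  shows "cont_bdd M (\<lambda>n. F (a + n + b)) B"
proof (rule cont_bddI)
  fix n0
  have "((\<lambda>n. a + n + b) \<longlongrightarrow> a + n0 + b) (nhds n0)"
    by (intro tendsto_add tendsto_const filterlim_ident)
  from filterlim_compose[OF cont_bdd_cont[OF assms] this]
  show "((\<lambda>n. nrm M (\<lambda>x. F (a + n + b) x - F (a + n0 + b) x)) \<longlongrightarrow> 0) (nhds n0)" .
qed (rule cont_bdd_sq_int[OF assms] cont_bdd_nrm[OF assms])+

lemma cont_bdd_translate_left:
  fixes F :: "'g::topological_group_add \<Rightarrow> _"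
  shows "cont_bdd M F B \<Longrightarrow> cont_bdd M (\<lambda>n. F (a + n)) B"
  using cont_bdd_translate[of M F B a 0] by simp

lemma cont_bdd_const: "f \<in> sq_int M \<Longrightarrow> nrm M f \<le> B \<Longrightarrow> cont_bdd M (\<lambda>n. f) B"
  by (rule cont_bddI) simp_all

lemma cont_bdd_cnj:
  assumes "cont_bdd M F B"
  shows "cont_bdd M (\<lambda>n x. cnj (F n x)) B"
proof (rule cont_bddI)
  have "nrm M (\<lambda>x. cnj (F n x)) = nrm M (F n)" for n by (simp add: nrm_def)
  then show "nrm M (\<lambda>x. cnj (F n x)) \<le> B" for n using cont_bdd_nrm[OF assms] by simp
  have "nrm M (\<lambda>x. cnj (F n x) - cnj (F n0 x)) = nrm M (\<lambda>x. F n x - F n0 x)" for n n0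
    by (simp add: nrm_def flip: complex_cnj_diff)
  then show "((\<lambda>n. nrm M (\<lambda>x. cnj (F n x) - cnj (F n0 x))) \<longlongrightarrow> 0) (nhds n0)" for n0
    using cont_bdd_cont[OF assms] by simp
qed (rule sq_int_cnj[OF cont_bdd_sq_int[OF assms]])

lemma cont_bdd_cmult:
  assumes "cont_bdd M F B"
  shows "cont_bdd M (\<lambda>n x. c * F n x) (cmod c * B)"
proof (rule cont_bddI)
  show "nrm M (\<lambda>x. c * F n x) \<le> cmod c * B" for n
    unfolding nrm_cmult using cont_bdd_nrm[OF assms] by (rule mult_left_mono) simp
  have "nrm M (\<lambda>x. c * F n x - c * F n0 x) = cmod c * nrm M (\<lambda>x. F n x - F n0 x)" for n n0
    by (simp add: nrm_cmult flip: right_diff_distrib)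
  moreover have "((\<lambda>n. cmod c * nrm M (\<lambda>x. F n x - F n0 x)) \<longlongrightarrow> 0) (nhds n0)" for n0
    by (rule tendsto_mult_right_zero[OF cont_bdd_cont[OF assms]])
  ultimately show "((\<lambda>n. nrm M (\<lambda>x. c * F n x - c * F n0 x)) \<longlongrightarrow> 0) (nhds n0)" for n0
    by simp
qed (rule sq_int_cmult[OF cont_bdd_sq_int[OF assms]])

lemma cont_bdd_add:
  assumes F: "cont_bdd M F B" and G: "cont_bdd M G C"
  shows "cont_bdd M (\<lambda>n x. F n x + G n x) (B + C)"
proof (rule cont_bddI)
  note s = cont_bdd_sq_int[OF F] cont_bdd_sq_int[OF G]
  show "nrm M (\<lambda>x. F n x + G n x) \<le> B + C" for n
    using nrm_triangle[OF s, of n n] cont_bdd_nrm[OF F, of n] cont_bdd_nrm[OF G, of n] by linarith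
  fix n0
  show "((\<lambda>n. nrm M (\<lambda>x. F n x + G n x - (F n0 x + G n0 x))) \<longlongrightarrow> 0) (nhds n0)"
  proof (rule tendsto_0_le)
    show "((\<lambda>n. nrm M (\<lambda>x. F n x - F n0 x) + nrm M (\<lambda>x. G n x - G n0 x)) \<longlongrightarrow> 0) (nhds n0)"
      using tendsto_add[OF cont_bdd_cont[OF F] cont_bdd_cont[OF G]] by simp
    show "nrm M (\<lambda>x. F n x + G n x - (F n0 x + G n0 x)) \<le>
        nrm M (\<lambda>x. F n x - F n0 x) + nrm M (\<lambda>x. G n x - G n0 x)" for n
      using nrm_triangle[OF sq_int_diff[OF s(1) s(1)] sq_int_diff[OF s(2) s(2)], of n n0 n n0]
      by (simp add: algebra_simps)
  qed simp
qed (rule sq_int_add[OF cont_bdd_sq_int[OF F] cont_bdd_sq_int[OF G]])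

lemma cont_bdd_sum:
  "finite T \<Longrightarrow> (\<And>t. t \<in> T \<Longrightarrow> cont_bdd M (F t) (B t)) \<Longrightarrow>
    cont_bdd M (\<lambda>n x. \<Sum>t\<in>T. c t * F t n x) (\<Sum>t\<in>T. cmod (c t) * B t)"
proof (induction T rule: finite_induct)
  case empty
  show ?case using cont_bdd_const[OF sq_int_zero, of M 0] by simp
next
  case (insert t T)
  then show ?case using cont_bdd_add[OF cont_bdd_cmult[of M "F t" "B t" "c t"], of "\<lambda>n x. \<Sum>t\<in>T. c t * F t n x"] by simp
qed

context prob_space
begin

lemma cont_bdd_mult:
  fixes F :: "'g::topological_space \<Rightarrow> _"
  assumes F: "cont_bdd M F B" "\<And>n. F n \<in> bdd M C" and G: "cont_bdd M G B'" "\<And>n. G n \<in> bdd M D"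
  shows "cont_bdd M (\<lambda>n x. F n x * G n x) (C * B')"
proof (rule cont_bddI)
  note nn = bdd_nonneg[OF F(2)] bdd_nonneg[OF G(2)]
  note s = cont_bdd_sq_int[OF F(1)] cont_bdd_sq_int[OF G(1)]
  show "(\<lambda>x. F n x * G n x) \<in> sq_int M" for n by (rule bdd_mult_sq_int(1)[OF F(2) s(2) nn(1)])
  show "nrm M (\<lambda>x. F n x * G n x) \<le> C * B'" for n
    using bdd_mult_sq_int(2)[OF F(2) s(2) nn(1), of n n] mult_left_mono[OF cont_bdd_nrm[OF G(1), of n] nn(1)]
    by linarith
  fix n0
  show "((\<lambda>n. nrm M (\<lambda>x. F n x * G n x - F n0 x * G n0 x)) \<longlongrightarrow> 0) (nhds n0)"
  proof (rule tendsto_0_le)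
    show "((\<lambda>n. C * nrm M (\<lambda>x. G n x - G n0 x) + D * nrm M (\<lambda>x. F n x - F n0 x)) \<longlongrightarrow> 0) (nhds n0)"
      using tendsto_add[OF tendsto_mult_right_zero[OF cont_bdd_cont[OF G(1)]] tendsto_mult_right_zero[OF cont_bdd_cont[OF F(1)]]]
      by simp
    show "nrm M (\<lambda>x. F n x * G n x - F n0 x * G n0 x) \<le>
        C * nrm M (\<lambda>x. G n x - G n0 x) + D * nrm M (\<lambda>x. F n x - F n0 x)" for n
      by (rule nrm_mult_diff_le[OF F(2) s(1) s(2) G(2) s(2) s(1) nn])
  qed simp
qed

lemma cont_bdd_prod:
  fixes F :: "'i \<Rightarrow> 'g::topological_space \<Rightarrow> _"
  shows "finite I \<Longrightarrow> (\<And>i. i \<in> I \<Longrightarrow> cont_bdd M (F i) 1) \<Longrightarrow> (\<And>i n. i \<in> I \<Longrightarrow> F i n \<in> bdd M 1) \<Longrightarrow>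
    cont_bdd M (\<lambda>n x. \<Prod>i\<in>I. F i n x) 1"
proof (induction I rule: finite_induct)
  case empty
  show ?case using cont_bdd_const[OF one_sq_int, of 1] nrm_one by simp
next
  case (insert i I)
  have "cont_bdd M (\<lambda>n x. F i n x * (\<Prod>i\<in>I. F i n x)) (1 * 1)"
  proof (rule cont_bdd_mult[where C=1 and D=1 and B=1 and B'=1])
    show "(\<lambda>x. \<Prod>i\<in>I. F i n x) \<in> bdd M 1" for n using insert by (intro bdd_prod) simp
  qed (use insert in simp_all)
  then show ?case using insert by simp
qed

lemma cont_bdd_ip_cont:
  fixes F :: "'g::topological_space \<Rightarrow> _"
  assumes F: "cont_bdd M F B" and h: "h \<in> sq_int M"
  shows "continuous_on UNIV (\<lambda>n. ip M (F n) h)"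
  unfolding continuous_on_def
proof
  fix n0
  note s = cont_bdd_sq_int[OF F]
  have "((\<lambda>n. cmod (ip M (F n) h - ip M (F n0) h)) \<longlongrightarrow> 0) (nhds n0)"
  proof (rule tendsto_0_le)
    show "((\<lambda>n. nrm M (\<lambda>x. F n x - F n0 x) * nrm M h) \<longlongrightarrow> 0) (nhds n0)"
      by (rule tendsto_mult_left_zero[OF cont_bdd_cont[OF F]])
    show "cmod (ip M (F n) h - ip M (F n0) h) \<le> nrm M (\<lambda>x. F n x - F n0 x) * nrm M h" for n
      using cauchy_schwarz[OF sq_int_diff[OF s s] h, of n n0] ip_diff_left[OF s s h, of n n0] by simp
  qed simp
  then have "((\<lambda>n. ip M (F n) h) \<longlongrightarrow> ip M (F n0) h) (nhds n0)"
    by (simp add: tendsto_norm_zero_iff LIM_zero_iff)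
  then show "((\<lambda>n. ip M (F n) h) \<longlongrightarrow> ip M (F n0) h) (at n0 within UNIV)"
    by (rule tendsto_mono[OF at_within_le_nhds])
qed

lemma cont_bdd_ip_bound:
  assumes F: "cont_bdd M F B" and h: "h \<in> sq_int M"
  shows "cmod (ip M (F n) h) \<le> B * nrm M h"
  using cauchy_schwarz[OF cont_bdd_sq_int[OF F] h, of n] mult_right_mono[OF cont_bdd_nrm[OF F, of n] nrm_nonneg[of M h]]
  by linarith

lemma cont_bdd_ip_measurable:
  fixes F :: "'g::topological_space \<Rightarrow> _"
  assumes "cont_bdd M F B" "h \<in> sq_int M" "sets \<nu> = sets borel"
  shows "(\<lambda>n. ip M (F n) h) \<in> borel_measurable \<nu>"
  using borel_measurable_continuous_onI[OF cont_bdd_ip_cont[OF assms(1,2)]] assms(3)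
  by (simp cong: measurable_cong_sets)

end

text \<open>
  A probability measure \<open>\<nu>\<close> and a shift \<open>a\<close> describe the average of \<open>F (a + n)\<close> over \<open>n\<close>; all arguments
  that occur lie in the compact set \<open>Z\<close>.
\<close>

definition averaging :: "'g::{topological_group_add, t2_space} measure \<Rightarrow> 'g \<Rightarrow> 'g set \<Rightarrow> bool" where
  "averaging \<nu> a Z \<longleftrightarrow> prob_space \<nu> \<and> sets \<nu> = sets borel \<and> compact Z \<and> (AE n in \<nu>. a + n \<in> Z)"

text \<open>A weak integral; pairings determine it up to null sets.\<close>

definition is_mean :: "'x measure \<Rightarrow> 'g::{topological_group_add, t2_space} measure \<Rightarrow> 'g \<Rightarrow>
    ('g \<Rightarrow> 'x \<Rightarrow> complex) \<Rightarrow> ('x \<Rightarrow> complex) \<Rightarrow> bool" where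
  "is_mean M \<nu> a F v \<longleftrightarrow> v \<in> sq_int M \<and> (\<forall>h\<in>sq_int M. ip M v h = (\<integral>n. ip M (F (a + n)) h \<partial>\<nu>))"

lemma is_meanD: "is_mean M \<nu> a F v \<Longrightarrow> v \<in> sq_int M"
  "is_mean M \<nu> a F v \<Longrightarrow> h \<in> sq_int M \<Longrightarrow> ip M v h = (\<integral>n. ip M (F (a + n)) h \<partial>\<nu>)"
  by (simp_all add: is_mean_def)

text \<open>Take the first of the sets that contains the point; this choice is Borel.\<close>

lemma open_selector:
  fixes W :: "'g::topological_space \<Rightarrow> 'g set"
  shows "finite Q \<Longrightarrow> Q \<noteq> {} \<Longrightarrow> (\<And>b. b \<in> Q \<Longrightarrow> open (W b)) \<Longrightarrow>
    \<exists>c. (\<forall>n. c n \<in> Q) \<and> (\<forall>b. {n. c n = b} \<in> sets borel) \<and> (\<forall>n\<in>(\<Union>b\<in>Q. W b). n \<in> W (c n))"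
proof (induction Q rule: finite_ne_induct)
  case (singleton b)
  show ?case by (rule exI[of _ "\<lambda>_. b"]) simp
next
  case (insert b Q)
  have "\<exists>c. (\<forall>n. c n \<in> Q) \<and> (\<forall>b. {n. c n = b} \<in> sets borel) \<and> (\<forall>n\<in>(\<Union>b\<in>Q. W b). n \<in> W (c n))"
    by (rule insert.IH) (use insert.prems in simp)
  then obtain c where c0: "\<forall>n. c n \<in> Q" "\<forall>b. {n. c n = b} \<in> sets borel" "\<forall>n\<in>(\<Union>b\<in>Q. W b). n \<in> W (c n)"
    by (elim exE conjE)
  note c = spec[OF c0(1)] spec[OF c0(2)] bspec[OF c0(3)]
  define c' where "c' n = (if n \<in> W b then b else c n)" for n
  have Wb: "W b \<in> sets borel" using insert by simp
  have "{n. c' n = b'} \<in> sets borel" for b'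
  proof -
    have "{n. c' n = b'} = (if b = b' then W b else {}) \<union> ({n. c n = b'} - W b)"
      by (auto simp: c'_def)
    also have "(if b = b' then W b else {}) \<in> sets borel" using Wb by (cases "b = b'") auto
    then have "(if b = b' then W b else {}) \<union> ({n. c n = b'} - W b) \<in> sets borel"
      using Wb c(2) by (intro sets.Un sets.Diff)
    finally show ?thesis .
  qed
  moreover have "n \<in> W (c' n)" if "n \<in> (\<Union>b\<in>insert b Q. W b)" for n
    using that c(3)[of n] by (cases "n \<in> W b") (simp_all add: c'_def)
  moreover have "c' n \<in> insert b Q" for n using c(1) by (simp add: c'_def)
  ultimately show ?case by blast
qed

context prob_space
begin

text \<open>
  By the tube lemma \<open>F (l + n)\<close> is nearly constant for \<open>n\<close> in a small neighbourhood of a point \<open>b\<close>, uniformly in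
  \<open>l \<in> L\<close>. Finitely many of these neighbourhoods cover \<open>Z\<close>, and the weight of \<open>b\<close> is the measure of the set of
  points that are assigned to \<open>b\<close>. It matters later that nodes and weights serve all \<open>l\<close> at once.
\<close>

lemma quadrature:
  fixes F :: "'g::{topological_group_add, t2_space} \<Rightarrow> _"
  assumes F: "cont_bdd M F B" and \<nu>: "prob_space \<nu>" "sets \<nu> = sets borel"
    and Z: "compact Z" "AE n in \<nu>. n \<in> Z" and L: "compact L" and \<epsilon>: "0 < \<epsilon>"
  shows "\<exists>Q q. finite Q \<and> (\<forall>b\<in>Q. 0 \<le> q b) \<and> sum q Q = 1 \<and> (\<forall>l\<in>L. \<forall>h\<in>sq_int M.
    cmod ((\<integral>n. ip M (F (l + n)) h \<partial>\<nu>) - (\<Sum>b\<in>Q. of_real (q b) * ip M (F (l + b)) h)) \<le> \<epsilon> * nrm M h)"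
proof -
  interpret \<nu>: prob_space \<nu> by fact
  have [simp]: "space \<nu> = UNIV" using sets_eq_imp_space_eq[OF \<nu>(2)] by simp
  have pU: "\<nu>.prob UNIV = 1" using \<nu>.prob_space by simp
  note s = cont_bdd_sq_int[OF F]
  have "\<forall>b\<in>Z. \<exists>W. open W \<and> b \<in> W \<and> (\<forall>l\<in>L. \<forall>n\<in>W. nrm M (\<lambda>x. F (l + n) x - F (l + b) x) < \<epsilon>)"
  proof (intro ballI compact_tube[OF L])
    fix b l
    have "\<forall>\<^sub>F m in nhds (l + b). nrm M (\<lambda>x. F m x - F (l + b) x) < \<epsilon> / 2"
      by (rule order_tendstoD(2)[OF cont_bdd_cont[OF F]]) (use \<epsilon> in simp)
    then obtain U where U: "open U" "l + b \<in> U" "\<And>m. m \<in> U \<Longrightarrow> nrm M (\<lambda>x. F m x - F (l + b) x) < \<epsilon> / 2"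
      unfolding eventually_nhds by blast
    from open_add_split[OF U(1,2)] obtain A W where AW: "open A" "l \<in> A" "open W" "b \<in> W"
      "\<And>a n. a \<in> A \<Longrightarrow> n \<in> W \<Longrightarrow> a + n \<in> U" by blast
    have "nrm M (\<lambda>x. F (a + n) x - F (a + b) x) < \<epsilon>" if "a \<in> A" "n \<in> W" for a n
    proof -
      have "nrm M (\<lambda>x. F (a + n) x - F (a + b) x) \<le>
          nrm M (\<lambda>x. F (a + n) x - F (l + b) x) + nrm M (\<lambda>x. F (l + b) x - F (a + b) x)"
        by (rule nrm_triangle_diff[OF s s s])
      also have "nrm M (\<lambda>x. F (l + b) x - F (a + b) x) = nrm M (\<lambda>x. F (a + b) x - F (l + b) x)"
        by (rule nrm_minus_commute)
      finally show ?thesis using U(3)[OF AW(5)[OF that]] U(3)[OF AW(5)[OF that(1) AW(4)]] by linarith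
    qed
    with AW show "\<exists>A W. open A \<and> l \<in> A \<and> open W \<and> b \<in> W \<and>
        (\<forall>l\<in>A. \<forall>n\<in>W. nrm M (\<lambda>x. F (l + n) x - F (l + b) x) < \<epsilon>)"
      by (intro exI[of _ A] exI[of _ W] conjI ballI)
  qed
  from bchoice[OF this] obtain W where W0: "\<forall>b\<in>Z. open (W b) \<and> b \<in> W b \<and>
      (\<forall>l\<in>L. \<forall>n\<in>W b. nrm M (\<lambda>x. F (l + n) x - F (l + b) x) < \<epsilon>)" by (elim exE)
  obtain Q where Q: "Q \<subseteq> Z" "finite Q" "Z \<subseteq> (\<Union>b\<in>Q. W b)"
  proof (rule compactE_image[OF Z(1), of Z W])
    show "open (W b)" if "b \<in> Z" for b using W0 that by simp
    show "Z \<subseteq> (\<Union>b\<in>Z. W b)"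
    proof
      fix b assume "b \<in> Z"
      with bspec[OF W0 this] show "b \<in> (\<Union>b\<in>Z. W b)" by (intro UN_I[of b]) simp_all
    qed
  qed
  have "Q \<noteq> {}"
  proof
    assume "Q = {}"
    then have "AE n in \<nu>. False" using Q(3) Z(2) by simp
    then show False by simp
  qed
  moreover have "open (W b)" if "b \<in> Q" for b using bspec[OF W0, of b] Q(1) that by blast
  ultimately have "\<exists>c. (\<forall>n. c n \<in> Q) \<and> (\<forall>b. {n. c n = b} \<in> sets borel) \<and> (\<forall>n\<in>(\<Union>b\<in>Q. W b). n \<in> W (c n))"
    by (intro open_selector[OF Q(2)])
  then obtain c where c0: "\<forall>n. c n \<in> Q" "\<forall>b. {n. c n = b} \<in> sets borel" "\<forall>n\<in>(\<Union>b\<in>Q. W b). n \<in> W (c n)"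
    by (elim exE conjE)
  note c = spec[OF c0(1)] spec[OF c0(2)] bspec[OF c0(3)]
  define q where "q b = measure \<nu> {n. c n = b}" for b
  have cs: "{n. c n = b} \<in> sets \<nu>" for b using c(2) \<nu>(2) by simp
  have expand: "\<phi> (c n) = (\<Sum>b\<in>Q. indicator {n. c n = b} n *\<^sub>R \<phi> b)" for \<phi> :: "'g \<Rightarrow> complex" and n
  proof -
    have "(\<Sum>b\<in>Q. indicator {n. c n = b} n *\<^sub>R \<phi> b) = (\<Sum>b\<in>Q. if b = c n then \<phi> b else 0)"
      by (intro sum.cong) (auto simp: indicator_def)
    then show ?thesis using Q(2) c(1)[of n] by simp
  qed
  have ind: "integrable \<nu> (\<lambda>n. indicator {n. c n = b} n *\<^sub>R \<phi> b)" for \<phi> :: "'g \<Rightarrow> complex" and b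
    using cs[of b] by (intro integrable_scaleR_left impI integrable_real_indicator) (simp_all add: \<nu>.emeasure_eq_measure)
  have int: "integrable \<nu> (\<lambda>n. \<phi> (c n))" "(\<integral>n. \<phi> (c n) \<partial>\<nu>) = (\<Sum>b\<in>Q. of_real (q b) * \<phi> b)"
    for \<phi> :: "'g \<Rightarrow> complex"
  proof -
    show "integrable \<nu> (\<lambda>n. \<phi> (c n))" unfolding expand[of \<phi>] using ind by (intro Bochner_Integration.integrable_sum)
    have "(\<integral>n. \<phi> (c n) \<partial>\<nu>) = (\<Sum>b\<in>Q. \<integral>n. indicator {n. c n = b} n *\<^sub>R \<phi> b \<partial>\<nu>)"
      unfolding expand[of \<phi>] using ind by (intro Bochner_Integration.integral_sum)
    also have "\<dots> = (\<Sum>b\<in>Q. of_real (q b) * \<phi> b)"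
      using cs by (intro sum.cong refl) (simp add: q_def scaleR_conv_of_real)
    finally show "(\<integral>n. \<phi> (c n) \<partial>\<nu>) = (\<Sum>b\<in>Q. of_real (q b) * \<phi> b)" .
  qed
  have "of_real (sum q Q) = (1 :: complex)" using int(2)[of "\<lambda>_. 1"] by (simp add: pU)
  then have "sum q Q = 1" by (simp only: of_real_eq_1_iff)
  moreover have "cmod ((\<integral>n. ip M (F (l + n)) h \<partial>\<nu>) - (\<Sum>b\<in>Q. of_real (q b) * ip M (F (l + b)) h)) \<le> \<epsilon> * nrm M h"
    if l: "l \<in> L" and h: "h \<in> sq_int M" for l h
  proof -
    let ?f = "\<lambda>n. ip M (F (l + n)) h"
    have m: "?f \<in> borel_measurable \<nu>"
      by (rule cont_bdd_ip_measurable[OF cont_bdd_translate_left[OF F] h \<nu>(2)])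
    have i1: "integrable \<nu> ?f"
      by (rule \<nu>.integrable_const_bound[where B="B * nrm M h"]) (use m cont_bdd_ip_bound[OF F h] in simp_all)
    have "(\<integral>n. ?f n \<partial>\<nu>) - (\<Sum>b\<in>Q. of_real (q b) * ?f b) = (\<integral>n. ?f n - ?f (c n) \<partial>\<nu>)"
      using i1 int[of ?f] by simp
    also have "cmod \<dots> \<le> (\<integral>n. cmod (?f n - ?f (c n)) \<partial>\<nu>)" by (rule integral_norm_bound)
    also have "\<dots> \<le> (\<integral>n. \<epsilon> * nrm M h \<partial>\<nu>)"
    proof (rule integral_mono_AE)
      show "AE n in \<nu>. cmod (?f n - ?f (c n)) \<le> \<epsilon> * nrm M h"
        using Z(2)
      proof eventually_elim
        case (elim n)
        then have n: "n \<in> W (c n)" using Q(3) c(3) by blast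
        have cn: "c n \<in> Z" using c(1)[of n] Q(1) by blast
        have "nrm M (\<lambda>x. F (l + n) x - F (l + c n) x) < \<epsilon>" using bspec[OF W0 cn] n l by simp
        then have "nrm M (\<lambda>x. F (l + n) x - F (l + c n) x) * nrm M h \<le> \<epsilon> * nrm M h"
          by (intro mult_right_mono) simp_all
        then show ?case
          using cauchy_schwarz[OF sq_int_diff[OF s s] h, of "l + n" "l + c n"] ip_diff_left[OF s s h, of "l + n" "l + c n"]
          by simp
      qed
    qed (use i1 int(1)[of ?f] in simp_all)
    also have "\<dots> = \<epsilon> * nrm M h" by (simp add: pU)
    finally show ?thesis .
  qed
  moreover have "0 \<le> q b" for b by (simp add: q_def)
  ultimately show ?thesis using Q(2) by (intro exI[of _ Q] exI[of _ q] conjI ballI)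
qed

lemma averaging_integrable:
  fixes F :: "'g::{topological_group_add, t2_space} \<Rightarrow> _"
  assumes F: "cont_bdd M F B" and \<nu>: "averaging \<nu> a Z" and h: "h \<in> sq_int M"
  shows "integrable \<nu> (\<lambda>n. ip M (F (a + n)) h)"
proof -
  interpret \<nu>: prob_space \<nu> using \<nu> by (simp add: averaging_def)
  have "sets \<nu> = sets borel" using \<nu> by (simp add: averaging_def)
  then have m: "(\<lambda>n. ip M (F (a + n)) h) \<in> borel_measurable \<nu>"
    by (rule cont_bdd_ip_measurable[OF cont_bdd_translate_left[OF F] h])
  show ?thesis
    by (rule \<nu>.integrable_const_bound[where B="B * nrm M h"]) (use m cont_bdd_ip_bound[OF F h] in simp_all)
qed

text \<open>Averages exist because the finite sums given by quadrature form a Cauchy sequence.\<close>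

lemma mean_exists:
  fixes F :: "'g::{topological_group_add, t2_space} \<Rightarrow> _"
  assumes F: "cont_bdd M F B" and av: "averaging \<nu> a Z"
  shows "\<exists>v. is_mean M \<nu> a F v"
proof -
  have \<nu>: "prob_space \<nu>" "sets \<nu> = sets borel" "compact Z" "AE n in \<nu>. a + n \<in> Z"
    using av by (simp_all add: averaging_def)
  have "compact ((+) (- a) ` Z)" by (rule compact_translate[OF \<nu>(3)])
  moreover have "AE n in \<nu>. n \<in> (+) (- a) ` Z"
    using \<nu>(4)
  proof eventually_elim
    case (elim n)
    then have "- a + (a + n) \<in> (+) (- a) ` Z" by (rule imageI)
    then show ?case by (simp add: add.assoc[symmetric])
  qed
  ultimately have "\<forall>k::nat. \<exists>Q q. finite Q \<and> (\<forall>b\<in>Q. 0 \<le> q b) \<and> sum q Q = 1 \<and> (\<forall>l\<in>{a}. \<forall>h\<in>sq_int M.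
    cmod ((\<integral>n. ip M (F (l + n)) h \<partial>\<nu>) - (\<Sum>b\<in>Q. of_real (q b) * ip M (F (l + b)) h)) \<le> inverse (Suc k) * nrm M h)"
    by (intro allI quadrature[OF F \<nu>(1,2)]) simp_all
  from choice[OF this] obtain Q where "\<forall>k::nat. \<exists>q. finite (Q k) \<and> (\<forall>b\<in>Q k. 0 \<le> q b) \<and> sum q (Q k) = 1 \<and> (\<forall>l\<in>{a}. \<forall>h\<in>sq_int M.
    cmod ((\<integral>n. ip M (F (l + n)) h \<partial>\<nu>) - (\<Sum>b\<in>Q k. of_real (q b) * ip M (F (l + b)) h)) \<le> inverse (Suc k) * nrm M h)"
    by (elim exE)
  from choice[OF this] obtain q where q: "\<forall>k::nat. finite (Q k) \<and> (\<forall>b\<in>Q k. 0 \<le> q k b) \<and> sum (q k) (Q k) = 1 \<and> (\<forall>l\<in>{a}. \<forall>h\<in>sq_int M.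
    cmod ((\<integral>n. ip M (F (l + n)) h \<partial>\<nu>) - (\<Sum>b\<in>Q k. of_real (q k b) * ip M (F (l + b)) h)) \<le> inverse (Suc k) * nrm M h)"
    by (elim exE)
  define X where "X k = (\<lambda>x. \<Sum>b\<in>Q k. of_real (q k b) * F (a + b) x)" for k
  have X: "X k \<in> sq_int M" for k unfolding X_def by (intro sq_int_sum cont_bdd_sq_int[OF F])
  have approx: "cmod ((\<integral>n. ip M (F (a + n)) h \<partial>\<nu>) - ip M (X k) h) \<le> inverse (Suc k) * nrm M h"
    if h: "h \<in> sq_int M" for k h
  proof -
    have "ip M (X k) h = (\<Sum>b\<in>Q k. of_real (q k b) * ip M (F (a + b)) h)"
      unfolding X_def by (intro ip_sum_left h cont_bdd_sq_int[OF F])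
    then show ?thesis using spec[OF q, of k] h by simp
  qed
  have close: "nrm M (\<lambda>x. X i x - X k x) \<le> inverse (Suc i) + inverse (Suc k)" for i k
  proof -
    have s: "(\<lambda>x. X i x - X k x) \<in> sq_int M" by (rule sq_int_diff[OF X X])
    have weak: "cmod (ip M (\<lambda>x. X i x - X k x) h) \<le> (inverse (Suc i) + inverse (Suc k)) * nrm M h"
      if h: "h \<in> sq_int M" for h
    proof -
      let ?I = "\<integral>n. ip M (F (a + n)) h \<partial>\<nu>"
      have eq: "ip M (\<lambda>x. X i x - X k x) h = (?I - ip M (X k) h) - (?I - ip M (X i) h)"
        using ip_diff_left[OF X X h] by simp
      have "cmod (ip M (\<lambda>x. X i x - X k x) h) \<le> cmod (?I - ip M (X k) h) + cmod (?I - ip M (X i) h)"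
        unfolding eq by (rule norm_triangle_ineq4)
      then show ?thesis using approx[OF h, of i] approx[OF h, of k] by (simp add: distrib_right)
    qed
    show ?thesis by (rule nrm_le_if_ip_le[OF s _ weak]) simp_all
  qed
  have lim0: "(\<lambda>k. inverse (real (Suc k))) \<longlonglongrightarrow> 0" by (rule LIMSEQ_inverse_real_of_nat)
  have "\<exists>N. \<forall>i\<ge>N. \<forall>k\<ge>N. nrm M (\<lambda>x. X i x - X k x) < e" if e: "e > 0" for e
  proof -
    have "\<forall>\<^sub>F k in sequentially. inverse (real (Suc k)) < e / 2"
      by (rule order_tendstoD(2)[OF lim0]) (use e in simp)
    then obtain N where N: "\<And>k. k \<ge> N \<Longrightarrow> inverse (real (Suc k)) < e / 2"
      unfolding eventually_sequentially by blast
    have "nrm M (\<lambda>x. X i x - X k x) < e" if "i \<ge> N" "k \<ge> N" for i k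
      using close[of i k] N[OF that(1)] N[OF that(2)] by linarith
    then show ?thesis by blast
  qed
  from L2_complete[OF X this] obtain v where v: "v \<in> sq_int M"
    and lim: "(\<lambda>k. nrm M (\<lambda>x. X k x - v x)) \<longlonglongrightarrow> 0" by blast
  have "ip M v h = (\<integral>n. ip M (F (a + n)) h \<partial>\<nu>)" if h: "h \<in> sq_int M" for h
  proof (rule LIMSEQ_unique)
    have "(\<lambda>k. cmod (ip M (X k) h - ip M v h)) \<longlonglongrightarrow> 0"
    proof (rule tendsto_0_le)
      show "(\<lambda>k. nrm M (\<lambda>x. X k x - v x) * nrm M h) \<longlonglongrightarrow> 0"
        by (rule tendsto_mult_left_zero[OF lim])
      show "cmod (ip M (X k) h - ip M v h) \<le> nrm M (\<lambda>x. X k x - v x) * nrm M h" for k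
        using cauchy_schwarz[OF sq_int_diff[OF X v] h, of k] ip_diff_left[OF X v h, of k] by simp
    qed simp
    then show "(\<lambda>k. ip M (X k) h) \<longlonglongrightarrow> ip M v h" by (simp add: tendsto_norm_zero_iff LIM_zero_iff)
    have "(\<lambda>k. cmod (ip M (X k) h - (\<integral>n. ip M (F (a + n)) h \<partial>\<nu>))) \<longlonglongrightarrow> 0"
    proof (rule tendsto_0_le)
      show "(\<lambda>k. inverse (real (Suc k)) * nrm M h) \<longlonglongrightarrow> 0"
        by (rule tendsto_mult_left_zero[OF lim0])
      show "cmod (ip M (X k) h - (\<integral>n. ip M (F (a + n)) h \<partial>\<nu>)) \<le> inverse (real (Suc k)) * nrm M h" for k
        using approx[OF h, of k] by (simp add: norm_minus_commute)
    qed simp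
    then show "(\<lambda>k. ip M (X k) h) \<longlonglongrightarrow> (\<integral>n. ip M (F (a + n)) h \<partial>\<nu>)"
      by (simp add: tendsto_norm_zero_iff LIM_zero_iff)
  qed
  with v have "is_mean M \<nu> a F v" by (simp add: is_mean_def)
  then show ?thesis by blast
qed

lemma is_mean_unique:
  assumes "is_mean M \<nu> a F v" "is_mean M \<nu> a F w"
  shows "AE x in M. v x = w x"
  using is_meanD[OF assms(1)] is_meanD[OF assms(2)] by (intro ip_eq_imp_AE) simp_all

lemma is_mean_cong:
  assumes "is_mean M \<nu> a F v" "\<And>n. AE x in M. F n x = F' n x"
    "\<And>n. F n \<in> borel_measurable M" "\<And>n. F' n \<in> borel_measurable M"
  shows "is_mean M \<nu> a F' v"
proof -
  have "ip M (F n) h = ip M (F' n) h" if "h \<in> sq_int M" for n h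
    using assms(2-4) that by (intro ip_cong_AE) simp_all
  then show ?thesis using assms(1) by (simp add: is_mean_def)
qed

lemma is_mean_sum:
  fixes F :: "'i \<Rightarrow> 'g::{topological_group_add, t2_space} \<Rightarrow> _"
  assumes av: "averaging \<nu> a Z" and F: "\<And>t. t \<in> T \<Longrightarrow> cont_bdd M (F t) (B t)"
    and v: "\<And>t. t \<in> T \<Longrightarrow> is_mean M \<nu> a (F t) (v t)"
  shows "is_mean M \<nu> a (\<lambda>n x. \<Sum>t\<in>T. c t * F t n x) (\<lambda>x. \<Sum>t\<in>T. c t * v t x)"
  unfolding is_mean_def
proof (intro conjI ballI)
  have vs: "v t \<in> sq_int M" if "t \<in> T" for t by (rule is_meanD(1)[OF v[OF that]])
  then show "(\<lambda>x. \<Sum>t\<in>T. c t * v t x) \<in> sq_int M" by (rule sq_int_sum)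
  fix h assume h: "h \<in> sq_int M"
  have "ip M (\<lambda>x. \<Sum>t\<in>T. c t * v t x) h = (\<Sum>t\<in>T. c t * ip M (v t) h)"
    using vs by (rule ip_sum_left[OF h])
  also have "\<dots> = (\<Sum>t\<in>T. c t * (\<integral>n. ip M (F t (a + n)) h \<partial>\<nu>))"
    by (intro sum.cong refl arg_cong2[of _ _ _ _ "(*)"] is_meanD(2)[OF v h])
  also have "\<dots> = (\<integral>n. (\<Sum>t\<in>T. c t * ip M (F t (a + n)) h) \<partial>\<nu>)"
    using averaging_integrable[OF F av h] by (simp add: Bochner_Integration.integral_sum)
  also have "(\<lambda>n. \<Sum>t\<in>T. c t * ip M (F t (a + n)) h) = (\<lambda>n. ip M (\<lambda>x. \<Sum>t\<in>T. c t * F t (a + n) x) h)"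
    by (intro ext ip_sum_left[symmetric] h cont_bdd_sq_int[OF F])
  finally show "ip M (\<lambda>x. \<Sum>t\<in>T. c t * v t x) h = (\<integral>n. ip M (\<lambda>x. \<Sum>t\<in>T. c t * F t (a + n) x) h \<partial>\<nu>)" .
qed

lemma is_mean_add:
  fixes F :: "'g::{topological_group_add, t2_space} \<Rightarrow> _"
  assumes av: "averaging \<nu> a Z" and F: "cont_bdd M F B" "cont_bdd M F' B'"
    and v: "is_mean M \<nu> a F v" "is_mean M \<nu> a F' v'"
  shows "is_mean M \<nu> a (\<lambda>n x. F n x + F' n x) (\<lambda>x. v x + v' x)"
  unfolding is_mean_def
proof (intro conjI ballI)
  note s = is_meanD(1)[OF v(1)] is_meanD(1)[OF v(2)]
  show "(\<lambda>x. v x + v' x) \<in> sq_int M" by (rule sq_int_add[OF s])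
  fix h assume h: "h \<in> sq_int M"
  have "ip M (\<lambda>x. v x + v' x) h = (\<integral>n. ip M (F (a + n)) h \<partial>\<nu>) + (\<integral>n. ip M (F' (a + n)) h \<partial>\<nu>)"
    unfolding ip_add_left[OF s h] is_meanD(2)[OF v(1) h] is_meanD(2)[OF v(2) h] ..
  also have "\<dots> = (\<integral>n. ip M (F (a + n)) h + ip M (F' (a + n)) h \<partial>\<nu>)"
    by (rule Bochner_Integration.integral_add[symmetric]; rule averaging_integrable[OF _ av h], rule F)
  also have "\<dots> = (\<integral>n. ip M (\<lambda>x. F (a + n) x + F' (a + n) x) h \<partial>\<nu>)"
    by (simp only: ip_add_left[OF cont_bdd_sq_int[OF F(1)] cont_bdd_sq_int[OF F(2)] h])
  finally show "ip M (\<lambda>x. v x + v' x) h = (\<integral>n. ip M (\<lambda>x. F (a + n) x + F' (a + n) x) h \<partial>\<nu>)" .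
qed

lemma is_mean_diff_le:
  fixes F :: "'g::{topological_group_add, t2_space} \<Rightarrow> _"
  assumes av: "averaging \<nu> a Z" and F: "cont_bdd M F B" "cont_bdd M F' B'"
    and v: "is_mean M \<nu> a F v" "is_mean M \<nu> a F' v'"
    and le: "\<And>n. n \<in> Z \<Longrightarrow> nrm M (\<lambda>x. F n x - F' n x) \<le> \<delta>" and \<delta>: "0 \<le> \<delta>"
  shows "nrm M (\<lambda>x. v x - v' x) \<le> \<delta>"
proof -
  interpret \<nu>: prob_space \<nu> using av by (simp add: averaging_def)
  note s = is_meanD(1)[OF v(1)] is_meanD(1)[OF v(2)]
  note t = cont_bdd_sq_int[OF F(1)] cont_bdd_sq_int[OF F(2)]
  have weak: "cmod (ip M (\<lambda>x. v x - v' x) h) \<le> \<delta> * nrm M h" if h: "h \<in> sq_int M" for h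
  proof -
    note i = averaging_integrable[OF F(1) av h] averaging_integrable[OF F(2) av h]
    have "ip M (\<lambda>x. v x - v' x) h = (\<integral>n. ip M (F (a + n)) h - ip M (F' (a + n)) h \<partial>\<nu>)"
      unfolding ip_diff_left[OF s h] is_meanD(2)[OF v(1) h] is_meanD(2)[OF v(2) h]
      by (rule Bochner_Integration.integral_diff[OF i, symmetric])
    also have "cmod \<dots> \<le> (\<integral>n. cmod (ip M (F (a + n)) h - ip M (F' (a + n)) h) \<partial>\<nu>)"
      by (rule integral_norm_bound)
    also have "\<dots> \<le> (\<integral>n. \<delta> * nrm M h \<partial>\<nu>)"
    proof (rule integral_mono_AE)
      have "AE n in \<nu>. a + n \<in> Z" using av by (simp add: averaging_def)
      then show "AE n in \<nu>. cmod (ip M (F (a + n)) h - ip M (F' (a + n)) h) \<le> \<delta> * nrm M h"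
      proof eventually_elim
        case (elim n)
        show ?case
          using cauchy_schwarz[OF sq_int_diff[OF t] h, of "a + n" "a + n"] ip_diff_left[OF t h, of "a + n" "a + n"]
            mult_right_mono[OF le[OF elim] nrm_nonneg[of M h]] by simp
      qed
    qed (use i in simp_all)
    finally show ?thesis by (simp add: \<nu>.prob_space)
  qed
  show ?thesis by (rule nrm_le_if_ip_le[OF sq_int_diff[OF s] \<delta> weak])
qed

lemma is_mean_nrm_le:
  fixes F :: "'g::{topological_group_add, t2_space} \<Rightarrow> _"
  assumes av: "averaging \<nu> a Z" and F: "cont_bdd M F B" and v: "is_mean M \<nu> a F v"
  shows "nrm M v \<le> B"
proof -
  have "is_mean M \<nu> a (\<lambda>n x. 0) (\<lambda>x. 0)" by (simp add: is_mean_def sq_int_zero ip_zero_left)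
  from is_mean_diff_le[OF av F cont_bdd_const[OF sq_int_zero] v this, of 0 B] cont_bdd_nrm[OF F] cont_bdd_nonneg[OF F]
  show ?thesis by simp
qed

lemma is_mean_bdd:
  fixes F :: "'g::{topological_group_add, t2_space} \<Rightarrow> _"
  assumes av: "averaging \<nu> a Z" and F: "cont_bdd M F B" "\<And>n. F n \<in> bdd M C" and v: "is_mean M \<nu> a F v"
  shows "v \<in> bdd M C"
proof (rule bdd_if_ip_le[OF is_meanD(1)[OF v] bdd_nonneg[OF F(2)]])
  interpret \<nu>: prob_space \<nu> using av by (simp add: averaging_def)
  fix h assume hb: "h \<in> bdd M 1"
  have h: "h \<in> sq_int M" by (rule bdd_sq_int(1)[OF hb])
  have ih: "integrable M (\<lambda>x. cmod (h x))" using sq_int_prod(2)[OF h one_sq_int] by simp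
  have le: "cmod (ip M (F n) h) \<le> C * (\<integral>x. cmod (h x) \<partial>M)" for n
  proof -
    have "cmod (ip M (F n) h) \<le> (\<integral>x. cmod (F n x * cnj (h x)) \<partial>M)"
      unfolding ip_def by (rule integral_norm_bound)
    also have "\<dots> \<le> (\<integral>x. C * cmod (h x) \<partial>M)"
    proof (rule integral_mono_AE)
      show "AE x in M. cmod (F n x * cnj (h x)) \<le> C * cmod (h x)"
        using bdd_AE[OF F(2)[of n]] by eventually_elim (simp add: norm_mult mult_right_mono)
      show "integrable M (\<lambda>x. cmod (F n x * cnj (h x)))"
        using sq_int_ip[OF cont_bdd_sq_int[OF F(1)] h, of n] by (rule integrable_norm)
    qed (use ih in simp)
    finally show ?thesis by simp
  qed
  have "cmod (ip M v h) \<le> (\<integral>n. cmod (ip M (F (a + n)) h) \<partial>\<nu>)"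
    unfolding is_meanD(2)[OF v h] by (rule integral_norm_bound)
  also have "\<dots> \<le> (\<integral>n. C * (\<integral>x. cmod (h x) \<partial>M) \<partial>\<nu>)"
    using averaging_integrable[OF F(1) av h] le by (intro integral_mono integrable_norm) simp_all
  also have "\<dots> = C * (\<integral>x. cmod (h x) \<partial>M)" by (simp add: \<nu>.prob_space)
  finally show "cmod (ip M v h) \<le> C * (\<integral>x. cmod (h x) \<partial>M)" .
qed

end

section \<open>Reduction of systems of polynomial maps\<close>

context polynomial_system
begin

lemma strongly_continuousD: "strongly_continuous g \<Longrightarrow> g n \<in> G"
  "strongly_continuous g \<Longrightarrow> u \<in> sq_int M \<Longrightarrow>
    ((\<lambda>n. nrm M (\<lambda>x. act M (g n) u x - act M (g n0) u x)) \<longlongrightarrow> 0) (nhds n0)"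
  by (simp_all add: strongly_continuous_def)

lemma cont_bdd_act:
  assumes g: "strongly_continuous g" and F: "cont_bdd M F B"
  shows "cont_bdd M (\<lambda>n. act M (g n) (F n)) B"
proof (rule cont_bddI)
  note G = strongly_continuousD(1)[OF g] and s = cont_bdd_sq_int[OF F]
  show "act M (g n) (F n) \<in> sq_int M" for n by (rule act_sq_int[OF G s])
  show "nrm M (act M (g n) (F n)) \<le> B" for n using act_nrm[OF G s] cont_bdd_nrm[OF F] by simp
  fix n0
  show "((\<lambda>n. nrm M (\<lambda>x. act M (g n) (F n) x - act M (g n0) (F n0) x)) \<longlongrightarrow> 0) (nhds n0)"
  proof (rule tendsto_0_le)
    show "((\<lambda>n. nrm M (\<lambda>x. F n x - F n0 x) + nrm M (\<lambda>x. act M (g n) (F n0) x - act M (g n0) (F n0) x)) \<longlongrightarrow> 0) (nhds n0)"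
      using tendsto_add[OF cont_bdd_cont[OF F] strongly_continuousD(2)[OF g s]] by simp
    show "nrm M (\<lambda>x. act M (g n) (F n) x - act M (g n0) (F n0) x) \<le>
      nrm M (\<lambda>x. F n x - F n0 x) + nrm M (\<lambda>x. act M (g n) (F n0) x - act M (g n0) (F n0) x)" for n
      using nrm_triangle_diff[where f="act M (g n) (F n)" and g="act M (g n) (F n0)" and h="act M (g n0) (F n0)" and M=M]
        act_nrm_diff[OF G[of n] s[of n] s[of n0]] by (simp add: act_sq_int[OF G s])
  qed simp
qed

lemma strongly_continuousI:
  assumes "\<And>n. g n \<in> G" "\<And>u. u \<in> sq_int M \<Longrightarrow> cont_bdd M (\<lambda>n. act M (g n) u) (nrm M u)"
  shows "strongly_continuous g"
  using assms cont_bdd_cont unfolding strongly_continuous_def by blast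

lemma strongly_continuous_cont_bdd: "strongly_continuous g \<Longrightarrow> u \<in> sq_int M \<Longrightarrow> cont_bdd M (\<lambda>n. act M (g n) u) (nrm M u)"
  by (rule cont_bdd_act[OF _ cont_bdd_const]) simp_all

lemma strongly_continuous_mult:
  assumes g: "strongly_continuous g" and h: "strongly_continuous h"
  shows "strongly_continuous (\<lambda>n. g n \<otimes>\<^bsub>H\<^esub> h n)"
proof (rule strongly_continuousI)
  note G = strongly_continuousD(1)[OF g] strongly_continuousD(1)[OF h]
  show "g n \<otimes>\<^bsub>H\<^esub> h n \<in> G" for n using G by simp
  fix u assume u: "u \<in> sq_int M"
  show "cont_bdd M (\<lambda>n. act M (g n \<otimes>\<^bsub>H\<^esub> h n) u) (nrm M u)"
    unfolding act_mult_op[OF G u] by (rule cont_bdd_act[OF g strongly_continuous_cont_bdd[OF h u]])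
qed

lemma strongly_continuous_inv:
  assumes g: "strongly_continuous g"
  shows "strongly_continuous (\<lambda>n. inv\<^bsub>H\<^esub> (g n))"
  unfolding strongly_continuous_def
proof (intro conjI allI ballI)
  note G = strongly_continuousD(1)[OF g]
  show G': "inv\<^bsub>H\<^esub> (g n) \<in> G" for n using G by simp
  fix u n0 assume u: "u \<in> sq_int M"
  define w where "w = act M (inv\<^bsub>H\<^esub> (g n0)) u"
  have w: "w \<in> sq_int M" unfolding w_def by (rule act_sq_int[OF G' u])
  have "nrm M (\<lambda>x. act M (inv\<^bsub>H\<^esub> (g n)) u x - w x) = nrm M (\<lambda>x. act M (g n) w x - act M (g n0) w x)" for n
  proof -
    have "nrm M (\<lambda>x. act M (inv\<^bsub>H\<^esub> (g n)) u x - w x) =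
        nrm M (\<lambda>x. act M (g n) (act M (inv\<^bsub>H\<^esub> (g n)) u) x - act M (g n) w x)"
      by (rule act_nrm_diff[OF G act_sq_int[OF G' u] w, symmetric])
    also have "\<dots> = nrm M (\<lambda>x. act M (g n0) w x - act M (g n) w x)"
    proof (rule nrm_cong_AE)
      show "AE x in M. act M (g n) (act M (inv\<^bsub>H\<^esub> (g n)) u) x - act M (g n) w x = act M (g n0) w x - act M (g n) w x"
        using act_inv(1)[OF G[of n] u] act_inv(1)[OF G[of n0] u] unfolding w_def by eventually_elim simp
    qed (intro sq_intD sq_int_diff act_sq_int G G' u w)+
    finally show ?thesis by (rule trans[OF _ nrm_minus_commute])
  qed
  then show "((\<lambda>n. nrm M (\<lambda>x. act M (inv\<^bsub>H\<^esub> (g n)) u x - act M (inv\<^bsub>H\<^esub> (g n0)) u x)) \<longlongrightarrow> 0) (nhds n0)"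
    unfolding w_def[symmetric] using strongly_continuousD(2)[OF g w] by simp
qed

lemma strongly_continuous_one: "strongly_continuous (\<lambda>n. \<one>\<^bsub>H\<^esub>)"
  unfolding strongly_continuous_def by simp

lemma strongly_continuous_translate:
  assumes "strongly_continuous g"
  shows "strongly_continuous (\<lambda>n. g (a + n + b))"
proof (rule strongly_continuousI)
  show "g (a + n + b) \<in> G" for n by (rule strongly_continuousD(1)[OF assms])
  show "cont_bdd M (\<lambda>n. act M (g (a + n + b)) u) (nrm M u)" if "u \<in> sq_int M" for u
    by (rule cont_bdd_translate[OF strongly_continuous_cont_bdd[OF assms that]])
qed

text \<open>
  Reductions use only products, inverses and derivatives, and therefore stay within the continuous
  polynomial maps.
\<close>

definition cpm :: "nat \<Rightarrow> ('g \<Rightarrow> 'x operator) set" where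
  "cpm t = {g \<in> pmap t. strongly_continuous g}"

abbreviation fone :: "'g \<Rightarrow> 'x operator" where
  "fone \<equiv> (\<lambda>n. \<one>\<^bsub>H\<^esub>)"

lemma cpm_G: "g \<in> cpm t \<Longrightarrow> g n \<in> G"
  unfolding cpm_def using pmap_G by blast

lemma cpm_mult: "g \<in> cpm t \<Longrightarrow> h \<in> cpm t \<Longrightarrow> (\<lambda>n. g n \<otimes>\<^bsub>H\<^esub> h n) \<in> cpm t"
  by (simp add: cpm_def pmap_mult strongly_continuous_mult)

lemma cpm_inv: "g \<in> cpm t \<Longrightarrow> (\<lambda>n. inv\<^bsub>H\<^esub> (g n)) \<in> cpm t"
  by (simp add: cpm_def pmap_inv strongly_continuous_inv)

lemma cpm_one: "fone \<in> cpm t"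
  by (simp add: cpm_def pmap_one strongly_continuous_one)

lemma cpm_Suc: "cpm (Suc t) \<subseteq> cpm t"
  unfolding cpm_def using pmap_Suc by blast

lemma cpm_deriv:
  assumes "g \<in> cpm t"
  shows "deriv_map a b g \<in> cpm (Suc t)"
proof -
  have "strongly_continuous (\<lambda>n. inv\<^bsub>H\<^esub> (g n) \<otimes>\<^bsub>H\<^esub> g (a + n + b))"
    using assms unfolding cpm_def
    by (intro strongly_continuous_mult strongly_continuous_inv strongly_continuous_translate) simp_all
  then show ?thesis using pmap_deriv[of g t a b] assms by (simp add: cpm_def deriv_map_def[abs_def])
qed

text \<open>
  Averaging a function of the form \<open>n \<mapsto> g (a + n + b)\<^sup>-\<^sup>1 (\<dots>)\<close> over \<open>b\<close> and applying \<open>g n\<close> produces the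
  maps \<open>bracket g a b h\<close>.
\<close>

definition bracket :: "('g \<Rightarrow> 'x operator) \<Rightarrow> 'g \<Rightarrow> 'g \<Rightarrow> ('g \<Rightarrow> 'x operator) \<Rightarrow> 'g \<Rightarrow> 'x operator" where
  "bracket g a b h n = g n \<otimes>\<^bsub>H\<^esub> inv\<^bsub>H\<^esub> (g (a + n + b)) \<otimes>\<^bsub>H\<^esub> h (a + n + b)"

text \<open>A bracket differs from its last entry by a derivative, hence by a map of higher level.\<close>

lemma bracket_level:
  assumes "g \<in> cpm t" "h \<in> cpm t"
  shows "\<exists>d\<in>cpm (Suc t). bracket g a b h = (\<lambda>n. h n \<otimes>\<^bsub>H\<^esub> d n)"
proof
  show "deriv_map a b (\<lambda>n. inv\<^bsub>H\<^esub> (g n) \<otimes>\<^bsub>H\<^esub> h n) \<in> cpm (Suc t)"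
    by (intro cpm_deriv cpm_mult cpm_inv assms)
  have [simp]: "g n \<in> carrier H" "h n \<in> carrier H" for n
    by (rule G_closed(4)[OF cpm_G[OF assms(1)]] G_closed(4)[OF cpm_G[OF assms(2)]])+
  show "bracket g a b h = (\<lambda>n. h n \<otimes>\<^bsub>H\<^esub> deriv_map a b (\<lambda>n. inv\<^bsub>H\<^esub> (g n) \<otimes>\<^bsub>H\<^esub> h n) n)"
    by (rule ext) (simp add: bracket_def deriv_map_def H.m_assoc H.inv_mult_group cancel)
qed

text \<open>
  The number of reductions that make a system trivial, whatever the parameters: one reduction
  replaces the member \<open>g\<close> by the brackets of \<open>g\<close> with the other members. The parameter \<open>C\<close> is the
  set from which the members are taken.
\<close>

primrec cplx :: "('g \<Rightarrow> 'x operator) set \<Rightarrow> nat \<Rightarrow> ('g \<Rightarrow> 'x operator) set \<Rightarrow> bool" where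
  "cplx C 0 S \<longleftrightarrow> S \<subseteq> {fone}"
| "cplx C (Suc c) S \<longleftrightarrow> (\<exists>g S'. finite S' \<and> fone \<in> S' \<and> insert g S' \<subseteq> C \<and> S \<subseteq> insert g S' \<and>
    (\<forall>a b. cplx C c (S' \<union> bracket g a b ` S')))"

lemma cplx_subset:
  assumes "cplx C c S" "S0 \<subseteq> S"
  shows "cplx C c S0"
proof (cases c)
  case 0
  then show ?thesis using assms by auto
next
  case (Suc c')
  from assms(1) obtain g S' where "finite S' \<and> fone \<in> S' \<and> insert g S' \<subseteq> C \<and> S \<subseteq> insert g S' \<and>
    (\<forall>a b. cplx C c' (S' \<union> bracket g a b ` S'))" unfolding Suc cplx.simps by (elim exE)
  then have "finite S' \<and> fone \<in> S' \<and> insert g S' \<subseteq> C \<and> S0 \<subseteq> insert g S' \<and>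
    (\<forall>a b. cplx C c' (S' \<union> bracket g a b ` S'))" using order_trans[OF assms(2)] by simp
  then show ?thesis unfolding Suc cplx.simps by (intro exI)
qed

lemma cplx_mono:
  assumes "C \<subseteq> C'"
  shows "cplx C c S \<Longrightarrow> cplx C' c S"
proof (induction c arbitrary: S)
  case (Suc c)
  from Suc.prems obtain g S' where g: "finite S' \<and> fone \<in> S' \<and> insert g S' \<subseteq> C \<and> S \<subseteq> insert g S' \<and>
    (\<forall>a b. cplx C c (S' \<union> bracket g a b ` S'))" unfolding cplx.simps by (elim exE)
  then have "insert g S' \<subseteq> C'" using order_trans[OF _ assms] by blast
  then have "finite S' \<and> fone \<in> S' \<and> insert g S' \<subseteq> C' \<and> S \<subseteq> insert g S' \<and>
    (\<forall>a b. cplx C' c (S' \<union> bracket g a b ` S'))" using g Suc.IH by simp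
  then show ?case unfolding cplx.simps by (intro exI)
qed simp

definition cosets :: "nat \<Rightarrow> ('g \<Rightarrow> 'x operator) set \<Rightarrow> ('g \<Rightarrow> 'x operator) set" where
  "cosets t X = {(\<lambda>n. r n \<otimes>\<^bsub>H\<^esub> d n) | r d. r \<in> X \<and> d \<in> cpm (Suc t)}"

lemma cosetsI: "r \<in> X \<Longrightarrow> d \<in> cpm (Suc t) \<Longrightarrow> (\<lambda>n. r n \<otimes>\<^bsub>H\<^esub> d n) \<in> cosets t X"
  unfolding cosets_def by (rule CollectI, rule exI[of _ r], rule exI[of _ d]) simp

lemma cosetsE:
  assumes "k \<in> cosets t X"
  obtains r d where "r \<in> X" "d \<in> cpm (Suc t)" "k = (\<lambda>n. r n \<otimes>\<^bsub>H\<^esub> d n)"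
  using assms unfolding cosets_def by (elim CollectE exE conjE)

lemma cosets_sub_cpm: "X \<subseteq> cpm t \<Longrightarrow> cosets t X \<subseteq> cpm t"
  unfolding cosets_def using cpm_mult cpm_Suc by blast

lemma bracket_cosets:
  assumes g: "g \<in> cpm t" and X: "X \<subseteq> cpm t" and k: "k \<in> cosets t X"
  shows "bracket g a b k \<in> cosets t X"
proof -
  from k obtain r d where r: "r \<in> X" "d \<in> cpm (Suc t)" "k = (\<lambda>n. r n \<otimes>\<^bsub>H\<^esub> d n)"
    by (rule cosetsE)
  have kc: "k \<in> cpm t" using cosets_sub_cpm[OF X] k by blast
  from bracket_level[OF g kc] obtain d' where d': "d' \<in> cpm (Suc t)" "bracket g a b k = (\<lambda>n. k n \<otimes>\<^bsub>H\<^esub> d' n)" by blast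
  have rX: "r \<in> cpm t" using r(1) X by blast
  have "bracket g a b k = (\<lambda>n. k n \<otimes>\<^bsub>H\<^esub> d' n)" by (rule d'(2))
  also have "\<dots> = (\<lambda>n. r n \<otimes>\<^bsub>H\<^esub> (d n \<otimes>\<^bsub>H\<^esub> d' n))"
    unfolding r(3) by (rule ext) (simp add: H.m_assoc G_closed(4)[OF cpm_G[OF rX]] G_closed(4)[OF cpm_G[OF r(2)]] G_closed(4)[OF cpm_G[OF d'(1)]])
  also have "\<dots> \<in> cosets t X" by (rule cosetsI[OF r(1) cpm_mult[OF r(2) d'(1)]])
  finally show ?thesis .
qed

lemma cosets_one: "cpm (Suc t) = cosets t {fone}"
proof -
  have "(\<lambda>n. \<one>\<^bsub>H\<^esub> \<otimes>\<^bsub>H\<^esub> d n) = d" if "d \<in> cpm (Suc t)" for d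
    by (rule ext) (simp add: G_closed(4)[OF cpm_G[OF that]])
  note eq = this
  show ?thesis
  proof (intro equalityI subsetI)
    fix d assume d: "d \<in> cpm (Suc t)"
    have "(\<lambda>n. \<one>\<^bsub>H\<^esub> \<otimes>\<^bsub>H\<^esub> d n) \<in> cosets t {fone}" using cosetsI[of fone "{fone}" d t] d by simp
    then show "d \<in> cosets t {fone}" unfolding eq[OF d] .
  next
    fix k assume "k \<in> cosets t {fone}"
    then obtain r d where "r \<in> {fone}" "d \<in> cpm (Suc t)" "k = (\<lambda>n. r n \<otimes>\<^bsub>H\<^esub> d n)" by (rule cosetsE)
    then show "k \<in> cpm (Suc t)" using eq[of d] by simp
  qed
qed

text \<open>Within the coset of \<open>g\<close>, brackets are brackets of the next level, multiplied by \<open>g\<close>.\<close>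

lemma bracket_mult_left:
  assumes "g \<in> cpm t" "k \<in> cpm t" "k' \<in> cpm t"
  shows "bracket (\<lambda>n. g n \<otimes>\<^bsub>H\<^esub> k n) a b (\<lambda>n. g n \<otimes>\<^bsub>H\<^esub> k' n) = (\<lambda>n. g n \<otimes>\<^bsub>H\<^esub> bracket k a b k' n)"
proof -
  have [simp]: "g n \<in> carrier H" "k n \<in> carrier H" "k' n \<in> carrier H" for n
    by (rule G_closed(4)[OF cpm_G[OF assms(1)]] G_closed(4)[OF cpm_G[OF assms(2)]] G_closed(4)[OF cpm_G[OF assms(3)]])+
  show ?thesis by (rule ext) (simp add: bracket_def H.m_assoc H.inv_mult_group cancel)
qed

definition bounded_cplx :: "nat \<Rightarrow> bool" where
  "bounded_cplx t \<longleftrightarrow> (\<forall>m. \<exists>c. \<forall>S. finite S \<longrightarrow> card S \<le> m \<longrightarrow> S \<subseteq> cpm t \<longrightarrow> cplx (cpm t) c S)"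

text \<open>
  The induction on the level \<open>t\<close> contains an induction on the number \<open>s\<close> of cosets of \<open>cpm (Suc t)\<close>,
  apart from \<open>cpm (Suc t)\<close> itself, that the system may meet.
\<close>

definition bounded_cplx_cosets :: "nat \<Rightarrow> nat \<Rightarrow> bool" where
  "bounded_cplx_cosets t s \<longleftrightarrow> (\<forall>m. \<exists>c. \<forall>S X. finite S \<longrightarrow> card S \<le> m \<longrightarrow> fone \<in> S \<longrightarrow> finite X \<longrightarrow> card X \<le> s \<longrightarrow>
    X \<subseteq> cpm t \<longrightarrow> S \<subseteq> cosets t (insert fone X) \<longrightarrow> cplx (cpm t) c S)"

text \<open>
  Members outside the coset of \<open>g\<close> stay in their cosets, while within \<open>g K\<close> the reduction follows
  that of \<open>K\<close>. After as many steps as \<open>K\<close> needs, only \<open>g\<close> is left of \<open>g K\<close>, and one more step removes it.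
\<close>

lemma remove_coset:
  assumes IH: "bounded_cplx_cosets t s"
  shows "\<exists>c. \<forall>S X g K. finite S \<longrightarrow> card S \<le> m \<longrightarrow> fone \<in> S \<longrightarrow> finite X \<longrightarrow> card X \<le> s \<longrightarrow>
    X \<subseteq> cpm t \<longrightarrow> S \<subseteq> cosets t (insert fone X) \<longrightarrow> g \<in> cpm t \<longrightarrow> cplx (cpm (Suc t)) c' K \<longrightarrow>
    cplx (cpm t) c (S \<union> (\<lambda>k n. g n \<otimes>\<^bsub>H\<^esub> k n) ` K)"
proof -
  have reduce: "finite (S \<union> bracket g a b ` S)" "card (S \<union> bracket g a b ` S) \<le> 2 * m"
      "S \<union> bracket g a b ` S \<subseteq> cosets t (insert fone X)"
    if "finite S" "card S \<le> m" "X \<subseteq> cpm t" "S \<subseteq> cosets t (insert fone X)" "g \<in> cpm t"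
    for S X g a b m
  proof -
    show "finite (S \<union> bracket g a b ` S)" using that by simp
    have "card (S \<union> bracket g a b ` S) \<le> card S + card (bracket g a b ` S)" by (rule card_Un_le)
    also have "\<dots> \<le> card S + card S" using card_image_le[OF that(1)] by simp
    finally show "card (S \<union> bracket g a b ` S) \<le> 2 * m" using that(2) by simp
    have "insert fone X \<subseteq> cpm t" using that(3) cpm_one by blast
    then show "S \<union> bracket g a b ` S \<subseteq> cosets t (insert fone X)"
      using bracket_cosets[OF that(5)] that(4) by blast
  qed
  have sub: "S \<subseteq> cpm t" if "X \<subseteq> cpm t" "S \<subseteq> cosets t (insert fone X)" for S X
    using cosets_sub_cpm[of "insert fone X" t] cpm_one that by blast
  show ?thesis
  proof (induction c' arbitrary: m)
    case 0
    from spec[OF IH[unfolded bounded_cplx_cosets_def], of "2 * m"] obtain c where c0: "\<forall>S X. finite S \<longrightarrow> card S \<le> 2 * m \<longrightarrow> fone \<in> S \<longrightarrow> finite X \<longrightarrow> card X \<le> s \<longrightarrow>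
        X \<subseteq> cpm t \<longrightarrow> S \<subseteq> cosets t (insert fone X) \<longrightarrow> cplx (cpm t) c S"
      by (elim exE)
    note c = c0[rule_format]
    show ?case
    proof (intro exI[of _ "Suc c"] allI impI)
      fix S X g K
      assume S: "finite S" "card S \<le> m" "fone \<in> S" and X: "finite X" "card X \<le> s" "X \<subseteq> cpm t"
        and SX: "S \<subseteq> cosets t (insert fone X)" and g: "g \<in> cpm t" and K: "cplx (cpm (Suc t)) 0 K"
      have "(\<lambda>n. g n \<otimes>\<^bsub>H\<^esub> \<one>\<^bsub>H\<^esub>) = g" by (rule ext) (simp add: G_closed(4)[OF cpm_G[OF g]])
      then have "S \<union> (\<lambda>k n. g n \<otimes>\<^bsub>H\<^esub> k n) ` K \<subseteq> insert g S" using K by auto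
      moreover have "cplx (cpm t) c (S \<union> bracket g a b ` S)" for a b
        by (rule c[OF reduce(1,2)[OF S(1,2) X(3) SX g] _ X reduce(3)[OF S(1,2) X(3) SX g]]) (use S in simp)
      moreover have "insert g S \<subseteq> cpm t" using sub[OF X(3) SX] g by simp
      ultimately show "cplx (cpm t) (Suc c) (S \<union> (\<lambda>k n. g n \<otimes>\<^bsub>H\<^esub> k n) ` K)"
        unfolding cplx.simps using S by (intro exI[of _ g] exI[of _ S] conjI allI)
    qed
  next
    case (Suc c')
    from Suc.IH[of "2 * m"] obtain c where c0: "\<forall>S X g K. finite S \<longrightarrow> card S \<le> 2 * m \<longrightarrow> fone \<in> S \<longrightarrow> finite X \<longrightarrow> card X \<le> s \<longrightarrow>
        X \<subseteq> cpm t \<longrightarrow> S \<subseteq> cosets t (insert fone X) \<longrightarrow> g \<in> cpm t \<longrightarrow> cplx (cpm (Suc t)) c' K \<longrightarrow>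
        cplx (cpm t) c (S \<union> (\<lambda>k n. g n \<otimes>\<^bsub>H\<^esub> k n) ` K)"
      by (elim exE)
    note c = c0[rule_format]
    show ?case
    proof (intro exI[of _ "Suc c"] allI impI)
      fix S X g K
      assume S: "finite S" "card S \<le> m" "fone \<in> S" and X: "finite X" "card X \<le> s" "X \<subseteq> cpm t"
        and SX: "S \<subseteq> cosets t (insert fone X)" and g: "g \<in> cpm t" and K: "cplx (cpm (Suc t)) (Suc c') K"
      let ?g = "\<lambda>k n. g n \<otimes>\<^bsub>H\<^esub> k n"
      from K obtain k K' where k: "finite K' \<and> fone \<in> K' \<and> insert k K' \<subseteq> cpm (Suc t) \<and> K \<subseteq> insert k K' \<and>
          (\<forall>a b. cplx (cpm (Suc t)) c' (K' \<union> bracket k a b ` K'))" unfolding cplx.simps by (elim exE)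
      have kK: "insert k K' \<subseteq> cpm t" using k cpm_Suc by blast
      have gk: "?g k \<in> cpm t" "?g ` K' \<subseteq> cpm t" using kK cpm_mult[OF g] by blast+
      have "cplx (cpm t) c ((S \<union> ?g ` K') \<union> bracket (?g k) a b ` (S \<union> ?g ` K'))" for a b
      proof -
        have "bracket (?g k) a b ` ?g ` K' = ?g ` bracket k a b ` K'"
          unfolding image_image
        proof (intro image_cong refl)
          fix k' assume "k' \<in> K'"
          then show "bracket (?g k) a b (?g k') = ?g (bracket k a b k')"
            using kK by (intro bracket_mult_left[OF g]) blast+
        qed
        then have "(S \<union> ?g ` K') \<union> bracket (?g k) a b ` (S \<union> ?g ` K') =
            (S \<union> bracket (?g k) a b ` S) \<union> ?g ` (K' \<union> bracket k a b ` K')"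
          unfolding image_Un by blast
        moreover have "cplx (cpm t) c ((S \<union> bracket (?g k) a b ` S) \<union> ?g ` (K' \<union> bracket k a b ` K'))"
          using k by (intro c[OF reduce(1,2)[OF S(1,2) X(3) SX gk(1)] _ X reduce(3)[OF S(1,2) X(3) SX gk(1)] g])
            (use S in simp_all)
        ultimately show ?thesis by simp
      qed
      moreover have "insert (?g k) (S \<union> ?g ` K') \<subseteq> cpm t" using sub[OF X(3) SX] gk by simp
      moreover have "S \<union> ?g ` K \<subseteq> insert (?g k) (S \<union> ?g ` K')" using k by blast
      moreover have "finite (S \<union> ?g ` K')" "fone \<in> S \<union> ?g ` K'" using S k by simp_all
      ultimately show "cplx (cpm t) (Suc c) (S \<union> ?g ` K)"
        unfolding cplx.simps by (intro exI[of _ "?g k"] exI[of _ "S \<union> ?g ` K'"] conjI allI)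
    qed
  qed
qed

lemma bounded_cplx_cosets_all:
  assumes B: "bounded_cplx (Suc t)"
  shows "bounded_cplx_cosets t s"
proof (induction s)
  case 0
  show ?case unfolding bounded_cplx_cosets_def
  proof
    fix m
    from spec[OF B[unfolded bounded_cplx_def], of m] obtain c where
      c0: "\<forall>S. finite S \<longrightarrow> card S \<le> m \<longrightarrow> S \<subseteq> cpm (Suc t) \<longrightarrow> cplx (cpm (Suc t)) c S" by (elim exE)
    note c = c0[rule_format]
    show "\<exists>c. \<forall>S X. finite S \<longrightarrow> card S \<le> m \<longrightarrow> fone \<in> S \<longrightarrow> finite X \<longrightarrow> card X \<le> 0 \<longrightarrow>
      X \<subseteq> cpm t \<longrightarrow> S \<subseteq> cosets t (insert fone X) \<longrightarrow> cplx (cpm t) c S"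
    proof (intro exI[of _ c] allI impI)
      fix S X assume S: "finite S" "card S \<le> m" and X: "finite X" "card X \<le> 0" "S \<subseteq> cosets t (insert fone X)"
      from X(1,2) have "X = {}" by simp
      with X(3) have "S \<subseteq> cpm (Suc t)" unfolding cosets_one by simp
      with S have "cplx (cpm (Suc t)) c S" by (rule c)
      then show "cplx (cpm t) c S" by (rule cplx_mono[OF cpm_Suc])
    qed
  qed
next
  case (Suc s)
  show ?case unfolding bounded_cplx_cosets_def
  proof
    fix m
    from spec[OF B[unfolded bounded_cplx_def], of m] obtain c' where
      c0: "\<forall>S. finite S \<longrightarrow> card S \<le> m \<longrightarrow> S \<subseteq> cpm (Suc t) \<longrightarrow> cplx (cpm (Suc t)) c' S" by (elim exE)
    note c' = c0[rule_format]
    from remove_coset[OF Suc.IH, of m c'] obtain c where c0: "\<forall>S X g K. finite S \<longrightarrow> card S \<le> m \<longrightarrow> fone \<in> S \<longrightarrow> finite X \<longrightarrow> card X \<le> s \<longrightarrow>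
        X \<subseteq> cpm t \<longrightarrow> S \<subseteq> cosets t (insert fone X) \<longrightarrow> g \<in> cpm t \<longrightarrow> cplx (cpm (Suc t)) c' K \<longrightarrow>
        cplx (cpm t) c (S \<union> (\<lambda>k n. g n \<otimes>\<^bsub>H\<^esub> k n) ` K)"
      by (elim exE)
    note c = c0[rule_format]
    show "\<exists>c. \<forall>S X. finite S \<longrightarrow> card S \<le> m \<longrightarrow> fone \<in> S \<longrightarrow> finite X \<longrightarrow> card X \<le> Suc s \<longrightarrow>
      X \<subseteq> cpm t \<longrightarrow> S \<subseteq> cosets t (insert fone X) \<longrightarrow> cplx (cpm t) c S"
    proof (intro exI[of _ c] allI impI)
      fix S X assume S: "finite S" "card S \<le> m" "fone \<in> S" and X: "finite X" "card X \<le> Suc s" "X \<subseteq> cpm t"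
        and SX: "S \<subseteq> cosets t (insert fone X)"
      \<comment> \<open>If \<open>X\<close> is empty there is no coset to remove, and any value of \<open>g\<close> will do.\<close>
      define g where "g = (if X = {} then fone else (SOME g. g \<in> X))"
      have gX: "g \<in> X" if "X \<noteq> {}" using that by (simp add: g_def some_in_eq)
      have g: "g \<in> cpm t"
      proof (cases "X = {}")
        case True
        then show ?thesis using cpm_one[of t] by (simp add: g_def)
      next
        case False
        then show ?thesis using gX X(3) by blast
      qed
      define X' where "X' = X - {g}"
      have X': "finite X'" "card X' \<le> s" "X' \<subseteq> cpm t"
      proof -
        show "finite X'" unfolding X'_def using X(1) by (rule finite_Diff)
        show "X' \<subseteq> cpm t" unfolding X'_def using X(3) by blast
        show "card X' \<le> s" unfolding X'_def using X gX by (cases "X = {}") (simp_all add: card_Diff_singleton)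
      qed
      define S1 where "S1 = S \<inter> cosets t (insert fone X')"
      have one: "fone \<in> cosets t (insert fone X')"
        using cosetsI[of fone "insert fone X'" fone t] cpm_one[of "Suc t"] by simp
      have S1: "finite S1" "card S1 \<le> m" "fone \<in> S1"
        using S one card_mono[OF S(1), of S1] by (simp_all add: S1_def)
      let ?g = "\<lambda>k n. g n \<otimes>\<^bsub>H\<^esub> k n"
      define K where "K = {k \<in> cpm (Suc t). ?g k \<in> S}"
      have inj: "inj_on ?g K"
      proof (rule inj_onI, rule ext)
        fix k k' n assume kk: "k \<in> K" "k' \<in> K" and eq: "?g k = ?g k'"
        from kk have "k \<in> cpm (Suc t)" "k' \<in> cpm (Suc t)" by (simp_all add: K_def)
        moreover have "g n \<otimes>\<^bsub>H\<^esub> k n = g n \<otimes>\<^bsub>H\<^esub> k' n" using fun_cong[OF eq, of n] .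
        ultimately have c: "k n \<in> carrier H" "k' n \<in> carrier H" "g n \<in> carrier H"
          and e: "g n \<otimes>\<^bsub>H\<^esub> k n = g n \<otimes>\<^bsub>H\<^esub> k' n"
          using G_closed(4) cpm_G g by blast+
        have "k n = inv\<^bsub>H\<^esub> (g n) \<otimes>\<^bsub>H\<^esub> (g n \<otimes>\<^bsub>H\<^esub> k n)" by (rule cancel(1)[OF c(3,1), symmetric])
        also have "\<dots> = k' n" unfolding e by (rule cancel(1)[OF c(3,2)])
        finally show "k n = k' n" .
      qed
      have gK: "?g ` K \<subseteq> S" by (auto simp: K_def)
      have K: "finite K" "card K \<le> m"
        using inj_on_finite[OF inj gK S(1)] card_inj_on_le[OF inj gK S(1)] S(2) by simp_all
      have "K \<subseteq> cpm (Suc t)" by (auto simp: K_def)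
      with K have "cplx (cpm (Suc t)) c' K" by (rule c')
      moreover have "S1 \<subseteq> cosets t (insert fone X')" by (simp add: S1_def)
      ultimately have "cplx (cpm t) c (S1 \<union> ?g ` K)" using S1 X' g by (intro c)
      moreover have "S \<subseteq> S1 \<union> ?g ` K"
      proof
        fix k assume k: "k \<in> S"
        with SX have "k \<in> cosets t (insert fone X)" by blast
        then obtain r d where r: "r \<in> insert fone X" "d \<in> cpm (Suc t)" "k = (\<lambda>n. r n \<otimes>\<^bsub>H\<^esub> d n)"
          by (rule cosetsE)
        show "k \<in> S1 \<union> ?g ` K"
        proof (cases "r = g")
          case True
          then have kd: "k = ?g d" using r(3) by simp
          then have "d \<in> K" using r(2) k by (simp add: K_def)
          then show ?thesis unfolding kd by (intro UnI2 imageI)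
        next
          case False
          then have "r \<in> insert fone X'" using r(1) by (auto simp: X'_def)
          then have "k \<in> cosets t (insert fone X')" unfolding r(3) using r(2) by (rule cosetsI)
          then show ?thesis using k by (simp add: S1_def)
        qed
      qed
      ultimately show "cplx (cpm t) c S" by (rule cplx_subset)
    qed
  qed
qed

text \<open>
  A system of \<open>m\<close> maps meets at most \<open>m\<close> cosets of the next level, and these are
  removed one after the other. At level \<open>len\<close> all maps are trivial.
\<close>

theorem bounded_cplx_all: "bounded_cplx t"
proof (induction "len - t" arbitrary: t)
  case 0
  have "g = fone" if "g \<in> cpm t" for g
    using pmap_value[of g t] Gs_trivial[of t] 0 that unfolding cpm_def by auto
  then have "cplx (cpm t) 0 S" if "S \<subseteq> cpm t" for S using that by auto
  then show ?case unfolding bounded_cplx_def by blast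
next
  case (Suc k)
  have IH: "bounded_cplx (Suc t)" using Suc(2) by (intro Suc(1)) simp
  show ?case unfolding bounded_cplx_def
  proof
    fix m
    from spec[OF bounded_cplx_cosets_all[OF IH, of m, unfolded bounded_cplx_cosets_def], of "Suc m"]
    obtain c where c0: "\<forall>S X. finite S \<longrightarrow> card S \<le> Suc m \<longrightarrow> fone \<in> S \<longrightarrow> finite X \<longrightarrow> card X \<le> m \<longrightarrow>
        X \<subseteq> cpm t \<longrightarrow> S \<subseteq> cosets t (insert fone X) \<longrightarrow> cplx (cpm t) c S" by (elim exE)
    note c = c0[rule_format]
    show "\<exists>c. \<forall>S. finite S \<longrightarrow> card S \<le> m \<longrightarrow> S \<subseteq> cpm t \<longrightarrow> cplx (cpm t) c S"
    proof (intro exI[of _ c] allI impI)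
      fix S assume S: "finite S" "card S \<le> m" "S \<subseteq> cpm t"
      have "insert fone S \<subseteq> cosets t (insert fone S)"
      proof
        fix r assume r: "r \<in> insert fone S"
        then have rc: "r \<in> cpm t" using S cpm_one by blast
        have "r = (\<lambda>n. r n \<otimes>\<^bsub>H\<^esub> \<one>\<^bsub>H\<^esub>)" by (rule ext) (simp add: G_closed(4)[OF cpm_G[OF rc]])
        then show "r \<in> cosets t (insert fone S)" using cosetsI[OF r cpm_one] by simp
      qed
      moreover have "card (insert fone S) \<le> Suc m" using S card_insert_le_m1[of "Suc m" S fone] by simp
      ultimately have "cplx (cpm t) c (insert fone S)" using S by (intro c[of _ S]) simp_all
      then show "cplx (cpm t) c S" by (rule cplx_subset) blast
    qed
  qed
qed

end

section \<open>An energy decomposition\<close>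

text \<open>The bound on the coefficients will allow to treat all terms of a combination at the same time.\<close>

definition comb :: "('x \<Rightarrow> complex) set \<Rightarrow> real \<Rightarrow> ('x \<Rightarrow> complex) set" where
  "comb A C = {w. \<exists>T lam. finite T \<and> T \<subseteq> A \<and> (\<Sum>\<sigma>\<in>T. cmod (lam \<sigma>)) \<le> C \<and> w = (\<lambda>x. \<Sum>\<sigma>\<in>T. lam \<sigma> * \<sigma> x)}"

lemma combI:
  "finite T \<Longrightarrow> T \<subseteq> A \<Longrightarrow> (\<Sum>\<sigma>\<in>T. cmod (lam \<sigma>)) \<le> C \<Longrightarrow> (\<lambda>x. \<Sum>\<sigma>\<in>T. lam \<sigma> * \<sigma> x) \<in> comb A C"
  unfolding comb_def by (rule CollectI, rule exI[of _ T], rule exI[of _ lam]) simp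

lemma combE:
  assumes "w \<in> comb A C"
  obtains T lam where "finite T" "T \<subseteq> A" "(\<Sum>\<sigma>\<in>T. cmod (lam \<sigma>)) \<le> C" "w = (\<lambda>x. \<Sum>\<sigma>\<in>T. lam \<sigma> * \<sigma> x)"
  using assms unfolding comb_def by (elim CollectE exE conjE)

lemma comb_zero: "0 \<le> C \<Longrightarrow> (\<lambda>x. 0) \<in> comb A C"
  using combI[of "{}" A "\<lambda>_. 0" C] by simp

lemma comb_add:
  assumes w: "w \<in> comb A C" and AB: "A \<subseteq> B" and \<sigma>: "\<sigma> \<in> B" and c: "cmod c \<le> C' - C"
  shows "(\<lambda>x. w x + c * \<sigma> x) \<in> comb B C'"
proof -
  obtain T lam where T: "finite T" "T \<subseteq> A" "(\<Sum>\<tau>\<in>T. cmod (lam \<tau>)) \<le> C" and wT: "w = (\<lambda>x. \<Sum>\<tau>\<in>T. lam \<tau> * \<tau> x)"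
    using w by (rule combE)
  define lam' where "lam' \<tau> = (if \<tau> \<in> T then lam \<tau> else 0) + (if \<tau> = \<sigma> then c else 0)" for \<tau>
  have split: "(\<Sum>\<tau>\<in>insert \<sigma> T. (if \<tau> \<in> T then p \<tau> else 0) + (if \<tau> = \<sigma> then r else 0)) = (\<Sum>\<tau>\<in>T. p \<tau>) + r"
    for p :: "_ \<Rightarrow> 'b::comm_monoid_add" and r
  proof -
    have "(\<Sum>\<tau>\<in>insert \<sigma> T. if \<tau> \<in> T then p \<tau> else 0) = (\<Sum>\<tau>\<in>T. if \<tau> \<in> T then p \<tau> else 0)"
      using T(1) by (intro sum.mono_neutral_right) auto
    also have "\<dots> = (\<Sum>\<tau>\<in>T. p \<tau>)" by (rule sum.cong) simp_all
    finally show ?thesis using T(1) by (simp add: sum.distrib)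
  qed
  have "(\<Sum>\<tau>\<in>insert \<sigma> T. lam' \<tau> * \<tau> x) = (\<Sum>\<tau>\<in>T. lam \<tau> * \<tau> x) + c * \<sigma> x" for x
  proof -
    have "(\<Sum>\<tau>\<in>insert \<sigma> T. lam' \<tau> * \<tau> x) =
        (\<Sum>\<tau>\<in>insert \<sigma> T. (if \<tau> \<in> T then lam \<tau> * \<tau> x else 0) + (if \<tau> = \<sigma> then c * \<sigma> x else 0))"
      by (rule sum.cong) (simp_all add: lam'_def distrib_right)
    then show ?thesis unfolding split .
  qed
  moreover have "(\<Sum>\<tau>\<in>insert \<sigma> T. cmod (lam' \<tau>)) \<le> C'"
  proof -
    have "(\<Sum>\<tau>\<in>insert \<sigma> T. cmod (lam' \<tau>)) \<le>
        (\<Sum>\<tau>\<in>insert \<sigma> T. (if \<tau> \<in> T then cmod (lam \<tau>) else 0) + (if \<tau> = \<sigma> then cmod c else 0))"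
      by (rule sum_mono) (simp add: lam'_def norm_triangle_ineq)
    also have "\<dots> = (\<Sum>\<tau>\<in>T. cmod (lam \<tau>)) + cmod c" by (rule split)
    finally show ?thesis using T(3) c by linarith
  qed
  moreover have "insert \<sigma> T \<subseteq> B" using T(2) AB \<sigma> by blast
  ultimately show ?thesis using combI[of "insert \<sigma> T" B lam' C'] T(1) by (simp add: wT)
qed

context prob_space
begin

lemma comb_bdd:
  assumes "w \<in> comb A C" "A \<subseteq> bdd M 1"
  shows "w \<in> bdd M C"
proof -
  obtain T lam where T: "finite T" "T \<subseteq> A" "(\<Sum>\<tau>\<in>T. cmod (lam \<tau>)) \<le> C" and w: "w = (\<lambda>x. \<Sum>\<tau>\<in>T. lam \<tau> * \<tau> x)"
    using assms(1) by (rule combE)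
  have "(\<lambda>x. \<Sum>\<tau>\<in>T. lam \<tau> * \<tau> x) \<in> bdd M (\<Sum>\<tau>\<in>T. cmod (lam \<tau>))"
    by (rule bdd_sum) (use T(2) assms(2) in blast)
  then show ?thesis unfolding w using T(3) by (rule bdd_mono)
qed

lemma nrm_diff_cmult_sq:
  assumes u: "u \<in> sq_int M" and s: "s \<in> sq_int M"
  shows "(nrm M (\<lambda>x. u x - c * s x))\<^sup>2 = (nrm M u)\<^sup>2 - 2 * Re (c * ip M s u) + (cmod c)\<^sup>2 * (nrm M s)\<^sup>2"
proof -
  have cs: "(\<lambda>x. c * s x) \<in> sq_int M" by (rule sq_int_cmult[OF s])
  have "complex_of_real ((nrm M (\<lambda>x. u x - c * s x))\<^sup>2) = ip M (\<lambda>x. u x - c * s x) (\<lambda>x. u x - c * s x)"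
    by (rule ip_self[symmetric])
  also have "\<dots> = ip M u u - cnj c * ip M u s - (c * ip M s u - c * (cnj c * ip M s s))"
    by (simp add: ip_diff_left[OF u cs sq_int_diff[OF u cs]] ip_diff_right[OF u cs u] ip_diff_right[OF u cs cs] ip_diff_right[OF u cs s]
        ip_cmult_left ip_cmult_right right_diff_distrib)
  also have "ip M u s = cnj (ip M s u)" by (rule ip_cnj)
  finally have "(nrm M (\<lambda>x. u x - c * s x))\<^sup>2 =
      Re (ip M u u - cnj c * cnj (ip M s u) - (c * ip M s u - c * (cnj c * ip M s s)))"
    by (metis Re_complex_of_real)
  also have "\<dots> = (nrm M u)\<^sup>2 - 2 * Re (c * ip M s u) + (cmod c)\<^sup>2 * (nrm M s)\<^sup>2"
    by (simp add: ip_self cmod_power2 algebra_simps power2_eq_square[of "Re c"] power2_eq_square[of "Im c"]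
        del: of_real_power)
  finally show ?thesis .
qed

text \<open>
  Let \<open>e r\<close> be the squared distance of \<open>\<phi>\<close> from the combinations of \<open>\<Sigma> r\<close> with coefficient norm at
  most \<open>2 \<surd>\<kappa> \<surd>r\<close>. As the harmonic series diverges, some step decreases \<open>e r\<close> by at most \<open>\<kappa> / (r + 1)\<close>,
  and then the difference of \<open>\<phi>\<close> and a nearly optimal combination is nearly orthogonal to \<open>\<Sigma> (r + 1)\<close>.
  The coefficient bound is chosen so that it grows by more than the square root of the admitted
  decrease, while its product with that square root remains small.
\<close>

lemma energy_decomposition:
  fixes \<Sigma> :: "nat \<Rightarrow> ('a \<Rightarrow> complex) set"
  assumes \<Sigma>: "\<And>r. \<Sigma> r \<subseteq> bdd M 1" "\<And>r. \<Sigma> r \<subseteq> \<Sigma> (Suc r)"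
    and \<phi>: "\<phi> \<in> bdd M 1" and \<kappa>: "0 < \<kappa>" and R: "1 < \<kappa> * (\<Sum>r<R. 1 / real (Suc r))"
  shows "\<exists>r<R. \<exists>w\<in>comb (\<Sigma> r) (2 * sqrt \<kappa> * sqrt r). \<forall>\<sigma>\<in>\<Sigma> (Suc r).
    cmod (ip M \<sigma> (\<lambda>x. \<phi> x - w x)) \<le> 3 / 2 * sqrt (\<kappa> / Suc r)"
proof -
  define C where "C r = 2 * sqrt \<kappa> * sqrt (real r)" for r
  define \<theta> where "\<theta> r = \<kappa> / real (Suc r)" for r
  define E where "E r = (\<lambda>w. (nrm M (\<lambda>x. \<phi> x - w x))\<^sup>2) ` comb (\<Sigma> r) (C r)" for r
  define e where "e r = Inf (E r)" for r
  have C0: "C r \<ge> 0" for r using \<kappa> by (simp add: C_def)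
  have \<theta>0: "\<theta> r > 0" for r using \<kappa> by (simp add: \<theta>_def)
  have Cgrow: "sqrt (\<theta> r) \<le> C (Suc r) - C r" for r
  proof -
    have le: "sqrt r \<le> sqrt (Suc r)" and pos: "sqrt (Suc r) > 0" by simp_all
    have "1 = (sqrt (Suc r) - sqrt r) * (sqrt (Suc r) + sqrt r)"
      by (simp add: algebra_simps flip: power2_eq_square)
    also have "\<dots> \<le> (sqrt (Suc r) - sqrt r) * (2 * sqrt (Suc r))"
      using le by (intro mult_left_mono) simp_all
    finally have "1 / sqrt (Suc r) \<le> 2 * (sqrt (Suc r) - sqrt r)"
      unfolding pos_divide_le_eq[OF pos] by (simp only: mult_ac)
    then have "sqrt \<kappa> * (1 / sqrt (Suc r)) \<le> sqrt \<kappa> * (2 * (sqrt (Suc r) - sqrt r))"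
      using \<kappa> by (intro mult_left_mono) simp_all
    then show ?thesis by (simp add: C_def \<theta>_def real_sqrt_divide algebra_simps)
  qed
  have bdd: "bdd_below (E r)" for r unfolding E_def by (rule bdd_belowI2[of _ 0]) simp
  have ne: "E r \<noteq> {}" for r unfolding E_def using comb_zero[OF C0] by blast
  have e0: "0 \<le> e r" for r unfolding e_def by (rule cInf_greatest[OF ne]) (auto simp: E_def)
  have \<phi>s: "\<phi> \<in> sq_int M" by (rule bdd_sq_int(1)[OF \<phi>])
  have e1: "e r \<le> 1" for r
  proof -
    have "(nrm M (\<lambda>x. \<phi> x - 0))\<^sup>2 \<in> E r" unfolding E_def by (rule imageI[OF comb_zero[OF C0]])
    then have "e r \<le> (nrm M (\<lambda>x. \<phi> x - 0))\<^sup>2" unfolding e_def by (rule cInf_lower[OF _ bdd])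
    also have "\<dots> \<le> 1" using power_mono[OF bdd_sq_int(2)[OF \<phi>], of 2] by simp
    finally show ?thesis .
  qed
  have "\<exists>r<R. e r \<le> e (Suc r) + \<theta> r"
  proof (rule ccontr)
    assume "\<not> (\<exists>r<R. e r \<le> e (Suc r) + \<theta> r)"
    then have "\<theta> r \<le> e r - e (Suc r)" if "r < R" for r using that by force
    then have "(\<Sum>r<R. \<theta> r) \<le> (\<Sum>r<R. e r - e (Suc r))" by (intro sum_mono) simp
    also have "\<dots> = e 0 - e R" by (rule sum_lessThan_telescope')
    also have "\<dots> \<le> 1" using e0[of R] e1[of 0] by linarith
    finally show False using R by (simp add: \<theta>_def sum_distrib_left)
  qed
  then obtain r where r: "r < R" "e r \<le> e (Suc r) + \<theta> r" by blast
  have "e r < e r + \<theta> r" using \<theta>0 by simp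
  from cInf_lessD[OF ne this[unfolded e_def]] obtain w where w: "w \<in> comb (\<Sigma> r) (C r)"
    and near: "(nrm M (\<lambda>x. \<phi> x - w x))\<^sup>2 < e r + \<theta> r" unfolding E_def e_def by blast
  define u where "u = (\<lambda>x. \<phi> x - w x)"
  have ws: "w \<in> sq_int M" by (rule bdd_sq_int(1)[OF comb_bdd[OF w \<Sigma>(1)]])
  have us: "u \<in> sq_int M" unfolding u_def by (rule sq_int_diff[OF \<phi>s ws])
  have "cmod (ip M \<sigma> u) \<le> 3 / 2 * sqrt (\<theta> r)" if \<sigma>: "\<sigma> \<in> \<Sigma> (Suc r)" for \<sigma>
  proof -
    define z where "z = ip M \<sigma> u"
    \<comment> \<open>If the pairing \<open>z\<close> were large, adding \<open>c \<sigma>\<close> to \<open>w\<close> would decrease the distance too much.\<close>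
    define c where "c = of_real (sqrt (\<theta> r)) * cnj (sgn z)"
    have \<sigma>b: "\<sigma> \<in> bdd M 1" using \<Sigma>(1) \<sigma> by blast
    have c1: "cmod c \<le> sqrt (\<theta> r)" using \<theta>0[of r] by (simp add: c_def norm_mult norm_sgn)
    have "cnj (sgn z) * z = of_real (cmod z)"
    proof (cases "z = 0")
      case False
      have "cnj z * z = of_real (cmod z) * of_real (cmod z)"
        using complex_norm_square[of z] by (simp add: power2_eq_square mult.commute)
      then show ?thesis using False by (simp add: sgn_div_norm scaleR_conv_of_real divide_simps)
    qed simp
    then have cz: "c * z = of_real (sqrt (\<theta> r) * cmod z)" by (simp add: c_def mult.assoc)
    have "(\<lambda>x. w x + c * \<sigma> x) \<in> comb (\<Sigma> (Suc r)) (C (Suc r))"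
      using c1 Cgrow[of r] by (intro comb_add[OF w \<Sigma>(2) \<sigma>]) simp
    then have "(nrm M (\<lambda>x. \<phi> x - (w x + c * \<sigma> x)))\<^sup>2 \<in> E (Suc r)" unfolding E_def by (rule imageI)
    then have "e (Suc r) \<le> (nrm M (\<lambda>x. \<phi> x - (w x + c * \<sigma> x)))\<^sup>2" unfolding e_def by (rule cInf_lower[OF _ bdd])
    also have "(\<lambda>x. \<phi> x - (w x + c * \<sigma> x)) = (\<lambda>x. u x - c * \<sigma> x)" by (simp add: u_def algebra_simps)
    also have "(nrm M (\<lambda>x. u x - c * \<sigma> x))\<^sup>2 = (nrm M u)\<^sup>2 - 2 * Re (c * z) + (cmod c)\<^sup>2 * (nrm M \<sigma>)\<^sup>2"
      unfolding z_def by (rule nrm_diff_cmult_sq[OF us bdd_sq_int(1)[OF \<sigma>b]])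
    also have "(cmod c)\<^sup>2 * (nrm M \<sigma>)\<^sup>2 \<le> \<theta> r * 1"
    proof (rule mult_mono)
      show "(cmod c)\<^sup>2 \<le> \<theta> r" using power_mono[OF c1, of 2] \<theta>0[of r] by simp
      show "(nrm M \<sigma>)\<^sup>2 \<le> 1" using power_mono[OF bdd_sq_int(2)[OF \<sigma>b], of 2] by simp
    qed (use \<theta>0[of r] in simp_all)
    also have "2 * Re (c * z) = 2 * (sqrt (\<theta> r) * cmod z)" unfolding cz by simp
    finally have "2 * (sqrt (\<theta> r) * cmod z) \<le> 3 * \<theta> r"
      using near r(2) unfolding u_def by linarith
    also have "3 * \<theta> r = sqrt (\<theta> r) * (3 * sqrt (\<theta> r))" using \<theta>0[of r] by simp
    finally have "sqrt (\<theta> r) * (2 * cmod z) \<le> sqrt (\<theta> r) * (3 * sqrt (\<theta> r))" by simp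
    then have "2 * cmod z \<le> 3 * sqrt (\<theta> r)" using \<theta>0[of r] by (simp add: mult_le_cancel_left)
    then show ?thesis by (simp add: z_def)
  qed
  then show ?thesis using r(1) w unfolding u_def C_def \<theta>_def
    by (intro exI[of _ r] conjI bexI[of _ w] ballI)
qed

end

section \<open>Products along a system\<close>

context polynomial_system
begin

text \<open>
  The maps form a set rather than a family: when two maps coincide, their functions are multiplied.
\<close>

definition prodF :: "('g \<Rightarrow> 'x operator) set \<Rightarrow> (('g \<Rightarrow> 'x operator) \<Rightarrow> 'x \<Rightarrow> complex) \<Rightarrow> 'g \<Rightarrow> 'x \<Rightarrow> complex" where
  "prodF S f n = (\<lambda>x. \<Prod>h\<in>S. act M (h n) (f h) x)"

lemma prodF_bdd:
  assumes "S \<subseteq> cpm 0" "\<And>h. h \<in> S \<Longrightarrow> f h \<in> bdd M 1"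
  shows "prodF S f n \<in> bdd M 1"
  unfolding prodF_def
proof (rule bdd_prod)
  fix h assume h: "h \<in> S"
  then have "h n \<in> G" using assms(1) by (intro cpm_G[of h 0]) blast
  then show "act M (h n) (f h) \<in> bdd M 1" using assms(2)[OF h] by (rule act_bdd)
qed

lemma cpm_strongly_continuous: "h \<in> cpm t \<Longrightarrow> strongly_continuous h"
  by (simp add: cpm_def)

lemma cont_bdd_mono: "cont_bdd M F B \<Longrightarrow> B \<le> B' \<Longrightarrow> cont_bdd M F B'"
  unfolding cont_bdd_def by (meson order_trans)

lemma cont_bdd_act_bdd:
  assumes "h \<in> cpm t" "u \<in> bdd M C"
  shows "cont_bdd M (\<lambda>n. act M (h n) u) C"
  by (rule cont_bdd_mono[OF strongly_continuous_cont_bdd[OF cpm_strongly_continuous[OF assms(1)] bdd_sq_int(1)[OF assms(2)]]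
      bdd_sq_int(2)[OF assms(2)]])

lemma prodF_cont_bdd:
  assumes "finite S" "S \<subseteq> cpm 0" "\<And>h. h \<in> S \<Longrightarrow> f h \<in> bdd M 1"
  shows "cont_bdd M (prodF S f) 1"
  unfolding prodF_def[abs_def]
proof (rule cont_bdd_prod[OF assms(1)])
  fix h assume h: "h \<in> S"
  with assms(2) have hc: "h \<in> cpm 0" by blast
  show "cont_bdd M (\<lambda>n. act M (h n) (f h)) 1" by (rule cont_bdd_act_bdd[OF hc assms(3)[OF h]])
  show "act M (h n) (f h) \<in> bdd M 1" for n by (rule act_bdd[OF cpm_G[OF hc] assms(3)[OF h]])
qed

text \<open>Missing members are supplied with the function 1, which all operators preserve.\<close>

lemma prodF_split:
  assumes S: "finite S'" "S \<subseteq> insert g S'" "insert g S' \<subseteq> cpm 0"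
  shows "AE x in M. prodF S f n x =
    prodF S' (\<lambda>h. if h \<in> S then f h else (\<lambda>x. 1)) n x * act M (g n) (if g \<in> S - S' then f g else (\<lambda>x. 1)) x"
proof -
  let ?f' = "\<lambda>h. if h \<in> S then f h else (\<lambda>x. 1)"
  have "AE x in M. \<forall>h\<in>insert g S'. act M (h n) (\<lambda>x. 1) x = 1"
  proof (rule AE_finite_allI)
    show "finite (insert g S')" using S(1) by simp
    fix h assume "h \<in> insert g S'"
    then have "h n \<in> G" using S(3) by (intro cpm_G[of h 0]) blast
    then show "AE x in M. act M (h n) (\<lambda>x. 1) x = 1" by (rule act_one_fun)
  qed
  then show ?thesis
  proof eventually_elim
    case (elim x)
    have fin: "finite S" by (rule finite_subset[OF S(2)]) (simp add: S(1))
    have "prodF S' ?f' n x = (\<Prod>h\<in>S'. if h \<in> S then act M (h n) (f h) x else 1)"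
      unfolding prodF_def using elim by (intro prod.cong) auto
    also have "\<dots> = (\<Prod>h\<in>S' \<inter> S. act M (h n) (f h) x)" using S(1) by (simp add: prod.inter_restrict)
    finally have 1: "prodF S' ?f' n x = (\<Prod>h\<in>S' \<inter> S. act M (h n) (f h) x)" .
    show ?case
    proof (cases "g \<in> S - S'")
      case True
      then have "S = insert g (S' \<inter> S)" "g \<notin> S' \<inter> S" using S(2) by auto
      then have "prodF S f n x = act M (g n) (f g) x * (\<Prod>h\<in>S' \<inter> S. act M (h n) (f h) x)"
        unfolding prodF_def using S(1) prod.insert[of "S' \<inter> S" g "\<lambda>h. act M (h n) (f h) x"] by simp
      then show ?thesis unfolding 1 using True by simp
    next
      case False
      then have "S = S' \<inter> S" using S(2) by auto
      then have "prodF S f n x = (\<Prod>h\<in>S' \<inter> S. act M (h n) (f h) x)" unfolding prodF_def by simp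
      then show ?thesis unfolding 1 if_not_P[OF False] using elim by simp
    qed
  qed
qed

text \<open>A bracket determines its last entry, whose value at \<open>n\<close> is read off at \<open>m\<close> with \<open>a + m + b = n\<close>.\<close>

lemma bracket_inj: "inj_on (bracket g a b) {h. \<forall>n. h n \<in> carrier H}" if g: "\<forall>n. g n \<in> carrier H"
proof (rule inj_onI, rule ext)
  fix h h' n assume h: "h \<in> {h. \<forall>n. h n \<in> carrier H}" "h' \<in> {h. \<forall>n. h n \<in> carrier H}"
    and eq: "bracket g a b h = bracket g a b h'"
  define m where "m = - a + n + - b"
  have m: "a + m + b = n" by (simp add: m_def add.assoc[symmetric] add.assoc)
  let ?T = "g m \<otimes>\<^bsub>H\<^esub> inv\<^bsub>H\<^esub> (g n)"
  have T: "?T \<in> carrier H" using g by simp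
  have e: "?T \<otimes>\<^bsub>H\<^esub> h n = ?T \<otimes>\<^bsub>H\<^esub> h' n" using fun_cong[OF eq, of m] unfolding bracket_def m .
  have "h n = inv\<^bsub>H\<^esub> ?T \<otimes>\<^bsub>H\<^esub> (?T \<otimes>\<^bsub>H\<^esub> h n)" by (rule cancel(1)[symmetric]) (use T h in simp_all)
  also have "\<dots> = h' n" unfolding e by (rule cancel(1)) (use T h in simp_all)
  finally show "h n = h' n" .
qed

text \<open>A map may be both a member of \<open>S\<close> and a bracket; then its two functions are multiplied.\<close>

lemma prodF_collapse:
  assumes S: "finite S" "insert g S \<subseteq> cpm 0"
    and f: "\<And>h. h \<in> S \<Longrightarrow> f h \<in> bdd M 1" and f1: "\<And>h. h \<in> S \<Longrightarrow> f1 h \<in> bdd M 1"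
  shows "\<exists>f2. (\<forall>k\<in>S \<union> bracket g a b ` S. f2 k \<in> bdd M 1) \<and>
    (\<forall>n. AE x in M. prodF (S \<union> bracket g a b ` S) f2 n x = prodF S f n x * (\<Prod>h\<in>S. act M (bracket g a b h n) (f1 h) x))"
proof -
  let ?B = "bracket g a b"
  have carr: "\<forall>n. h n \<in> carrier H" if "h \<in> insert g S" for h
    using that S(2) G_closed(4)[OF cpm_G[of h 0]] by blast
  have inj: "inj_on ?B S" by (rule inj_on_subset[OF bracket_inj]) (use carr in blast)+
  define p where "p k = (if k \<in> S then f k else (\<lambda>x. 1))" for k
  define q where "q k = (if k \<in> ?B ` S then f1 (inv_into S ?B k) else (\<lambda>x. 1))" for k
  have one: "(\<lambda>x::'x. 1) \<in> bdd M 1" by (rule bdd_const) simp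
  have pb: "p k \<in> bdd M 1" for k using f one by (simp add: p_def)
  have qb: "q k \<in> bdd M 1" for k
  proof (cases "k \<in> ?B ` S")
    case True
    then show ?thesis using f1[OF inv_into_into[OF True]] by (simp add: q_def)
  qed (simp add: q_def one)
  define f2 where "f2 k = (\<lambda>x. p k x * q k x)" for k
  have f2b: "f2 k \<in> bdd M 1" for k unfolding f2_def using bdd_mult[OF pb qb] by simp
  have KG: "k n \<in> G" if "k \<in> S \<union> ?B ` S" for k n
  proof -
    have "h n \<in> G" if "h \<in> insert g S" for h n using S(2) that by (intro cpm_G[of h 0]) blast
    then show ?thesis using that by (auto simp: bracket_def)
  qed
  have fin: "finite (S \<union> ?B ` S)" using S(1) by simp
  have "AE x in M. prodF (S \<union> ?B ` S) f2 n x = prodF S f n x * (\<Prod>h\<in>S. act M (?B h n) (f1 h) x)" for n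
  proof -
    have "AE x in M. \<forall>k\<in>S \<union> ?B ` S. act M (k n) (f2 k) x = act M (k n) (p k) x * act M (k n) (q k) x
        \<and> act M (k n) (\<lambda>x. 1) x = 1"
    proof (rule AE_finite_allI[OF fin])
      fix k assume k: "k \<in> S \<union> ?B ` S"
      show "AE x in M. act M (k n) (f2 k) x = act M (k n) (p k) x * act M (k n) (q k) x \<and> act M (k n) (\<lambda>x. 1) x = 1"
        using act_mult[OF KG[OF k] pb qb] act_one_fun[OF KG[OF k]] unfolding f2_def by eventually_elim simp
    qed
    then show ?thesis
    proof eventually_elim
      case (elim x)
      have "prodF (S \<union> ?B ` S) f2 n x = (\<Prod>k\<in>S \<union> ?B ` S. act M (k n) (p k) x * act M (k n) (q k) x)"
        unfolding prodF_def using elim by (intro prod.cong refl) blast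
      also have "\<dots> = (\<Prod>k\<in>S \<union> ?B ` S. act M (k n) (p k) x) * (\<Prod>k\<in>S \<union> ?B ` S. act M (k n) (q k) x)"
        by (rule prod.distrib)
      also have "(\<Prod>k\<in>S \<union> ?B ` S. act M (k n) (p k) x) = (\<Prod>k\<in>S. act M (k n) (p k) x)"
        using elim fin by (intro prod.mono_neutral_right) (auto simp: p_def)
      also have "\<dots> = prodF S f n x" unfolding prodF_def by (rule prod.cong) (simp_all add: p_def)
      also have "(\<Prod>k\<in>S \<union> ?B ` S. act M (k n) (q k) x) = (\<Prod>k\<in>?B ` S. act M (k n) (q k) x)"
        using elim fin by (intro prod.mono_neutral_right) (auto simp: q_def)
      also have "\<dots> = (\<Prod>h\<in>S. act M (?B h n) (q (?B h)) x)"
        using prod.reindex[OF inj, of "\<lambda>k. act M (k n) (q k) x"] by simp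
      also have "\<dots> = (\<Prod>h\<in>S. act M (?B h n) (f1 h) x)"
        by (rule prod.cong) (simp_all add: q_def inv_into_f_f[OF inj])
      finally show ?case .
    qed
  qed
  then show ?thesis using f2b by blast
qed

text \<open>
  The operator \<open>T = g l (g (a + l + b))\<^sup>-\<^sup>1\<close> is multiplicative and commutes with conjugation, so it can be applied
  to each factor, and \<open>T\<close> times \<open>h (a + l + b)\<close> is the bracket. The function \<open>h0\<close> goes with the identity map.
\<close>

lemma act_dual_product:
  assumes S: "finite S" "fone \<in> S" "insert g S \<subseteq> cpm 0"
    and f: "\<And>h. h \<in> S \<Longrightarrow> f h \<in> bdd M 1" and h0: "h0 \<in> bdd M 1"
  shows "AE x in M. act M (g l) (act M (inv\<^bsub>H\<^esub> (g (a + l + b))) (\<lambda>x. h0 x * cnj (prodF S f (a + l + b) x))) x =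
    (\<Prod>h\<in>S. act M (bracket g a b h l) (if h = fone then (\<lambda>x. h0 x * cnj (f fone x)) else (\<lambda>x. cnj (f h x))) x)"
proof -
  define n where "n = a + l + b"
  define F where "F h = (if h = fone then (\<lambda>x. h0 x * cnj (f fone x)) else (\<lambda>x. cnj (f h x)))" for h
  have HG: "h n \<in> G" if "h \<in> insert g S" for h n using S(3) that by (intro cpm_G[of h 0]) blast
  have Fb: "F h \<in> bdd M 1" if "h \<in> S" for h
    using bdd_mult[OF h0 bdd_cnj[OF f[OF S(2)]]] bdd_cnj[OF f[OF that]] by (simp add: F_def)
  have AFb: "act M (h n) (F h) \<in> bdd M 1" if "h \<in> S" for h by (rule act_bdd[OF HG Fb]) (use that in simp_all)
  let ?w = "\<lambda>x. h0 x * cnj (prodF S f n x)"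
  have wb: "?w \<in> bdd M 1"
    using bdd_mult[OF h0 bdd_cnj[OF prodF_bdd[of S f n]]] S(3) f by simp
  have eqw: "AE x in M. ?w x = (\<Prod>h\<in>S. act M (h n) (F h) x)"
  proof -
    have "AE x in M. \<forall>h\<in>S. act M (h n) (F h) x = (if h = fone then h0 x else 1) * cnj (act M (h n) (f h) x)"
    proof (rule AE_finite_allI[OF S(1)])
      fix h assume h: "h \<in> S"
      have fh: "f h \<in> bdd M 1" and hG: "h n \<in> G" using f[OF h] HG[of h n] h by simp_all
      show "AE x in M. act M (h n) (F h) x = (if h = fone then h0 x else 1) * cnj (act M (h n) (f h) x)"
      proof (cases "h = fone")
        case True
        have "AE x in M. act M \<one>\<^bsub>H\<^esub> (F h) x = F h x" "AE x in M. act M \<one>\<^bsub>H\<^esub> (f h) x = f h x"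
          using act_one[OF bdd_sq_int(1)[OF Fb[OF h]]] act_one[OF bdd_sq_int(1)[OF fh]] by simp_all
        then have "AE x in M. act M \<one>\<^bsub>H\<^esub> (F h) x = h0 x * cnj (act M \<one>\<^bsub>H\<^esub> (f h) x)"
          by eventually_elim (simp add: F_def True)
        then show ?thesis using True by simp
      next
        case False
        then show ?thesis using act_cnj[OF hG fh] by (simp add: F_def)
      qed
    qed
    then show ?thesis
    proof eventually_elim
      case (elim x)
      have "(\<Prod>h\<in>S. act M (h n) (F h) x) = (\<Prod>h\<in>S. (if h = fone then h0 x else 1) * cnj (act M (h n) (f h) x))"
        using elim by (intro prod.cong) simp_all
      also have "\<dots> = (\<Prod>h\<in>S. if h = fone then h0 x else 1) * cnj (prodF S f n x)"
        by (simp add: prod.distrib prodF_def)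
      also have "(\<Prod>h\<in>S. if h = fone then h0 x else 1) = h0 x" using S(1,2) by simp
      finally show ?case by simp
    qed
  qed
  let ?T = "g l \<otimes>\<^bsub>H\<^esub> inv\<^bsub>H\<^esub> (g n)"
  have T: "?T \<in> G" using HG[of g] by simp
  have "act M (g l) (act M (inv\<^bsub>H\<^esub> (g n)) ?w) = act M ?T ?w"
    using act_mult_op[OF HG[of g l] G_closed(2)[OF HG[of g n]] bdd_sq_int(1)[OF wb]] by simp
  also have "\<dots> = act M ?T (\<lambda>x. \<Prod>h\<in>S. act M (h n) (F h) x)" by (rule act_cong_AE[OF eqw])
  finally have "act M (g l) (act M (inv\<^bsub>H\<^esub> (g n)) ?w) = act M ?T (\<lambda>x. \<Prod>h\<in>S. act M (h n) (F h) x)" .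
  moreover have "AE x in M. act M ?T (\<lambda>x. \<Prod>h\<in>S. act M (h n) (F h) x) x = (\<Prod>h\<in>S. act M ?T (act M (h n) (F h)) x)"
    by (rule act_prod[OF T AFb])
  moreover have "act M ?T (act M (h n) (F h)) = act M (bracket g a b h l) (F h)" if "h \<in> S" for h
    using act_mult_op[OF T HG[of h n] bdd_sq_int(1)[OF Fb[OF that]]] that by (simp add: bracket_def n_def)
  ultimately have "AE x in M. act M (g l) (act M (inv\<^bsub>H\<^esub> (g n)) ?w) x = (\<Prod>h\<in>S. act M (bracket g a b h l) (F h) x)"
    by simp
  then show ?thesis unfolding n_def F_def .
qed

end

section \<open>Metastable convergence\<close>

context polynomial_system
begin

definition inv_under :: "'g measure \<Rightarrow> real \<Rightarrow> 'g \<Rightarrow> bool" where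
  "inv_under \<nu> \<delta> l \<longleftrightarrow> (\<forall>\<phi> :: 'g \<Rightarrow> complex. \<forall>B. continuous_on UNIV \<phi> \<longrightarrow> (\<forall>n. cmod (\<phi> n) \<le> B) \<longrightarrow>
    cmod ((\<integral>n. \<phi> (l + n) \<partial>\<nu>) - (\<integral>n. \<phi> n \<partial>\<nu>)) \<le> \<delta> * B)"

text \<open>
  A chain is a finite sequence of pairs of averages, each nearly invariant under the translations by all
  arguments that occur in the earlier pairs. The Boolean argument selects the member of the pair.
\<close>

definition chain :: "nat set \<Rightarrow> real \<Rightarrow> (nat \<Rightarrow> bool \<Rightarrow> 'g measure) \<Rightarrow> (nat \<Rightarrow> bool \<Rightarrow> 'g) \<Rightarrow> (nat \<Rightarrow> 'g set) \<Rightarrow> bool" where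
  "chain D \<delta> \<nu> a Z \<longleftrightarrow> (\<forall>k\<in>D. \<forall>s. averaging (\<nu> k s) (a k s) (Z k) \<and>
    (\<forall>i\<in>D. i < k \<longrightarrow> (\<forall>l\<in>Z i. inv_under (\<nu> k s) \<delta> l)))"

lemma chainD:
  assumes "chain D \<delta> \<nu> a Z" "k \<in> D"
  shows "averaging (\<nu> k s) (a k s) (Z k)" "i \<in> D \<Longrightarrow> i < k \<Longrightarrow> l \<in> Z i \<Longrightarrow> inv_under (\<nu> k s) \<delta> l"
  using assms unfolding chain_def by blast+

lemma chain_subset: "chain D \<delta> \<nu> a Z \<Longrightarrow> D' \<subseteq> D \<Longrightarrow> chain D' \<delta> \<nu> a Z"
  unfolding chain_def by blast

lemma inv_under_mono:
  assumes "inv_under \<nu> \<delta> l" "\<delta> \<le> \<delta>'"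
  shows "inv_under \<nu> \<delta>' l"
  unfolding inv_under_def
proof (intro allI impI)
  fix \<phi> :: "'g \<Rightarrow> complex" and B
  assume c: "continuous_on UNIV \<phi>" and b: "\<forall>n. cmod (\<phi> n) \<le> B"
  have "0 \<le> B" using b by (meson norm_ge_zero order_trans)
  then have "\<delta> * B \<le> \<delta>' * B" using assms(2) by (rule mult_right_mono[rotated])
  moreover have "cmod ((\<integral>n. \<phi> (l + n) \<partial>\<nu>) - (\<integral>n. \<phi> n \<partial>\<nu>)) \<le> \<delta> * B"
    using assms(1) c b unfolding inv_under_def by blast
  ultimately show "cmod ((\<integral>n. \<phi> (l + n) \<partial>\<nu>) - (\<integral>n. \<phi> n \<partial>\<nu>)) \<le> \<delta>' * B" by linarith
qed

lemma chain_mono: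
  assumes "chain D \<delta> \<nu> a Z" "\<delta> \<le> \<delta>'"
  shows "chain D \<delta>' \<nu> a Z"
  unfolding chain_def
proof (intro ballI allI conjI impI)
  fix k s assume k: "k \<in> D"
  show "averaging (\<nu> k s) (a k s) (Z k)" by (rule chainD(1)[OF assms(1) k])
  fix i l assume "i \<in> D" "i < k" "l \<in> Z i"
  from inv_under_mono[OF chainD(2)[OF assms(1) k this] assms(2)] show "inv_under (\<nu> k s) \<delta>' l" .
qed

definition avg :: "'g measure \<Rightarrow> 'g \<Rightarrow> ('g \<Rightarrow> 'x \<Rightarrow> complex) \<Rightarrow> 'x \<Rightarrow> complex" where
  "avg \<nu> a F = (SOME v. is_mean M \<nu> a F v)"

definition gap :: "(nat \<Rightarrow> bool \<Rightarrow> 'g measure) \<Rightarrow> (nat \<Rightarrow> bool \<Rightarrow> 'g) \<Rightarrow> nat \<Rightarrow> ('g \<Rightarrow> 'x \<Rightarrow> complex) \<Rightarrow> real" where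
  "gap \<nu> a k F = nrm M (\<lambda>x. avg (\<nu> k True) (a k True) F x - avg (\<nu> k False) (a k False) F x)"

lemma avg_is_mean:
  assumes "cont_bdd M F B" "averaging \<nu> a Z"
  shows "is_mean M \<nu> a F (avg \<nu> a F)"
  unfolding avg_def by (rule someI_ex[OF mean_exists[OF assms]])

lemma avg_is_mean': "is_mean M \<nu> a F v \<Longrightarrow> is_mean M \<nu> a F (avg \<nu> a F)"
  unfolding avg_def by (rule someI[of "is_mean M \<nu> a F"])

lemma gap_eq:
  assumes v: "is_mean M (\<nu> k True) (a k True) F v" and v': "is_mean M (\<nu> k False) (a k False) F v'"
  shows "gap \<nu> a k F = nrm M (\<lambda>x. v x - v' x)"
  unfolding gap_def
proof (rule nrm_cong_AE)
  show "AE x in M. avg (\<nu> k True) (a k True) F x - avg (\<nu> k False) (a k False) F x = v x - v' x"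
    using is_mean_unique[OF avg_is_mean'[OF v] v] is_mean_unique[OF avg_is_mean'[OF v'] v']
    by eventually_elim simp
qed (intro sq_intD sq_int_diff is_meanD(1)[OF avg_is_mean'[OF v]] is_meanD(1)[OF avg_is_mean'[OF v']]
    is_meanD(1)[OF v] is_meanD(1)[OF v'])+

lemma gap_cong:
  assumes ok: "\<And>s. averaging (\<nu> k s) (a k s) (Z k)" and F: "cont_bdd M F B"
    and eq: "\<And>n. AE x in M. F n x = F' n x" "\<And>n. F' n \<in> borel_measurable M"
  shows "gap \<nu> a k F' = gap \<nu> a k F"
proof -
  have m: "is_mean M (\<nu> k s) (a k s) F (avg (\<nu> k s) (a k s) F)" for s by (rule avg_is_mean[OF F ok])
  have "is_mean M (\<nu> k s) (a k s) F' (avg (\<nu> k s) (a k s) F)" for s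
    by (rule is_mean_cong[OF m eq(1) sq_intD[OF cont_bdd_sq_int[OF F]] eq(2)])
  from gap_eq[of \<nu> k a, OF this this] show ?thesis by (simp add: gap_def)
qed

lemma gap_sum:
  assumes ok: "\<And>s. averaging (\<nu> k s) (a k s) (Z k)" and F: "\<And>t. t \<in> T \<Longrightarrow> cont_bdd M (F t) (B t)"
  shows "gap \<nu> a k (\<lambda>n x. \<Sum>t\<in>T. c t * F t n x) \<le> (\<Sum>t\<in>T. cmod (c t) * gap \<nu> a k (F t))"
proof -
  let ?v = "\<lambda>s t. avg (\<nu> k s) (a k s) (F t)"
  have m: "is_mean M (\<nu> k s) (a k s) (F t) (?v s t)" if "t \<in> T" for s t by (rule avg_is_mean[OF F[OF that] ok])
  have ms: "is_mean M (\<nu> k s) (a k s) (\<lambda>n x. \<Sum>t\<in>T. c t * F t n x) (\<lambda>x. \<Sum>t\<in>T. c t * ?v s t x)" for s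
    by (rule is_mean_sum[OF ok F m])
  have "gap \<nu> a k (\<lambda>n x. \<Sum>t\<in>T. c t * F t n x) =
      nrm M (\<lambda>x. (\<Sum>t\<in>T. c t * ?v True t x) - (\<Sum>t\<in>T. c t * ?v False t x))"
    by (rule gap_eq[of \<nu> k a, OF ms ms])
  also have "\<dots> = nrm M (\<lambda>x. \<Sum>t\<in>T. c t * (?v True t x - ?v False t x))"
    by (simp add: right_diff_distrib sum_subtractf)
  also have "\<dots> \<le> (\<Sum>t\<in>T. cmod (c t) * nrm M (\<lambda>x. ?v True t x - ?v False t x))"
    by (rule nrm_sum_le) (rule sq_int_diff[OF is_meanD(1)[OF m] is_meanD(1)[OF m]])
  finally show ?thesis by (simp add: gap_def)
qed

lemma gap_close:
  assumes ok: "\<And>s. averaging (\<nu> k s) (a k s) (Z k)" and F: "cont_bdd M F B" "cont_bdd M F' B'"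
    and le: "\<And>n. n \<in> Z k \<Longrightarrow> nrm M (\<lambda>x. F n x - F' n x) \<le> \<delta>" and \<delta>: "0 \<le> \<delta>"
  shows "gap \<nu> a k F \<le> gap \<nu> a k F' + 2 * \<delta>"
proof -
  let ?v = "\<lambda>s. avg (\<nu> k s) (a k s) F" and ?w = "\<lambda>s. avg (\<nu> k s) (a k s) F'"
  have m: "is_mean M (\<nu> k s) (a k s) F (?v s)" "is_mean M (\<nu> k s) (a k s) F' (?w s)" for s
    by (rule avg_is_mean[OF F(1) ok]) (rule avg_is_mean[OF F(2) ok])
  have d: "nrm M (\<lambda>x. ?v s x - ?w s x) \<le> \<delta>" for s
    by (rule is_mean_diff_le[OF ok F m le \<delta>])
  note sq = is_meanD(1)[OF m(1)] is_meanD(1)[OF m(2)]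
  have "gap \<nu> a k F \<le> nrm M (\<lambda>x. ?v True x - ?w True x) + nrm M (\<lambda>x. ?w True x - ?v False x)"
    unfolding gap_def by (rule nrm_triangle_diff[OF sq(1) sq(2) sq(1)])
  also have "nrm M (\<lambda>x. ?w True x - ?v False x) \<le> gap \<nu> a k F' + nrm M (\<lambda>x. ?w False x - ?v False x)"
    unfolding gap_def by (rule nrm_triangle_diff[OF sq(2) sq(2) sq(1)])
  also have "nrm M (\<lambda>x. ?w False x - ?v False x) = nrm M (\<lambda>x. ?v False x - ?w False x)" by (rule nrm_minus_commute)
  finally show ?thesis using d[of True] d[of False] by linarith
qed

lemma gap_le:
  assumes ok: "\<And>s. averaging (\<nu> k s) (a k s) (Z k)" and F: "cont_bdd M F B"
  shows "gap \<nu> a k F \<le> 2 * B"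
proof -
  have m: "is_mean M (\<nu> k s) (a k s) F (avg (\<nu> k s) (a k s) F)" for s by (rule avg_is_mean[OF F ok])
  show ?thesis
    using nrm_diff_le[OF is_meanD(1)[OF m[of True]] is_meanD(1)[OF m[of False]]]
      is_mean_nrm_le[OF ok F m[of True]] is_mean_nrm_le[OF ok F m[of False]] unfolding gap_def by linarith
qed

lemma gap_add_small:
  assumes ok: "\<And>s. averaging (\<nu> k s) (a k s) (Z k)" and F: "cont_bdd M F B" "cont_bdd M F' B'"
    and small: "\<And>s. nrm M (avg (\<nu> k s) (a k s) F') \<le> \<epsilon>"
  shows "gap \<nu> a k (\<lambda>n x. F n x + F' n x) \<le> gap \<nu> a k F + 2 * \<epsilon>"
proof -
  let ?v = "\<lambda>s. avg (\<nu> k s) (a k s) F" and ?w = "\<lambda>s. avg (\<nu> k s) (a k s) F'"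
  have m: "is_mean M (\<nu> k s) (a k s) F (?v s)" "is_mean M (\<nu> k s) (a k s) F' (?w s)" for s
    by (rule avg_is_mean[OF F(1) ok]) (rule avg_is_mean[OF F(2) ok])
  note sq = is_meanD(1)[OF m(1)] is_meanD(1)[OF m(2)]
  have ms: "is_mean M (\<nu> k s) (a k s) (\<lambda>n x. F n x + F' n x) (\<lambda>x. ?v s x + ?w s x)" for s
    by (rule is_mean_add[OF ok F m])
  have "gap \<nu> a k (\<lambda>n x. F n x + F' n x) = nrm M (\<lambda>x. (?v True x + ?w True x) - (?v False x + ?w False x))"
    by (rule gap_eq[of \<nu> k a, OF ms ms])
  also have "(\<lambda>x. (?v True x + ?w True x) - (?v False x + ?w False x)) =
      (\<lambda>x. (?v True x - ?v False x) + (?w True x - ?w False x))" by (rule ext) simp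
  also have "nrm M \<dots> \<le> gap \<nu> a k F + nrm M (\<lambda>x. ?w True x - ?w False x)"
    unfolding gap_def by (rule nrm_triangle[OF sq_int_diff[OF sq(1) sq(1)] sq_int_diff[OF sq(2) sq(2)]])
  also have "nrm M (\<lambda>x. ?w True x - ?w False x) \<le> nrm M (?w True) + nrm M (?w False)"
    by (rule nrm_diff_le[OF sq(2) sq(2)])
  finally show ?thesis using small[of True] small[of False] by linarith
qed

text \<open>
  A function is structured if its orbit under \<open>g\<close>, at the arguments that occur before step \<open>m\<close>, is
  approximated by averages of products along the brackets of \<open>g\<close>. Only the last argument \<open>l\<close> of the brackets
  varies along the orbit; nodes, weights and functions are fixed.
\<close>

definition structured :: "('g \<Rightarrow> 'x operator) \<Rightarrow> ('g \<Rightarrow> 'x operator) set \<Rightarrow> (nat \<Rightarrow> 'g set) \<Rightarrow> nat \<Rightarrow> real \<Rightarrow>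
    ('x \<Rightarrow> complex) \<Rightarrow> bool" where
  "structured g S Z m \<delta> \<sigma> \<longleftrightarrow> \<sigma> \<in> bdd M 1 \<and> (\<exists>a Q q f. finite Q \<and> (\<forall>b\<in>Q. 0 \<le> q b) \<and> sum q Q = 1 \<and>
    (\<forall>h\<in>S. f h \<in> bdd M 1) \<and> (\<forall>k<m. \<forall>l\<in>Z k. nrm M (\<lambda>x. act M (g l) \<sigma> x -
      (\<Sum>b\<in>Q. of_real (q b) * (\<Prod>h\<in>S. act M (bracket g a b h l) (f h) x))) \<le> \<delta>))"

lemma structured_bdd: "structured g S Z m \<delta> \<sigma> \<Longrightarrow> \<sigma> \<in> bdd M 1"
  by (simp add: structured_def)

lemma structured_antimono:
  assumes "structured g S Z m \<delta> \<sigma>" "m' \<le> m"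
  shows "structured g S Z m' \<delta> \<sigma>"
proof -
  from assms(1) obtain a Q q f where *: "\<sigma> \<in> bdd M 1" "finite Q" "\<forall>b\<in>Q. 0 \<le> q b" "sum q Q = 1"
    "\<forall>h\<in>S. f h \<in> bdd M 1" "\<forall>k<m. \<forall>l\<in>Z k. nrm M (\<lambda>x. act M (g l) \<sigma> x -
      (\<Sum>b\<in>Q. of_real (q b) * (\<Prod>h\<in>S. act M (bracket g a b h l) (f h) x))) \<le> \<delta>"
    unfolding structured_def by (elim conjE exE)
  have "\<forall>k<m'. \<forall>l\<in>Z k. nrm M (\<lambda>x. act M (g l) \<sigma> x -
      (\<Sum>b\<in>Q. of_real (q b) * (\<Prod>h\<in>S. act M (bracket g a b h l) (f h) x))) \<le> \<delta>"
  proof (intro allI impI ballI)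
    fix k l assume "k < m'" and l: "l \<in> Z k"
    then have "k < m" using assms(2) by simp
    with *(6) l show "nrm M (\<lambda>x. act M (g l) \<sigma> x -
      (\<Sum>b\<in>Q. of_real (q b) * (\<Prod>h\<in>S. act M (bracket g a b h l) (f h) x))) \<le> \<delta>" by blast
  qed
  with * show ?thesis unfolding structured_def
    by (intro conjI exI[of _ a] exI[of _ Q] exI[of _ q] exI[of _ f])
qed

lemma dual_cont_bdd:
  assumes S: "finite S" "insert g S \<subseteq> cpm 0" and f: "\<And>h. h \<in> S \<Longrightarrow> f h \<in> bdd M 1" and h0: "h0 \<in> bdd M 1"
  shows "cont_bdd M (\<lambda>n. act M (inv\<^bsub>H\<^esub> (g n)) (\<lambda>x. h0 x * cnj (prodF S f n x))) 1"
    "(\<lambda>x. h0 x * cnj (prodF S f n x)) \<in> bdd M 1"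
    "act M (inv\<^bsub>H\<^esub> (g n)) (\<lambda>x. h0 x * cnj (prodF S f n x)) \<in> bdd M 1"
proof -
  have S0: "S \<subseteq> cpm 0" and g: "g \<in> cpm 0" using S(2) by simp_all
  have Pb: "(\<lambda>x. cnj (prodF S f n x)) \<in> bdd M 1" for n by (rule bdd_cnj[OF prodF_bdd[OF S0 f]])
  have "cont_bdd M (\<lambda>n x. h0 x * cnj (prodF S f n x)) (1 * 1)"
    by (rule cont_bdd_mult[OF cont_bdd_const[OF bdd_sq_int(1)[OF h0] bdd_sq_int(2)[OF h0]] h0
        cont_bdd_cnj[OF prodF_cont_bdd[OF S(1) S0 f]] Pb])
  then have c: "cont_bdd M (\<lambda>n x. h0 x * cnj (prodF S f n x)) 1" by simp
  show "cont_bdd M (\<lambda>n. act M (inv\<^bsub>H\<^esub> (g n)) (\<lambda>x. h0 x * cnj (prodF S f n x))) 1"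
    by (rule cont_bdd_act[OF strongly_continuous_inv[OF cpm_strongly_continuous[OF g]] c])
  have b: "(\<lambda>x. h0 x * cnj (prodF S f n x)) \<in> bdd M 1" for n using bdd_mult[OF h0 Pb, of n] by simp
  show "(\<lambda>x. h0 x * cnj (prodF S f n x)) \<in> bdd M 1" by (rule b)
  show "act M (inv\<^bsub>H\<^esub> (g n)) (\<lambda>x. h0 x * cnj (prodF S f n x)) \<in> bdd M 1"
    by (rule act_bdd[OF G_closed(2)[OF cpm_G[OF g]] b])
qed

text \<open>
  The average over a later member of the chain does not change much under translation by an argument \<open>l\<close> of an
  earlier one, and applying \<open>g l\<close> to the translated average produces brackets. By quadrature the average is
  replaced by finite sums, with the same nodes for all \<open>l\<close>.
\<close>

lemma dual_structured:
  assumes S: "finite S" "fone \<in> S" "insert g S \<subseteq> cpm 0" and f: "\<And>h. h \<in> S \<Longrightarrow> f h \<in> bdd M 1" and h0: "h0 \<in> bdd M 1"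
    and ch: "chain {..<K} \<delta> \<nu> a Z" and k: "k < K" "m \<le> k" and \<delta>: "0 < \<delta>"
    and \<sigma>: "is_mean M (\<nu> k s) (a k s) (\<lambda>n. act M (inv\<^bsub>H\<^esub> (g n)) (\<lambda>x. h0 x * cnj (prodF S f n x))) \<sigma>"
  shows "structured g S Z m (2 * \<delta>) \<sigma>"
proof -
  define \<psi> where "\<psi> n = act M (inv\<^bsub>H\<^esub> (g n)) (\<lambda>x. h0 x * cnj (prodF S f n x))" for n
  note d = dual_cont_bdd[OF S(1,3) f h0]
  have \<psi>: "cont_bdd M \<psi> 1" using d(1) unfolding \<psi>_def .
  have \<psi>b: "\<psi> n \<in> bdd M 1" for n unfolding \<psi>_def by (rule d(3))
  have \<psi>s: "\<psi> n \<in> sq_int M" for n by (rule cont_bdd_sq_int[OF \<psi>])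
  have \<sigma>': "is_mean M (\<nu> k s) (a k s) \<psi> \<sigma>" using \<sigma> unfolding \<psi>_def[abs_def] .
  have kD: "k \<in> {..<K}" using k by simp
  have av: "averaging (\<nu> k s) (a k s) (Z k)" by (rule chainD(1)[OF ch kD])
  have \<sigma>b: "\<sigma> \<in> bdd M 1" by (rule is_mean_bdd[OF av \<psi> \<psi>b \<sigma>'])
  have \<sigma>s: "\<sigma> \<in> sq_int M" by (rule is_meanD(1)[OF \<sigma>'])
  let ?\<nu> = "\<nu> k s" and ?a = "a k s"
  have \<nu>: "prob_space ?\<nu>" "sets ?\<nu> = sets borel" "compact (Z k)" "AE n in ?\<nu>. ?a + n \<in> Z k"
    using av by (simp_all add: averaging_def)
  have Zc: "compact ((+) (- ?a) ` Z k)" by (rule compact_translate[OF \<nu>(3)])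
  have Zae: "AE n in ?\<nu>. n \<in> (+) (- ?a) ` Z k"
    using \<nu>(4)
  proof eventually_elim
    case (elim n)
    then have "- ?a + (?a + n) \<in> (+) (- ?a) ` Z k" by (rule imageI)
    then show ?case by (simp add: add.assoc[symmetric])
  qed
  have Lc: "compact (\<Union>i<m. Z i)"
  proof (rule compact_UN)
    show "compact (Z i)" if "i \<in> {..<m}" for i
      using chainD(1)[OF ch, of i s] that k by (simp add: averaging_def)
  qed simp
  have \<psi>a: "cont_bdd M (\<lambda>n. \<psi> (?a + n)) 1" by (rule cont_bdd_translate_left[OF \<psi>])
  from quadrature[OF \<psi>a \<nu>(1,2) Zc Zae Lc \<delta>] obtain Q q where
    Q: "finite Q" "\<forall>b\<in>Q. 0 \<le> q b" "sum q Q = 1" and quad: "\<forall>l\<in>(\<Union>i<m. Z i). \<forall>h\<in>sq_int M.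
    cmod ((\<integral>n. ip M (\<psi> (?a + (l + n))) h \<partial>?\<nu>) - (\<Sum>b\<in>Q. of_real (q b) * ip M (\<psi> (?a + (l + b))) h)) \<le> \<delta> * nrm M h"
    by (elim exE conjE)
  define f' where "f' h = (if h = fone then (\<lambda>x. h0 x * cnj (f fone x)) else (\<lambda>x. cnj (f h x)))" for h
  have f'b: "f' h \<in> bdd M 1" if "h \<in> S" for h
    using bdd_mult[OF h0 bdd_cnj[OF f[OF S(2)]]] bdd_cnj[OF f[OF that]] by (simp add: f'_def)
  have "nrm M (\<lambda>x. act M (g l) \<sigma> x - (\<Sum>b\<in>Q. of_real (q b) * (\<Prod>h\<in>S. act M (bracket g ?a b h l) (f' h) x))) \<le> 2 * \<delta>"
    if i: "i < m" and l: "l \<in> Z i" for i l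
  proof -
    let ?X = "\<lambda>x. \<Sum>b\<in>Q. of_real (q b) * \<psi> (?a + (l + b)) x"
    have X: "?X \<in> sq_int M" by (rule sq_int_sum[OF \<psi>s])
    have iD: "i \<in> {..<K}" "i < k" using i k by simp_all
    have gl: "g l \<in> G" using S(3) by (intro cpm_G[of g 0]) simp
    have "nrm M (\<lambda>x. \<sigma> x - ?X x) \<le> 2 * \<delta>"
    proof (rule nrm_le_if_ip_le[OF sq_int_diff[OF \<sigma>s X]])
      fix h assume h: "h \<in> sq_int M"
      let ?J = "\<integral>n. ip M (\<psi> (?a + (l + n))) h \<partial>?\<nu>"
      have "continuous_on UNIV (\<lambda>n. ip M (\<psi> (?a + n)) h)" by (rule cont_bdd_ip_cont[OF \<psi>a h])
      moreover have "\<forall>n. cmod (ip M (\<psi> (?a + n)) h) \<le> 1 * nrm M h" using cont_bdd_ip_bound[OF \<psi>a h] by blast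
      ultimately have "cmod (?J - (\<integral>n. ip M (\<psi> (?a + n)) h \<partial>?\<nu>)) \<le> \<delta> * (1 * nrm M h)"
        using chainD(2)[OF ch kD iD l, of s] unfolding inv_under_def by blast
      then have 1: "cmod (?J - ip M \<sigma> h) \<le> \<delta> * nrm M h" using is_meanD(2)[OF \<sigma>' h] by simp
      have ipX: "ip M ?X h = (\<Sum>b\<in>Q. of_real (q b) * ip M (\<psi> (?a + (l + b))) h)"
        by (rule ip_sum_left[OF h]) (rule \<psi>s)
      have "l \<in> (\<Union>i<m. Z i)" using i l by blast
      from bspec[OF bspec[OF quad this] h] have 2: "cmod (?J - ip M ?X h) \<le> \<delta> * nrm M h" unfolding ipX .
      have eq: "ip M (\<lambda>x. \<sigma> x - ?X x) h = (?J - ip M ?X h) - (?J - ip M \<sigma> h)"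
        using ip_diff_left[OF \<sigma>s X h] by simp
      have "cmod (ip M (\<lambda>x. \<sigma> x - ?X x) h) \<le> cmod (?J - ip M ?X h) + cmod (?J - ip M \<sigma> h)"
        unfolding eq by (rule norm_triangle_ineq4)
      with 1 2 show "cmod (ip M (\<lambda>x. \<sigma> x - ?X x) h) \<le> 2 * \<delta> * nrm M h" by linarith
    qed (use \<delta> in simp)
    then have "nrm M (\<lambda>x. act M (g l) \<sigma> x - act M (g l) ?X x) \<le> 2 * \<delta>"
      unfolding act_nrm_diff[OF gl \<sigma>s X] .
    also have "nrm M (\<lambda>x. act M (g l) \<sigma> x - act M (g l) ?X x) =
        nrm M (\<lambda>x. act M (g l) \<sigma> x - (\<Sum>b\<in>Q. of_real (q b) * (\<Prod>h\<in>S. act M (bracket g ?a b h l) (f' h) x)))"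
    proof (rule nrm_cong_AE)
      have "AE x in M. \<forall>b\<in>Q. act M (g l) (\<psi> (?a + (l + b))) x = (\<Prod>h\<in>S. act M (bracket g ?a b h l) (f' h) x)"
      proof (rule AE_finite_allI[OF Q(1)])
        fix b
        show "AE x in M. act M (g l) (\<psi> (?a + (l + b))) x = (\<Prod>h\<in>S. act M (bracket g ?a b h l) (f' h) x)"
          using act_dual_product[where S=S and g=g and f=f and ?h0.0=h0 and l=l and a="?a" and b=b, OF S f h0]
          unfolding \<psi>_def f'_def add.assoc .
      qed
      moreover have "AE x in M. act M (g l) ?X x = (\<Sum>b\<in>Q. of_real (q b) * act M (g l) (\<psi> (?a + (l + b))) x)"
        by (rule act_sum[OF gl]) (rule \<psi>s)
      ultimately show "AE x in M. act M (g l) \<sigma> x - act M (g l) ?X x =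
          act M (g l) \<sigma> x - (\<Sum>b\<in>Q. of_real (q b) * (\<Prod>h\<in>S. act M (bracket g ?a b h l) (f' h) x))"
        by eventually_elim simp
      have "h l \<in> G" if "h \<in> insert g S" for h l using S(3) that by (intro cpm_G[of h 0]) blast
      then have "bracket g ?a b h l \<in> G" if "h \<in> S" for b h using that by (simp add: bracket_def)
      then have "(\<lambda>x. \<Prod>h\<in>S. act M (bracket g ?a b h l) (f' h) x) \<in> bdd M 1" for b
        by (intro bdd_prod act_bdd f'b)
      then have "(\<lambda>x. \<Sum>b\<in>Q. of_real (q b) * (\<Prod>h\<in>S. act M (bracket g ?a b h l) (f' h) x)) \<in> sq_int M"
        by (intro sq_int_sum bdd_sq_int(1))
      then show "(\<lambda>x. act M (g l) \<sigma> x - (\<Sum>b\<in>Q. of_real (q b) * (\<Prod>h\<in>S. act M (bracket g ?a b h l) (f' h) x))) \<in> borel_measurable M"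
        by (rule sq_intD[OF sq_int_diff[OF act_sq_int[OF gl \<sigma>s]]])
    qed (intro sq_intD sq_int_diff act_sq_int[OF gl] \<sigma>s X)
    finally show ?thesis .
  qed
  then show ?thesis unfolding structured_def using \<sigma>b Q f'b
    by (intro conjI exI[of _ ?a] exI[of _ Q] exI[of _ q] exI[of _ f'] allI impI ballI) simp_all
qed

text \<open>
  Expand the square of the norm of \<open>v\<close> as the average of the pairings of \<open>prodF S f n \<cdot> g n u\<close> with \<open>v\<close>, and
  move both \<open>prodF S f n\<close> and \<open>g n\<close> to the other side. The function \<open>h0\<close> is \<open>v\<close>, scaled to have bound 1.
\<close>

lemma average_pairing:
  assumes S: "finite S" "insert g S \<subseteq> cpm 0" and f: "\<And>h. h \<in> S \<Longrightarrow> f h \<in> bdd M 1"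
    and av: "averaging \<nu> a Z" and u: "u \<in> bdd M C" and C: "0 < C"
    and v: "is_mean M \<nu> a (\<lambda>n x. prodF S f n x * act M (g n) u x) v"
  shows "\<exists>h0\<in>bdd M 1. \<forall>\<sigma>. is_mean M \<nu> a (\<lambda>n. act M (inv\<^bsub>H\<^esub> (g n)) (\<lambda>x. h0 x * cnj (prodF S f n x))) \<sigma> \<longrightarrow>
    (nrm M v)\<^sup>2 \<le> C * cmod (ip M \<sigma> u)"
proof -
  have S0: "S \<subseteq> cpm 0" and g: "g \<in> cpm 0" using S(2) by simp_all
  have gG: "g n \<in> G" for n by (rule cpm_G[OF g])
  have us: "u \<in> sq_int M" by (rule bdd_sq_int(1)[OF u])
  have Pb: "prodF S f n \<in> bdd M 1" for n by (rule prodF_bdd[OF S0 f])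
  have gub: "act M (g n) u \<in> bdd M C" for n by (rule act_bdd[OF gG u])
  have F: "cont_bdd M (\<lambda>n x. prodF S f n x * act M (g n) u x) (1 * C)"
    by (rule cont_bdd_mult[OF prodF_cont_bdd[OF S(1) S0 f] Pb cont_bdd_act_bdd[OF g u] gub])
  have "(\<lambda>x. prodF S f n x * act M (g n) u x) \<in> bdd M C" for n using bdd_mult[OF Pb gub, of n n] by simp
  then have vb: "v \<in> bdd M C" by (rule is_mean_bdd[OF av F _ v])
  have vs: "v \<in> sq_int M" by (rule is_meanD(1)[OF v])
  define h0 where "h0 = (\<lambda>x. of_real (1 / C) * v x)"
  have h0: "h0 \<in> bdd M 1" using bdd_cmult[OF vb, of "of_real (1 / C)"] C unfolding h0_def by (simp add: norm_divide)
  have vh: "v = (\<lambda>x. of_real C * h0 x)" using C by (simp add: h0_def)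
  define \<psi> where "\<psi> n = act M (inv\<^bsub>H\<^esub> (g n)) (\<lambda>x. h0 x * cnj (prodF S f n x))" for n
  note d = dual_cont_bdd[OF S f h0]
  have \<psi>: "cont_bdd M \<psi> 1" using d(1) unfolding \<psi>_def .
  have point: "ip M (\<lambda>x. prodF S f n x * act M (g n) u x) v = of_real C * cnj (ip M (\<psi> n) u)" for n
  proof -
    let ?y = "\<lambda>x. h0 x * cnj (prodF S f n x)"
    have y: "?y \<in> sq_int M" by (rule bdd_sq_int(1)[OF d(2)])
    have "ip M (\<lambda>x. prodF S f n x * act M (g n) u x) v = ip M (act M (g n) u) (\<lambda>x. of_real C * ?y x)"
      unfolding ip_def by (subst vh) (simp add: mult_ac)
    also have "\<dots> = of_real C * ip M (act M (g n) u) ?y" by (simp add: ip_cmult_right)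
    also have "ip M (act M (g n) u) ?y = ip M (act M (g n) u) (act M (g n) (\<psi> n))"
    proof (rule ip_cong_AE)
      have "AE x in M. act M (g n) (\<psi> n) x = ?y x" unfolding \<psi>_def by (rule act_inv(1)[OF gG y])
      then show "AE x in M. ?y x = act M (g n) (\<psi> n) x" by eventually_elim simp
    qed (simp_all add: act_meas[OF gG us] act_meas[OF gG cont_bdd_sq_int[OF \<psi>]] sq_intD[OF y])
    also have "\<dots> = ip M u (\<psi> n)" by (rule act_ip[OF gG us cont_bdd_sq_int[OF \<psi>]])
    also have "\<dots> = cnj (ip M (\<psi> n) u)" by (rule ip_cnj)
    finally show ?thesis .
  qed
  have "(nrm M v)\<^sup>2 \<le> C * cmod (ip M \<sigma> u)" if \<sigma>: "is_mean M \<nu> a \<psi> \<sigma>" for \<sigma>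
  proof -
    have "ip M v v = (\<integral>n. of_real C * cnj (ip M (\<psi> (a + n)) u) \<partial>\<nu>)"
      unfolding is_meanD(2)[OF v vs] point ..
    also have "\<dots> = of_real C * cnj (\<integral>n. ip M (\<psi> (a + n)) u \<partial>\<nu>)"
      unfolding Bochner_Integration.integral_cnj[symmetric] by simp
    also have "\<dots> = of_real C * cnj (ip M \<sigma> u)" by (simp add: is_meanD(2)[OF \<sigma> us])
    finally have "cmod (ip M v v) = C * cmod (ip M \<sigma> u)" using C by (simp add: norm_mult)
    moreover have "cmod (ip M v v) = (nrm M v)\<^sup>2" unfolding ip_self norm_of_real by simp
    ultimately show ?thesis by simp
  qed
  then show ?thesis using h0 unfolding \<psi>_def[abs_def] by blast
qed

text \<open>Insert the approximation of the orbit of \<open>\<sigma>\<close>; each of its terms completes \<open>prodF S f\<close> to a product along a reduced system.\<close>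

lemma structured_gap:
  assumes S: "finite S" "insert g S \<subseteq> cpm 0" and f0: "\<forall>h\<in>S. f h \<in> bdd M 1"
    and \<sigma>: "structured g S Z m \<delta> \<sigma>" and \<delta>: "0 \<le> \<delta>"
  shows "\<exists>c Q q f2. finite Q \<and> (\<forall>b\<in>Q. 0 \<le> q b) \<and> sum q Q = 1 \<and>
    (\<forall>b\<in>Q. \<forall>h\<in>S \<union> bracket g c b ` S. f2 b h \<in> bdd M 1) \<and>
    (\<forall>\<nu> a k. k < m \<longrightarrow> (\<forall>s. averaging (\<nu> k s) (a k s) (Z k)) \<longrightarrow>
      gap \<nu> a k (\<lambda>n x. prodF S f n x * act M (g n) \<sigma> x) \<le>
        2 * \<delta> + (\<Sum>b\<in>Q. q b * gap \<nu> a k (prodF (S \<union> bracket g c b ` S) (f2 b))))"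
proof -
  note f = f0[rule_format]
  have S0: "S \<subseteq> cpm 0" and g: "g \<in> cpm 0" using S(2) by simp_all
  from \<sigma> obtain c Q q f1 where \<sigma>b: "\<sigma> \<in> bdd M 1" and Q: "finite Q" "\<forall>b\<in>Q. 0 \<le> q b" "sum q Q = 1"
    and f1: "\<forall>h\<in>S. f1 h \<in> bdd M 1" and close: "\<forall>k<m. \<forall>l\<in>Z k. nrm M (\<lambda>x. act M (g l) \<sigma> x -
      (\<Sum>b\<in>Q. of_real (q b) * (\<Prod>h\<in>S. act M (bracket g c b h l) (f1 h) x))) \<le> \<delta>"
    unfolding structured_def by (elim conjE exE)
  have "\<forall>b. \<exists>f2. (\<forall>k\<in>S \<union> bracket g c b ` S. f2 k \<in> bdd M 1) \<and>
    (\<forall>n. AE x in M. prodF (S \<union> bracket g c b ` S) f2 n x = prodF S f n x * (\<Prod>h\<in>S. act M (bracket g c b h n) (f1 h) x))"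
    by (intro allI prodF_collapse[OF S f]) (use f1 in simp_all)
  from choice[OF this] obtain f2 where f2: "\<forall>b. (\<forall>k\<in>S \<union> bracket g c b ` S. f2 b k \<in> bdd M 1) \<and>
    (\<forall>n. AE x in M. prodF (S \<union> bracket g c b ` S) (f2 b) n x = prodF S f n x * (\<Prod>h\<in>S. act M (bracket g c b h n) (f1 h) x))"
    by (elim exE)
  have red: "S \<union> bracket g c b ` S \<subseteq> cpm 0" for b
  proof -
    have "bracket g c b h \<in> cpm 0" if "h \<in> S" for h
      using bracket_level[OF g, of h c b] S0 that cpm_mult[of h 0] cpm_Suc[of 0] by force
    then show ?thesis using S0 by blast
  qed
  have cE: "cont_bdd M (prodF (S \<union> bracket g c b ` S) (f2 b)) 1" for b
    by (rule prodF_cont_bdd[OF _ red]) (use S(1) f2 in simp_all)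
  let ?E = "\<lambda>n x. \<Sum>b\<in>Q. of_real (q b) * prodF (S \<union> bracket g c b ` S) (f2 b) n x"
  have cE': "cont_bdd M ?E (\<Sum>b\<in>Q. cmod (of_real (q b)) * 1)" by (rule cont_bdd_sum[OF Q(1) cE])
  have gub: "act M (g n) \<sigma> \<in> bdd M 1" for n by (rule act_bdd[OF cpm_G[OF g] \<sigma>b])
  have Pb: "prodF S f n \<in> bdd M 1" for n by (rule prodF_bdd[OF S0 f])
  have cF: "cont_bdd M (\<lambda>n x. prodF S f n x * act M (g n) \<sigma> x) (1 * 1)"
    by (rule cont_bdd_mult[OF prodF_cont_bdd[OF S(1) S0 f] Pb cont_bdd_act_bdd[OF g \<sigma>b] gub])
  have near: "nrm M (\<lambda>x. prodF S f n x * act M (g n) \<sigma> x - ?E n x) \<le> \<delta>" if k: "k < m" and n: "n \<in> Z k" for k n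
  proof -
    let ?D = "\<lambda>x. act M (g n) \<sigma> x - (\<Sum>b\<in>Q. of_real (q b) * (\<Prod>h\<in>S. act M (bracket g c b h n) (f1 h) x))"
    have hG: "h l \<in> G" if "h \<in> insert g S" for h l using S(2) that by (intro cpm_G[of h 0]) blast
    then have bG: "bracket g c b h n \<in> G" if "h \<in> S" for b h using that by (simp add: bracket_def)
    have pb: "(\<lambda>x. \<Prod>h\<in>S. act M (bracket g c b h n) (f1 h) x) \<in> bdd M 1" for b
      by (intro bdd_prod act_bdd bG) (use f1 in simp_all)
    have D: "?D \<in> sq_int M" by (intro sq_int_diff sq_int_sum bdd_sq_int(1)[OF pb] bdd_sq_int(1)[OF gub])
    have "nrm M (\<lambda>x. prodF S f n x * act M (g n) \<sigma> x - ?E n x) = nrm M (\<lambda>x. prodF S f n x * ?D x)"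
    proof (rule nrm_cong_AE)
      have "AE x in M. \<forall>b\<in>Q. prodF (S \<union> bracket g c b ` S) (f2 b) n x =
          prodF S f n x * (\<Prod>h\<in>S. act M (bracket g c b h n) (f1 h) x)"
        by (rule AE_finite_allI[OF Q(1)]) (use f2 in blast)
      then show "AE x in M. prodF S f n x * act M (g n) \<sigma> x - ?E n x = prodF S f n x * ?D x"
      proof eventually_elim
        case (elim x)
        then have "?E n x = prodF S f n x * (\<Sum>b\<in>Q. of_real (q b) * (\<Prod>h\<in>S. act M (bracket g c b h n) (f1 h) x))"
          by (simp add: sum_distrib_left mult_ac)
        then show ?case by (simp only: right_diff_distrib)
      qed
      show "(\<lambda>x. prodF S f n x * act M (g n) \<sigma> x - ?E n x) \<in> borel_measurable M"
        by (rule sq_intD[OF sq_int_diff[OF cont_bdd_sq_int[OF cF] cont_bdd_sq_int[OF cE']]])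
      show "(\<lambda>x. prodF S f n x * ?D x) \<in> borel_measurable M"
        by (rule sq_intD[OF bdd_mult_sq_int(1)[OF Pb D]]) simp
    qed
    also have "\<dots> \<le> 1 * nrm M ?D" by (rule bdd_mult_sq_int(2)[OF Pb D]) simp
    also have "\<dots> \<le> \<delta>" using close k n by simp
    finally show ?thesis .
  qed
  have "gap \<nu> a k (\<lambda>n x. prodF S f n x * act M (g n) \<sigma> x) \<le>
        2 * \<delta> + (\<Sum>b\<in>Q. q b * gap \<nu> a k (prodF (S \<union> bracket g c b ` S) (f2 b)))"
    if k: "k < m" and ok: "\<forall>s. averaging (\<nu> k s) (a k s) (Z k)" for \<nu> a k
  proof -
    have "gap \<nu> a k (\<lambda>n x. prodF S f n x * act M (g n) \<sigma> x) \<le> gap \<nu> a k ?E + 2 * \<delta>"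
      by (rule gap_close[where \<nu>=\<nu> and k=k and a=a and Z=Z, OF spec[OF ok] cF cE' near[OF k] \<delta>])
    also have "gap \<nu> a k ?E \<le> (\<Sum>b\<in>Q. cmod (of_real (q b)) * gap \<nu> a k (prodF (S \<union> bracket g c b ` S) (f2 b)))"
      by (rule gap_sum[where \<nu>=\<nu> and k=k and a=a and Z=Z, OF spec[OF ok]]) (rule cE)
    also have "\<dots> = (\<Sum>b\<in>Q. q b * gap \<nu> a k (prodF (S \<union> bracket g c b ` S) (f2 b)))"
      by (rule sum.cong) (use Q(2) in simp_all)
    finally show ?thesis by simp
  qed
  then show ?thesis using Q f2 by (intro exI[of _ c] exI[of _ Q] exI[of _ q] exI[of _ f2] conjI allI impI ballI) simp_all
qed

end

context polynomial_system
begin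

text \<open>
  Long chains contain a pair of averages that are close to each other. The required length and accuracy
  depend on \<open>\<epsilon>\<close> and on the complexity only. This uniformity carries the induction, in which the functions and,
  through the parameters of the brackets, also the system depend on the chain.
\<close>

definition metastable :: "nat \<Rightarrow> bool" where
  "metastable c \<longleftrightarrow> (\<forall>\<epsilon>>0. \<exists>K. \<exists>\<delta>>0. \<forall>D \<nu> a Z S f. finite D \<longrightarrow> K \<le> card D \<longrightarrow> chain D \<delta> \<nu> a Z \<longrightarrow>
    finite S \<longrightarrow> S \<subseteq> cpm 0 \<longrightarrow> cplx (cpm 0) c S \<longrightarrow> (\<forall>h\<in>S. f h \<in> bdd M 1) \<longrightarrow> (\<exists>k\<in>D. gap \<nu> a k (prodF S f) < \<epsilon>))"

text \<open>
  Since chains can be thinned out, metastability bounds the number of steps with a large gap, so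
  that the average gap along a long chain is small.
\<close>

lemma gap_sum_le:
  fixes \<epsilon> :: real and K :: nat
  assumes meta: "\<And>D. finite D \<Longrightarrow> K \<le> card D \<Longrightarrow> chain D \<delta> \<nu> a Z \<Longrightarrow> \<exists>k\<in>D. gap \<nu> a k F < \<epsilon>"
    and F: "cont_bdd M F 1" and D: "finite D" "chain D \<delta> \<nu> a Z" and \<epsilon>: "0 < \<epsilon>"
  shows "(\<Sum>k\<in>D. gap \<nu> a k F) \<le> 2 * K + card D * \<epsilon>"
proof -
  define Bad where "Bad = {k\<in>D. \<epsilon> \<le> gap \<nu> a k F}"
  have Bad: "finite Bad" "Bad \<subseteq> D" using D(1) by (simp_all add: Bad_def)
  have "\<not> K \<le> card Bad"
  proof
    assume "K \<le> card Bad"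
    from meta[OF Bad(1) this chain_subset[OF D(2) Bad(2)]] show False by (auto simp: Bad_def)
  qed
  have "gap \<nu> a k F \<le> 2" if "k \<in> D" for k
    using gap_le[where \<nu>=\<nu> and a=a and k=k and Z=Z, OF chainD(1)[OF D(2) that] F] by simp
  then have "(\<Sum>k\<in>Bad. gap \<nu> a k F) \<le> (\<Sum>k\<in>Bad. 2)" using Bad(2) by (intro sum_mono) blast
  also have "\<dots> \<le> 2 * K" using \<open>\<not> K \<le> card Bad\<close> by simp
  finally have 1: "(\<Sum>k\<in>Bad. gap \<nu> a k F) \<le> 2 * K" .
  have "(\<Sum>k\<in>D - Bad. gap \<nu> a k F) \<le> (\<Sum>k\<in>D - Bad. \<epsilon>)" by (intro sum_mono) (auto simp: Bad_def)
  also have "\<dots> = card (D - Bad) * \<epsilon>" by simp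
  also have "\<dots> \<le> card D * \<epsilon>" using card_mono[OF D(1), of "D - Bad"] \<epsilon> by (intro mult_right_mono) simp_all
  finally have 2: "(\<Sum>k\<in>D - Bad. gap \<nu> a k F) \<le> card D * \<epsilon>" .
  have "(\<Sum>k\<in>D. gap \<nu> a k F) = (\<Sum>k\<in>D - Bad. gap \<nu> a k F) + (\<Sum>k\<in>Bad. gap \<nu> a k F)"
    by (rule sum.subset_diff[OF Bad(2) D(1)])
  with 1 2 show ?thesis by linarith
qed

lemma reduced_cpm:
  assumes "insert g S \<subseteq> cpm 0"
  shows "S \<union> bracket g c b ` S \<subseteq> cpm 0"
proof -
  have "bracket g c b h \<in> cpm 0" if h: "h \<in> S" for h
  proof -
    have hc: "h \<in> cpm 0" "g \<in> cpm 0" using assms h by blast+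
    from bracket_level[OF hc(2,1), of c b] obtain d where d: "d \<in> cpm (Suc 0)"
      "bracket g c b h = (\<lambda>n. h n \<otimes>\<^bsub>H\<^esub> d n)" by blast
    have "d \<in> cpm 0" using d(1) cpm_Suc by blast
    from cpm_mult[OF hc(1) this] show ?thesis unfolding d(2) .
  qed
  then show ?thesis using assms by blast
qed

text \<open>The gap is at most a convex combination of gaps along reduced systems, up to a small error.\<close>

lemma structured_gap_sum_le:
  fixes \<epsilon> \<delta> :: real and K :: nat
  assumes meta: "\<And>D \<nu> a Z S f. finite D \<Longrightarrow> K \<le> card D \<Longrightarrow> chain D \<delta>0 \<nu> a Z \<Longrightarrow> finite S \<Longrightarrow> S \<subseteq> cpm 0 \<Longrightarrow>
      cplx (cpm 0) c S \<Longrightarrow> (\<forall>h\<in>S. f h \<in> bdd M 1) \<Longrightarrow> \<exists>k\<in>D. gap \<nu> a k (prodF S f) < \<epsilon>"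
    and S: "finite S" "insert g S \<subseteq> cpm 0" and red: "\<And>a b. cplx (cpm 0) c (S \<union> bracket g a b ` S)"
    and f: "\<And>h. h \<in> S \<Longrightarrow> f h \<in> bdd M 1"
    and \<sigma>: "structured g S Z m \<delta> \<sigma>" and \<delta>: "0 \<le> \<delta>"
    and D: "D \<subseteq> {..<m}" "chain D \<delta>0 \<nu> a Z" and \<epsilon>: "0 < \<epsilon>"
  shows "(\<Sum>k\<in>D. gap \<nu> a k (\<lambda>n x. prodF S f n x * act M (g n) \<sigma> x)) \<le> card D * (2 * \<delta> + \<epsilon>) + 2 * K"
proof -
  have fin: "finite D" by (rule finite_subset[OF D(1)]) simp
  have "\<forall>h\<in>S. f h \<in> bdd M 1" using f by blast
  from structured_gap[OF S this \<sigma> \<delta>] obtain c' Q q f2 where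
    Q: "finite Q" "\<forall>b\<in>Q. 0 \<le> q b" "sum q Q = 1" and f2: "\<forall>b\<in>Q. \<forall>h\<in>S \<union> bracket g c' b ` S. f2 b h \<in> bdd M 1"
    and le: "\<forall>\<nu> a k. k < m \<longrightarrow> (\<forall>s. averaging (\<nu> k s) (a k s) (Z k)) \<longrightarrow>
      gap \<nu> a k (\<lambda>n x. prodF S f n x * act M (g n) \<sigma> x) \<le>
        2 * \<delta> + (\<Sum>b\<in>Q. q b * gap \<nu> a k (prodF (S \<union> bracket g c' b ` S) (f2 b)))"
    by (elim exE conjE)
  let ?F = "\<lambda>b. prodF (S \<union> bracket g c' b ` S) (f2 b)"
  have "(\<Sum>k\<in>D. gap \<nu> a k (\<lambda>n x. prodF S f n x * act M (g n) \<sigma> x)) \<le>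
      (\<Sum>k\<in>D. 2 * \<delta> + (\<Sum>b\<in>Q. q b * gap \<nu> a k (?F b)))"
  proof (rule sum_mono)
    fix k assume k: "k \<in> D"
    have "k < m" using D(1) k by blast
    moreover have "\<forall>s. averaging (\<nu> k s) (a k s) (Z k)" using chainD(1)[OF D(2) k] by blast
    ultimately show "gap \<nu> a k (\<lambda>n x. prodF S f n x * act M (g n) \<sigma> x) \<le>
        2 * \<delta> + (\<Sum>b\<in>Q. q b * gap \<nu> a k (?F b))" using le by blast
  qed
  also have "\<dots> = card D * (2 * \<delta>) + (\<Sum>b\<in>Q. q b * (\<Sum>k\<in>D. gap \<nu> a k (?F b)))"
    using sum.swap[of "\<lambda>k b. q b * gap \<nu> a k (?F b)" Q D] by (simp add: sum.distrib sum_distrib_left)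
  also have "(\<Sum>b\<in>Q. q b * (\<Sum>k\<in>D. gap \<nu> a k (?F b))) \<le> (\<Sum>b\<in>Q. q b * (2 * K + card D * \<epsilon>))"
  proof (rule sum_mono)
    fix b assume b: "b \<in> Q"
    have S': "finite (S \<union> bracket g c' b ` S)" using S(1) by simp
    have fb: "\<forall>h\<in>S \<union> bracket g c' b ` S. f2 b h \<in> bdd M 1" using f2 b by blast
    have "(\<Sum>k\<in>D. gap \<nu> a k (?F b)) \<le> 2 * K + card D * \<epsilon>"
    proof (rule gap_sum_le[OF _ _ fin D(2) \<epsilon>])
      show "cont_bdd M (?F b) 1" by (rule prodF_cont_bdd[OF S' reduced_cpm[OF S(2)]]) (use fb in blast)
      show "\<exists>k\<in>D. gap \<nu> a k (?F b) < \<epsilon>" if "finite D" "K \<le> card D" "chain D \<delta>0 \<nu> a Z" for D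
        by (rule meta[OF that S' reduced_cpm[OF S(2)] red fb])
    qed
    then show "q b * (\<Sum>k\<in>D. gap \<nu> a k (?F b)) \<le> q b * (2 * K + card D * \<epsilon>)"
      using Q(2) b by (intro mult_left_mono) simp_all
  qed
  also have "\<dots> = 2 * K + card D * \<epsilon>" using Q(3) by (simp flip: sum_distrib_right)
  finally show ?thesis by (simp add: algebra_simps)
qed

lemma harmonic_unbounded: "\<exists>R. x < (\<Sum>r<R. 1 / real (Suc r))"
proof -
  obtain n :: nat where n: "exp x < real n" using reals_Archimedean2 by blast
  have "x = ln (exp x)" by simp
  also have "\<dots> < ln (real n + 1)" using n by (subst ln_less_cancel_iff) simp_all
  also have "\<dots> \<le> harm n" by (rule ln_le_harm)
  also have "harm n = (\<Sum>r<n. 1 / real (Suc r))"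
    unfolding harm_def by (rule sum.reindex_bij_witness[of _ Suc "\<lambda>k. k - 1"]) (auto simp: inverse_eq_divide)
  finally show ?thesis by blast
qed

text \<open>
  The factor \<open>g n \<phi>\<close> is split off, and \<open>\<phi>\<close> is decomposed into a combination of structured functions and a
  remainder that is nearly orthogonal to all functions structured in the next stage. The averages with the
  remainder are small, since they pair it with dual averages, and these are structured. For a structured
  function the induction hypothesis applies. There it is essential that it bounds the average gap over a
  block of steps: as the coefficients of the combination are bounded independently of the block, one step of
  the block works for all terms.
\<close>

lemma metastable_step_aux:
  assumes meta: "metastable c" and \<epsilon>: "0 < \<epsilon>"
  shows "\<exists>K. \<exists>\<delta>>0. \<forall>\<nu> a Z S f g S'. chain {..<K} \<delta> \<nu> a Z \<longrightarrow> finite S' \<longrightarrow> fone \<in> S' \<longrightarrow> insert g S' \<subseteq> cpm 0 \<longrightarrow>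
    S \<subseteq> insert g S' \<longrightarrow> (\<forall>a b. cplx (cpm 0) c (S' \<union> bracket g a b ` S')) \<longrightarrow> (\<forall>h\<in>S. f h \<in> bdd M 1) \<longrightarrow>
    (\<exists>k<K. gap \<nu> a k (prodF S f) < \<epsilon>)"
proof -
  \<comment> \<open>With this \<open>\<kappa>\<close> the averages of the remainder, the squares of whose norms are at most \<open>9/2 sqrt \<kappa>\<close>, have norm at most \<open>\<epsilon> / 4\<close>.\<close>
  define \<kappa> where "\<kappa> = min 1 ((\<epsilon>\<^sup>2 / 72)\<^sup>2)"
  have \<kappa>: "0 < \<kappa>" "\<kappa> \<le> 1" using \<epsilon> by (simp_all add: \<kappa>_def)
  have sq\<kappa>: "sqrt \<kappa> \<le> \<epsilon>\<^sup>2 / 72" "\<kappa> \<le> sqrt \<kappa>"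
  proof -
    have "\<kappa> \<le> (\<epsilon>\<^sup>2 / 72)\<^sup>2" by (simp add: \<kappa>_def)
    from real_sqrt_le_mono[OF this] show "sqrt \<kappa> \<le> \<epsilon>\<^sup>2 / 72" by (simp only: real_sqrt_abs) simp
    have "\<kappa> = sqrt \<kappa> * sqrt \<kappa>" using \<kappa> by simp
    also have "\<dots> \<le> sqrt \<kappa> * 1" using \<kappa> by (intro mult_left_mono) simp_all
    finally show "\<kappa> \<le> sqrt \<kappa>" by simp
  qed
  obtain R where "1 / \<kappa> < (\<Sum>r<R. 1 / real (Suc r))" using harmonic_unbounded by blast
  then have R: "1 < \<kappa> * (\<Sum>r<R. 1 / real (Suc r))" using \<kappa> by (simp add: divide_less_eq mult.commute)
  define C where "C = 2 * sqrt \<kappa> * sqrt R"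
  have C: "0 \<le> C" using \<kappa> by (simp add: C_def)
  define \<epsilon>' where "\<epsilon>' = \<epsilon> / (8 * C + 8)"
  have \<epsilon>': "0 < \<epsilon>'" using \<epsilon> C by (simp add: \<epsilon>'_def)
  have C\<epsilon>: "C * (4 * \<epsilon>') < \<epsilon> / 2" using \<epsilon> C by (simp add: \<epsilon>'_def field_simps)
  from spec[OF meta[unfolded metastable_def], of \<epsilon>', THEN mp, OF \<epsilon>'] obtain K' \<delta>0 where \<delta>0: "0 < \<delta>0" and
    m0: "\<forall>D \<nu> a Z S f. finite D \<longrightarrow> K' \<le> card D \<longrightarrow> chain D \<delta>0 \<nu> a Z \<longrightarrow>
    finite S \<longrightarrow> S \<subseteq> cpm 0 \<longrightarrow> cplx (cpm 0) c S \<longrightarrow> (\<forall>h\<in>S. f h \<in> bdd M 1) \<longrightarrow> (\<exists>k\<in>D. gap \<nu> a k (prodF S f) < \<epsilon>')"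
    by (elim exE conjE)
  note m1 = m0[rule_format]
  have meta': "\<exists>k\<in>D. gap \<nu> a k (prodF S f) < \<epsilon>'" if "finite D" "K' \<le> card D" "chain D \<delta>0 \<nu> a Z" "finite S" "S \<subseteq> cpm 0"
    "cplx (cpm 0) c S" "\<forall>h\<in>S. f h \<in> bdd M 1" for D \<nu> a Z S f
    by (rule m1[OF that(1-6)]) (use that(7) in blast)
  obtain N :: nat where N: "2 * real K' / \<epsilon>' < real N" using reals_Archimedean2 by blast
  then have N': "2 * real K' < real N * \<epsilon>'" using \<epsilon>' by (simp add: divide_less_eq)
  have Npos: "0 < N"
  proof (rule ccontr)
    assume "\<not> 0 < N"
    then have "2 * real K' < 0" using N' by simp
    then show False by simp
  qed
  define K where "K = R * N"
  define \<delta> where "\<delta> = min \<delta>0 (\<epsilon>' / 2)"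
  have \<delta>: "0 < \<delta>" "\<delta> \<le> \<delta>0" "\<delta> \<le> \<epsilon>' / 2" using \<delta>0 \<epsilon>' by (simp_all add: \<delta>_def)
  have "\<exists>k<K. gap \<nu> a k (prodF S f) < \<epsilon>"
    if ch: "chain {..<K} \<delta> \<nu> a Z" and S': "finite S'" "fone \<in> S'" "insert g S' \<subseteq> cpm 0" and S: "S \<subseteq> insert g S'"
      and red: "\<forall>a b. cplx (cpm 0) c (S' \<union> bracket g a b ` S')" and f: "\<forall>h\<in>S. f h \<in> bdd M 1"
    for \<nu> a Z S f g S'
  proof -
    have red': "cplx (cpm 0) c (S' \<union> bracket g a b ` S')" for a b using red by blast
    have S'0: "S' \<subseteq> cpm 0" and g: "g \<in> cpm 0" using S'(3) by simp_all
    have gG: "g n \<in> G" for n by (rule cpm_G[OF g])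
    have one: "(\<lambda>x::'x. 1) \<in> bdd M 1" by (rule bdd_const) simp
    define f' where "f' h = (if h \<in> S then f h else (\<lambda>x. 1))" for h
    define \<phi> where "\<phi> = (if g \<in> S - S' then f g else (\<lambda>x. 1))"
    have f'b: "f' h \<in> bdd M 1" for h using f one by (simp add: f'_def)
    have \<phi>b: "\<phi> \<in> bdd M 1" using f one by (simp add: \<phi>_def)
    \<comment> \<open>Block \<open>r\<close> consists of the steps from \<open>m (r + 1)\<close> to \<open>m r\<close>. The blocks run backwards, because a dual average at a step is structured with respect to the earlier steps.\<close>
    define m where "m r = (R - r) * N" for r
    define \<Sigma> where "\<Sigma> r = {\<sigma>. structured g S' Z (m r) \<epsilon>' \<sigma>}" for r
    have mSuc: "m (Suc r) \<le> m r" for r unfolding m_def by (rule mult_le_mono1) simp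
    have \<Sigma>1: "\<Sigma> r \<subseteq> bdd M 1" for r using structured_bdd by (auto simp: \<Sigma>_def)
    have \<Sigma>2: "\<Sigma> r \<subseteq> \<Sigma> (Suc r)" for r
      unfolding \<Sigma>_def using structured_antimono[OF _ mSuc] by blast
    from energy_decomposition[of \<Sigma>, OF \<Sigma>1 \<Sigma>2 \<phi>b \<kappa>(1) R] obtain r w where r: "r < R"
      and w: "w \<in> comb (\<Sigma> r) (2 * sqrt \<kappa> * sqrt r)"
      and orth: "\<forall>\<sigma>\<in>\<Sigma> (Suc r). cmod (ip M \<sigma> (\<lambda>x. \<phi> x - w x)) \<le> 3 / 2 * sqrt (\<kappa> / Suc r)"
      by (elim exE conjE bexE)
    define Cr where "Cr = 2 * sqrt \<kappa> * sqrt (real r)"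
    have Cr: "0 \<le> Cr" "Cr \<le> C" using \<kappa> r by (simp_all add: Cr_def C_def mult_left_mono)
    define u where "u = (\<lambda>x. \<phi> x - w x)"
    have wb: "w \<in> bdd M Cr" using comb_bdd[OF w \<Sigma>1] by (simp add: Cr_def)
    have ub: "u \<in> bdd M (1 + Cr)" unfolding u_def by (rule bdd_diff[OF \<phi>b wb])
    have us: "u \<in> sq_int M" and ws: "w \<in> sq_int M" by (rule bdd_sq_int(1)[OF ub], rule bdd_sq_int(1)[OF wb])
    let ?F = "\<lambda>u n x. prodF S' f' n x * act M (g n) u x"
    have Pb: "prodF S' f' n \<in> bdd M 1" for n by (rule prodF_bdd[OF S'0 f'b])
    have cF: "cont_bdd M (?F v) C'" if "v \<in> bdd M C'" for v C'
      using cont_bdd_mult[OF prodF_cont_bdd[OF S'(1) S'0 f'b] Pb cont_bdd_act_bdd[OF g that] act_bdd[OF gG that]] by simp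
    define D where "D = {m (Suc r)..<m r}"
    have mK: "m r \<le> K" by (simp add: m_def K_def)
    have cardD: "card D = N"
    proof -
      have "R - r = Suc (R - Suc r)" using r by simp
      then show ?thesis by (simp add: D_def m_def)
    qed
    have DK: "D \<subseteq> {..<K}" "D \<subseteq> {..<m r}" using mK by (auto simp: D_def)
    have chD: "chain D \<delta>0 \<nu> a Z" by (rule chain_mono[OF chain_subset[OF ch DK(1)] \<delta>(2)])
    have ok: "averaging (\<nu> k s) (a k s) (Z k)" if "k \<in> D" for k s by (rule chainD(1)[OF chD that])
    \<comment> \<open>The nearly orthogonal part has small averages in this block.\<close>
    have small: "nrm M (avg (\<nu> k s) (a k s) (?F u)) \<le> \<epsilon> / 4" if k: "k \<in> D" for k s
    proof -
      have mean: "is_mean M (\<nu> k s) (a k s) (?F u) (avg (\<nu> k s) (a k s) (?F u))" by (rule avg_is_mean[OF cF[OF ub] ok[OF k]])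
      have "0 < 1 + Cr" using Cr by simp
      from average_pairing[OF S'(1,3) f'b ok[OF k] ub this mean] obtain h0 where h0: "h0 \<in> bdd M 1" and
        pair: "\<forall>\<sigma>. is_mean M (\<nu> k s) (a k s) (\<lambda>n. act M (inv\<^bsub>H\<^esub> (g n)) (\<lambda>x. h0 x * cnj (prodF S' f' n x))) \<sigma> \<longrightarrow>
          (nrm M (avg (\<nu> k s) (a k s) (?F u)))\<^sup>2 \<le> (1 + Cr) * cmod (ip M \<sigma> u)" by (elim bexE)
      from mean_exists[OF dual_cont_bdd(1)[where f=f', OF S'(1,3) f'b h0] ok[OF k, of s]] obtain \<sigma> where
        \<sigma>: "is_mean M (\<nu> k s) (a k s) (\<lambda>n. act M (inv\<^bsub>H\<^esub> (g n)) (\<lambda>x. h0 x * cnj (prodF S' f' n x))) \<sigma>" by (elim exE)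
      have kK: "k < K" "m (Suc r) \<le> k" using k DK(1) by (auto simp: D_def)
      have "structured g S' Z (m (Suc r)) (2 * (\<epsilon>' / 2)) \<sigma>"
        using \<epsilon>' by (intro dual_structured[OF S'(1,2,3) f'b h0 chain_mono[OF ch \<delta>(3)] kK _ \<sigma>]) simp
      then have "\<sigma> \<in> \<Sigma> (Suc r)" by (simp add: \<Sigma>_def)
      then have small: "cmod (ip M \<sigma> u) \<le> 3 / 2 * sqrt (\<kappa> / Suc r)" using orth unfolding u_def by blast
      have "(nrm M (avg (\<nu> k s) (a k s) (?F u)))\<^sup>2 \<le> (1 + Cr) * cmod (ip M \<sigma> u)" using pair \<sigma> by blast
      also have "\<dots> \<le> (1 + Cr) * (3 / 2 * sqrt (\<kappa> / Suc r))" using small Cr by (intro mult_left_mono) simp_all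
      also have "\<dots> = 3 / 2 * (sqrt (\<kappa> / Suc r) + Cr * sqrt (\<kappa> / Suc r))" by (simp add: algebra_simps)
      also have "\<dots> \<le> 3 / 2 * (sqrt \<kappa> + 2 * \<kappa>)"
      proof (intro mult_left_mono add_mono)
        show "sqrt (\<kappa> / Suc r) \<le> sqrt \<kappa>" using \<kappa> by (simp add: divide_le_eq)
        have "Cr * sqrt (\<kappa> / Suc r) = 2 * (sqrt \<kappa> * sqrt \<kappa>) * sqrt (r / Suc r)"
          by (simp add: Cr_def real_sqrt_divide)
        also have "\<dots> \<le> 2 * (sqrt \<kappa> * sqrt \<kappa>) * 1" using \<kappa> by (intro mult_left_mono) simp_all
        finally show "Cr * sqrt (\<kappa> / Suc r) \<le> 2 * \<kappa>" using \<kappa> by simp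
      qed simp
      also have "\<dots> \<le> 9 / 2 * sqrt \<kappa>" using sq\<kappa>(2) by simp
      also have "\<dots> \<le> \<epsilon>\<^sup>2 / 16" using sq\<kappa>(1) by simp
      also have "\<dots> = (\<epsilon> / 4)\<^sup>2" by (simp add: power_divide)
      finally show ?thesis by (rule power2_le_imp_le) (use \<epsilon> in simp)
    qed
    \<comment> \<open>The structured part has a small gap at some step of this block.\<close>
    obtain T lam where T: "finite T" "T \<subseteq> \<Sigma> r" "(\<Sum>\<sigma>\<in>T. cmod (lam \<sigma>)) \<le> Cr" and wT: "w = (\<lambda>x. \<Sum>\<sigma>\<in>T. lam \<sigma> * \<sigma> x)"
      using w unfolding Cr_def[symmetric] by (rule combE)
    have \<sigma>b: "\<sigma> \<in> bdd M 1" if "\<sigma> \<in> T" for \<sigma> using that T(2) \<Sigma>1 by blast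
    have gapw: "gap \<nu> a k (?F w) \<le> (\<Sum>\<sigma>\<in>T. cmod (lam \<sigma>) * gap \<nu> a k (?F \<sigma>))" if k: "k \<in> D" for k
    proof -
      have cs: "cont_bdd M (\<lambda>n x. \<Sum>\<sigma>\<in>T. lam \<sigma> * ?F \<sigma> n x) (\<Sum>\<sigma>\<in>T. cmod (lam \<sigma>) * 1)"
        by (rule cont_bdd_sum[OF T(1)]) (rule cF[OF \<sigma>b])
      have "gap \<nu> a k (?F w) = gap \<nu> a k (\<lambda>n x. \<Sum>\<sigma>\<in>T. lam \<sigma> * ?F \<sigma> n x)"
      proof (rule gap_cong[where \<nu>=\<nu> and a=a and k=k and Z=Z, OF ok[OF k] cs])
        fix n
        have "AE x in M. act M (g n) w x = (\<Sum>\<sigma>\<in>T. lam \<sigma> * act M (g n) \<sigma> x)"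
          unfolding wT by (rule act_sum[OF gG]) (rule bdd_sq_int(1)[OF \<sigma>b])
        then show "AE x in M. (\<Sum>\<sigma>\<in>T. lam \<sigma> * ?F \<sigma> n x) = ?F w n x"
          by eventually_elim (simp add: sum_distrib_left mult_ac)
        show "?F w n \<in> borel_measurable M" by (rule sq_intD[OF cont_bdd_sq_int[OF cF[OF wb]]])
      qed
      also have "\<dots> \<le> (\<Sum>\<sigma>\<in>T. cmod (lam \<sigma>) * gap \<nu> a k (?F \<sigma>))"
        by (rule gap_sum[where \<nu>=\<nu> and a=a and k=k and Z=Z, OF ok[OF k]]) (rule cF[OF \<sigma>b])
      finally show ?thesis .
    qed
    have "\<exists>k\<in>D. gap \<nu> a k (?F w) < \<epsilon> / 2"
    proof (rule ccontr)
      assume "\<not> (\<exists>k\<in>D. gap \<nu> a k (?F w) < \<epsilon> / 2)"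
      then have "(\<Sum>k\<in>D. \<epsilon> / 2) \<le> (\<Sum>k\<in>D. gap \<nu> a k (?F w))" by (intro sum_mono) (simp add: not_less)
      also have "\<dots> \<le> (\<Sum>k\<in>D. \<Sum>\<sigma>\<in>T. cmod (lam \<sigma>) * gap \<nu> a k (?F \<sigma>))" by (rule sum_mono) (rule gapw)
      also have "\<dots> = (\<Sum>\<sigma>\<in>T. cmod (lam \<sigma>) * (\<Sum>k\<in>D. gap \<nu> a k (?F \<sigma>)))"
        using sum.swap[of "\<lambda>k \<sigma>. cmod (lam \<sigma>) * gap \<nu> a k (?F \<sigma>)" T D] by (simp add: sum_distrib_left)
      also have "\<dots> \<le> (\<Sum>\<sigma>\<in>T. cmod (lam \<sigma>) * (N * (4 * \<epsilon>')))"
      proof (intro sum_mono mult_left_mono)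
        fix \<sigma> assume "\<sigma> \<in> T"
        then have \<sigma>: "structured g S' Z (m r) \<epsilon>' \<sigma>" using T(2) unfolding \<Sigma>_def by blast
        have "(\<Sum>k\<in>D. gap \<nu> a k (?F \<sigma>)) \<le> card D * (2 * \<epsilon>' + \<epsilon>') + 2 * K'"
          by (rule structured_gap_sum_le[where f=f', OF meta' S'(1,3) red' f'b \<sigma> less_imp_le[OF \<epsilon>'] DK(2) chD \<epsilon>'])
        also have "\<dots> \<le> N * (4 * \<epsilon>')" using N' by (simp add: cardD algebra_simps)
        finally show "(\<Sum>k\<in>D. gap \<nu> a k (?F \<sigma>)) \<le> N * (4 * \<epsilon>')" .
      qed simp
      also have "\<dots> = (\<Sum>\<sigma>\<in>T. cmod (lam \<sigma>)) * (N * (4 * \<epsilon>'))" by (simp add: sum_distrib_right)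
      also have "\<dots> \<le> C * (N * (4 * \<epsilon>'))" using T(3) Cr \<epsilon>' by (intro mult_right_mono) simp_all
      also have "\<dots> = N * (C * (4 * \<epsilon>'))" by simp
      also have "\<dots> < N * (\<epsilon> / 2)" using C\<epsilon> Npos by (intro mult_strict_left_mono) simp_all
      finally show False by (simp add: cardD)
    qed
    then obtain k where k: "k \<in> D" and gw: "gap \<nu> a k (?F w) < \<epsilon> / 2" by blast
    have "gap \<nu> a k (prodF S f) = gap \<nu> a k (\<lambda>n x. ?F w n x + ?F u n x)"
    proof (rule gap_cong[where \<nu>=\<nu> and a=a and k=k and Z=Z, OF ok[OF k] cont_bdd_add[OF cF[OF wb] cF[OF ub]]])
      fix n
      have "AE x in M. act M (g n) (\<lambda>x. w x + u x) x = act M (g n) w x + act M (g n) u x"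
        by (rule act_add[OF gG ws us])
      moreover have "(\<lambda>x. w x + u x) = \<phi>" by (simp add: u_def)
      moreover have "AE x in M. prodF S f n x = prodF S' f' n x * act M (g n) \<phi> x"
        using prodF_split[OF S'(1) S S'(3), of f n] unfolding f'_def[abs_def] \<phi>_def .
      ultimately show "AE x in M. ?F w n x + ?F u n x = prodF S f n x"
      proof -
        assume a1: "AE x in M. act M (g n) (\<lambda>x. w x + u x) x = act M (g n) w x + act M (g n) u x"
          and a2: "(\<lambda>x. w x + u x) = \<phi>" and a3: "AE x in M. prodF S f n x = prodF S' f' n x * act M (g n) \<phi> x"
        show ?thesis using a1[unfolded a2] a3 by eventually_elim (simp add: distrib_left)
      qed
      have "S \<subseteq> cpm 0" using S S'(3) by blast
      then have "prodF S f n \<in> bdd M 1" by (rule prodF_bdd) (use f in blast)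
      then show "prodF S f n \<in> borel_measurable M" by (rule bddD)
    qed
    also have "\<dots> \<le> gap \<nu> a k (?F w) + 2 * (\<epsilon> / 4)"
      by (rule gap_add_small[where \<nu>=\<nu> and a=a and k=k and Z=Z, OF ok[OF k] cF[OF wb] cF[OF ub] small[OF k]])
    finally have "gap \<nu> a k (prodF S f) < \<epsilon>" using gw by simp
    moreover have "k < K" using k DK(1) by blast
    ultimately show ?thesis by blast
  qed
  note step = this
  show ?thesis
    by (rule exI[of _ K], rule exI[of _ \<delta>], intro conjI allI impI) (rule \<delta>(1), (rule step; assumption))
qed

lemma increasing_enumeration:
  assumes "finite (D::nat set)" "K \<le> card D"
  shows "\<exists>e. (\<forall>i<K. e i \<in> D) \<and> (\<forall>i<K. \<forall>k<i. e k < e i)"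
proof -
  let ?l = "sorted_list_of_set D"
  have len: "length ?l = card D" using assms(1) by simp
  have "?l ! i \<in> D" if "i < K" for i
    using nth_mem[of i ?l] that assms len by simp
  moreover have "?l ! k < ?l ! i" if "i < K" "k < i" for i k
    using sorted_wrt_nth_less[OF strict_sorted_list_of_set[of D] that(2)] that(1) len assms(2) by simp
  ultimately show ?thesis by (intro exI[of _ "\<lambda>i. ?l ! i"]) simp
qed

lemma metastable_Suc:
  assumes meta: "metastable c"
  shows "metastable (Suc c)"
  unfolding metastable_def
proof (intro allI impI)
  fix \<epsilon> :: real assume "0 < \<epsilon>"
  from metastable_step_aux[OF meta this] obtain K \<delta> where \<delta>: "0 < \<delta>" and
    step: "\<forall>\<nu> a Z S f g S'. chain {..<K} \<delta> \<nu> a Z \<longrightarrow> finite S' \<longrightarrow> fone \<in> S' \<longrightarrow> insert g S' \<subseteq> cpm 0 \<longrightarrow>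
    S \<subseteq> insert g S' \<longrightarrow> (\<forall>a b. cplx (cpm 0) c (S' \<union> bracket g a b ` S')) \<longrightarrow> (\<forall>h\<in>S. f h \<in> bdd M 1) \<longrightarrow>
    (\<exists>k<K. gap \<nu> a k (prodF S f) < \<epsilon>)" by (elim exE conjE)
  have "\<exists>k\<in>D. gap \<nu> a k (prodF S f) < \<epsilon>"
    if D: "finite D" "K \<le> card D" and ch: "chain D \<delta> \<nu> a Z" and cp: "cplx (cpm 0) (Suc c) S"
      and f: "\<forall>h\<in>S. f h \<in> bdd M 1" for D \<nu> a Z S f
  proof -
    from increasing_enumeration[OF D] obtain e where e: "\<forall>i<K. e i \<in> D" "\<forall>i<K. \<forall>k<i. e k < e i" by (elim exE conjE)
    from cp obtain g S' where S': "finite S'" "fone \<in> S'" "insert g S' \<subseteq> cpm 0" "S \<subseteq> insert g S'"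
      "\<forall>a b. cplx (cpm 0) c (S' \<union> bracket g a b ` S')" unfolding cplx.simps by (elim exE conjE)
    have "chain {..<K} \<delta> (\<nu> \<circ> e) (a \<circ> e) (Z \<circ> e)"
      unfolding chain_def
    proof (intro ballI allI conjI impI)
      fix k s assume "k \<in> {..<K}"
      then have k: "k < K" "e k \<in> D" using e by simp_all
      show "averaging ((\<nu> \<circ> e) k s) ((a \<circ> e) k s) ((Z \<circ> e) k)" using chainD(1)[OF ch k(2)] by simp
      fix i l assume "i \<in> {..<K}" "i < k" "l \<in> (Z \<circ> e) i"
      then show "inv_under ((\<nu> \<circ> e) k s) \<delta> l" using chainD(2)[OF ch k(2), of "e i" l s] e k by simp
    qed
    then have "\<exists>k<K. gap (\<nu> \<circ> e) (a \<circ> e) k (prodF S f) < \<epsilon>"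
      by (intro step[rule_format, OF _ S'(1-4)]) (use S'(5) f in simp_all)
    then obtain k where "k < K" "gap (\<nu> \<circ> e) (a \<circ> e) k (prodF S f) < \<epsilon>" by blast
    then show ?thesis using e by (intro bexI[of _ "e k"]) (simp_all add: gap_def)
  qed
  note step' = this
  show "\<exists>K. \<exists>\<delta>>0. \<forall>D \<nu> a Z S f. finite D \<longrightarrow> K \<le> card D \<longrightarrow> chain D \<delta> \<nu> a Z \<longrightarrow>
    finite S \<longrightarrow> S \<subseteq> cpm 0 \<longrightarrow> cplx (cpm 0) (Suc c) S \<longrightarrow> (\<forall>h\<in>S. f h \<in> bdd M 1) \<longrightarrow> (\<exists>k\<in>D. gap \<nu> a k (prodF S f) < \<epsilon>)"
    by (rule exI[of _ K], rule exI[of _ \<delta>], intro conjI allI impI) (rule \<delta>, (rule step'; assumption))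
qed

lemma metastable_0: "metastable 0"
  unfolding metastable_def
proof (intro allI impI)
  fix \<epsilon> :: real assume \<epsilon>: "0 < \<epsilon>"
  have "\<exists>k\<in>D. gap \<nu> a k (prodF S f) < \<epsilon>"
    if D: "finite D" "1 \<le> card D" and ch: "chain D 1 \<nu> a Z" and S: "S \<subseteq> {fone}" "S \<subseteq> cpm 0"
      and f: "\<forall>h\<in>S. f h \<in> bdd M 1" for D \<nu> a Z S f
  proof -
    have "D \<noteq> {}" using D(2) by auto
    then obtain k where k: "k \<in> D" by blast
    define v where "v = prodF S f 0"
    have const: "prodF S f n = v" for n
      unfolding v_def prodF_def
    proof (intro ext prod.cong refl)
      fix x h assume "h \<in> S"
      then have "h = fone" using S(1) by blast
      then show "act M (h n) (f h) x = act M (h 0) (f h) x" by (simp only:)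
    qed
    have vs: "v \<in> sq_int M" unfolding v_def by (rule bdd_sq_int(1)[OF prodF_bdd[OF S(2)]]) (use f in blast)
    have mean: "is_mean M (\<nu> k s) (a k s) (prodF S f) v" for s
    proof -
      interpret \<nu>: prob_space "\<nu> k s" using chainD(1)[OF ch k] by (simp add: averaging_def)
      show ?thesis unfolding is_mean_def const using vs by (simp add: \<nu>.prob_space)
    qed
    have "gap \<nu> a k (prodF S f) = 0" using gap_eq[of \<nu> k a, OF mean mean] by simp
    then show ?thesis using k \<epsilon> by (intro bexI[of _ k]) simp_all
  qed
  note base = this
  show "\<exists>K. \<exists>\<delta>>0. \<forall>D \<nu> a Z S f. finite D \<longrightarrow> K \<le> card D \<longrightarrow> chain D \<delta> \<nu> a Z \<longrightarrow>
    finite S \<longrightarrow> S \<subseteq> cpm 0 \<longrightarrow> cplx (cpm 0) 0 S \<longrightarrow> (\<forall>h\<in>S. f h \<in> bdd M 1) \<longrightarrow> (\<exists>k\<in>D. gap \<nu> a k (prodF S f) < \<epsilon>)"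
    unfolding cplx.simps
    by (rule exI[of _ 1], rule exI[of _ 1], intro conjI allI impI) (rule zero_less_one, (rule base; assumption))
qed

theorem metastable_all: "metastable c"
  by (induction c) (rule metastable_0, rule metastable_Suc)

end

section \<open>The limit of the averages\<close>

context polynomial_system
begin

text \<open>
  If two nearly invariant averages could always be far apart, then choosing such pairs one after the
  other, each nearly invariant under all arguments used before, would give long chains with large gaps.
\<close>

lemma averages_close:
  assumes S: "finite S" "S \<subseteq> cpm 0" and f: "\<forall>h\<in>S. f h \<in> bdd M 1" and \<epsilon>: "0 < \<epsilon>"
  shows "\<exists>L. \<exists>\<delta>>0. compact L \<and> (\<forall>\<nu> a Z. (\<forall>s. averaging (\<nu> s) (a s) Z) \<longrightarrow>
    (\<forall>s. \<forall>l\<in>L. inv_under (\<nu> s) \<delta> l) \<longrightarrow>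
    nrm M (\<lambda>x. avg (\<nu> True) (a True) (prodF S f) x - avg (\<nu> False) (a False) (prodF S f) x) < \<epsilon>)"
proof -
  from bounded_cplx_all[of 0, unfolded bounded_cplx_def, rule_format, of "card S"] obtain c where
    c0: "\<forall>S'. finite S' \<longrightarrow> card S' \<le> card S \<longrightarrow> S' \<subseteq> cpm 0 \<longrightarrow> cplx (cpm 0) c S'" by (elim exE)
  have c: "cplx (cpm 0) c S" by (rule c0[rule_format, OF S(1) order_refl S(2)])
  from spec[OF metastable_all[of c, unfolded metastable_def], of \<epsilon>, THEN mp, OF \<epsilon>] obtain K \<delta> where \<delta>: "0 < \<delta>" and
    meta: "\<forall>D \<nu> a Z S f. finite D \<longrightarrow> K \<le> card D \<longrightarrow> chain D \<delta> \<nu> a Z \<longrightarrow>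
    finite S \<longrightarrow> S \<subseteq> cpm 0 \<longrightarrow> cplx (cpm 0) c S \<longrightarrow> (\<forall>h\<in>S. f h \<in> bdd M 1) \<longrightarrow> (\<exists>k\<in>D. gap \<nu> a k (prodF S f) < \<epsilon>)"
    by (elim exE conjE)
  define bad where "bad L \<nu> a Z \<longleftrightarrow> (\<forall>s. averaging (\<nu> s) (a s) Z) \<and> (\<forall>s. \<forall>l\<in>L. inv_under (\<nu> s) \<delta> l) \<and>
    \<epsilon> \<le> nrm M (\<lambda>x. avg (\<nu> True) (a True) (prodF S f) x - avg (\<nu> False) (a False) (prodF S f) x)"
    for L and \<nu> :: "bool \<Rightarrow> 'g measure" and a Z
  have "\<exists>L. compact L \<and> (\<forall>\<nu> a Z. \<not> bad L \<nu> a Z)"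
  proof (rule ccontr)
    assume "\<not> (\<exists>L. compact L \<and> (\<forall>\<nu> a Z. \<not> bad L \<nu> a Z))"
    then have "\<forall>L. \<exists>p. compact L \<longrightarrow> bad L (fst p) (fst (snd p)) (snd (snd p))" by auto
    from choice[OF this] obtain p where p: "\<forall>L. compact L \<longrightarrow> bad L (fst (p L)) (fst (snd (p L))) (snd (snd (p L)))"
      by (elim exE)
    define Ls where "Ls = rec_nat {} (\<lambda>_ L. L \<union> snd (snd (p L)))"
    have Ls_Suc: "Ls (Suc k) = Ls k \<union> snd (snd (p (Ls k)))" for k by (simp add: Ls_def)
    have Ls: "compact (Ls k)" for k
    proof (induction k)
      case (Suc k)
      then have "bad (Ls k) (fst (p (Ls k))) (fst (snd (p (Ls k)))) (snd (snd (p (Ls k))))" using p by blast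
      then have "compact (snd (snd (p (Ls k))))" by (simp add: bad_def averaging_def)
      then show ?case unfolding Ls_Suc using Suc by (rule compact_Un[rotated])
    qed (simp add: Ls_def)
    have Ls_mono: "Ls i \<subseteq> Ls k" if "i \<le> k" for i k
      using that by (induction rule: dec_induct) (use Ls_Suc in blast)+
    define \<nu> where "\<nu> k = fst (p (Ls k))" for k
    define a where "a k = fst (snd (p (Ls k)))" for k
    define Z where "Z k = snd (snd (p (Ls k)))" for k
    have b: "bad (Ls k) (\<nu> k) (a k) (Z k)" for k using p Ls unfolding \<nu>_def a_def Z_def by blast
    have Z: "Z i \<subseteq> Ls k" if "i < k" for i k
      using Ls_mono[of "Suc i" k] that unfolding Ls_Suc Z_def by auto
    have "chain {..<K} \<delta> \<nu> a Z" unfolding chain_def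
    proof (intro ballI allI conjI impI)
      fix k s show "averaging (\<nu> k s) (a k s) (Z k)" using b[of k] by (simp add: bad_def)
      fix i l assume "i < k" "l \<in> Z i"
      then have "l \<in> Ls k" using Z by blast
      then show "inv_under (\<nu> k s) \<delta> l" using b[of k] by (simp add: bad_def)
    qed
    from meta[rule_format, OF _ _ this S c] f obtain k where k: "gap \<nu> a k (prodF S f) < \<epsilon>" by auto
    have "\<epsilon> \<le> gap \<nu> a k (prodF S f)" using b[of k] by (simp add: bad_def gap_def)
    with k show False by simp
  qed
  then obtain L where L: "compact L" "\<forall>\<nu> a Z. \<not> bad L \<nu> a Z" by (elim exE conjE)
  show ?thesis
  proof (intro exI[of _ L] exI[of _ \<delta>] conjI allI impI \<delta> L(1))
    fix \<nu> :: "bool \<Rightarrow> 'g measure" and a Z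
    assume "\<forall>s. averaging (\<nu> s) (a s) Z" "\<forall>s. \<forall>l\<in>L. inv_under (\<nu> s) \<delta> l"
    then show "nrm M (\<lambda>x. avg (\<nu> True) (a True) (prodF S f) x - avg (\<nu> False) (a False) (prodF S f) x) < \<epsilon>"
      using L(2) unfolding bad_def not_le[symmetric] by blast
  qed
qed

lemma averaging_mono: "averaging \<nu> a Z \<Longrightarrow> Z \<subseteq> Z' \<Longrightarrow> compact Z' \<Longrightarrow> averaging \<nu> a Z'"
  unfolding averaging_def by (auto elim: eventually_mono)

definition nearly_invariant :: "'g set \<Rightarrow> real \<Rightarrow> 'g measure \<Rightarrow> 'g \<Rightarrow> 'g set \<Rightarrow> bool" where
  "nearly_invariant L \<delta> \<nu> a Z \<longleftrightarrow> averaging \<nu> a Z \<and> (\<forall>l\<in>L. inv_under \<nu> \<delta> l)"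

lemma nearly_invariant_mono:
  "nearly_invariant L \<delta> \<nu> a Z \<Longrightarrow> L' \<subseteq> L \<Longrightarrow> \<delta> \<le> \<delta>' \<Longrightarrow> nearly_invariant L' \<delta>' \<nu> a Z"
  unfolding nearly_invariant_def using inv_under_mono by blast

lemma nearly_invariant_close:
  assumes "finite S" "S \<subseteq> cpm 0" "\<forall>h\<in>S. f h \<in> bdd M 1" "0 < \<epsilon>"
  shows "\<exists>L. \<exists>\<delta>>0. compact L \<and> (\<forall>\<nu> a Z \<nu>' a' Z'. nearly_invariant L \<delta> \<nu> a Z \<longrightarrow> nearly_invariant L \<delta> \<nu>' a' Z' \<longrightarrow>
    nrm M (\<lambda>x. avg \<nu> a (prodF S f) x - avg \<nu>' a' (prodF S f) x) < \<epsilon>)"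
proof -
  from averages_close[OF assms] obtain L \<delta> where L: "0 < \<delta>" "compact L" and
    cl: "\<forall>\<nu> a Z. (\<forall>s. averaging (\<nu> s) (a s) Z) \<longrightarrow> (\<forall>s. \<forall>l\<in>L. inv_under (\<nu> s) \<delta> l) \<longrightarrow>
    nrm M (\<lambda>x. avg (\<nu> True) (a True) (prodF S f) x - avg (\<nu> False) (a False) (prodF S f) x) < \<epsilon>" by (elim exE conjE)
  show ?thesis
  proof (intro exI[of _ L] exI[of _ \<delta>] conjI allI impI L)
    fix \<nu> a Z \<nu>' a' Z'
    assume n: "nearly_invariant L \<delta> \<nu> a Z" "nearly_invariant L \<delta> \<nu>' a' Z'"
    let ?\<nu> = "\<lambda>s. if s then \<nu> else \<nu>'" and ?a = "\<lambda>s. if s then a else a'"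
    have "compact (Z \<union> Z')" using n by (intro compact_Un) (simp_all add: nearly_invariant_def averaging_def)
    then have "\<forall>s. averaging (?\<nu> s) (?a s) (Z \<union> Z')"
      using n averaging_mono[of \<nu> a Z "Z \<union> Z'"] averaging_mono[of \<nu>' a' Z' "Z \<union> Z'"]
      by (simp add: nearly_invariant_def)
    moreover have "\<forall>s. \<forall>l\<in>L. inv_under (?\<nu> s) \<delta> l" using n by (simp add: nearly_invariant_def)
    ultimately have "nrm M (\<lambda>x. avg (?\<nu> True) (?a True) (prodF S f) x - avg (?\<nu> False) (?a False) (prodF S f) x) < \<epsilon>"
      using spec[OF spec[OF spec[OF cl, of ?\<nu>], of ?a], of "Z \<union> Z'"] by blast
    then show "nrm M (\<lambda>x. avg \<nu> a (prodF S f) x - avg \<nu>' a' (prodF S f) x) < \<epsilon>" by simp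
  qed
qed

text \<open>
  The averages form a Cauchy net with respect to the invariance that is demanded. If some demand cannot be
  met, every vector is a limit.
\<close>

theorem averages_limit:
  assumes S: "finite S" "S \<subseteq> cpm 0" and f: "\<forall>h\<in>S. f h \<in> bdd M 1"
  shows "\<exists>v\<in>sq_int M. \<forall>\<epsilon>>0. \<exists>L. \<exists>\<delta>>0. compact L \<and> (\<forall>\<nu> a Z. nearly_invariant L \<delta> \<nu> a Z \<longrightarrow>
    nrm M (\<lambda>x. avg \<nu> a (prodF S f) x - v x) < \<epsilon>)"
proof (cases "\<forall>L. \<forall>\<delta>>0. compact L \<longrightarrow> (\<exists>\<nu> a Z. nearly_invariant L \<delta> \<nu> a Z)")
  case False
  then obtain L \<delta> where "0 < \<delta>" "compact L" "\<And>\<nu> a Z. \<not> nearly_invariant L \<delta> \<nu> a Z" by blast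
  then show ?thesis using sq_int_zero by blast
next
  case True
  let ?F = "prodF S f"
  have "\<forall>i. \<exists>p. 0 < snd p \<and> compact (fst p) \<and> (\<forall>\<nu> a Z \<nu>' a' Z'.
    nearly_invariant (fst p) (snd p) \<nu> a Z \<longrightarrow> nearly_invariant (fst p) (snd p) \<nu>' a' Z' \<longrightarrow>
    nrm M (\<lambda>x. avg \<nu> a ?F x - avg \<nu>' a' ?F x) < 1 / real (Suc i))"
  proof
    fix i
    have "0 < 1 / real (Suc i)" by simp
    from nearly_invariant_close[OF S f this] obtain L \<delta> where "0 < \<delta>" "compact L" "\<forall>\<nu> a Z \<nu>' a' Z'.
      nearly_invariant L \<delta> \<nu> a Z \<longrightarrow> nearly_invariant L \<delta> \<nu>' a' Z' \<longrightarrow>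
      nrm M (\<lambda>x. avg \<nu> a ?F x - avg \<nu>' a' ?F x) < 1 / real (Suc i)" by (elim exE conjE)
    then show "\<exists>p. 0 < snd p \<and> compact (fst p) \<and> (\<forall>\<nu> a Z \<nu>' a' Z'.
      nearly_invariant (fst p) (snd p) \<nu> a Z \<longrightarrow> nearly_invariant (fst p) (snd p) \<nu>' a' Z' \<longrightarrow>
      nrm M (\<lambda>x. avg \<nu> a ?F x - avg \<nu>' a' ?F x) < 1 / real (Suc i))" by (intro exI[of _ "(L, \<delta>)"]) simp
  qed
  from choice[OF this] obtain p where p: "\<forall>i. 0 < snd (p i) \<and> compact (fst (p i)) \<and> (\<forall>\<nu> a Z \<nu>' a' Z'.
    nearly_invariant (fst (p i)) (snd (p i)) \<nu> a Z \<longrightarrow> nearly_invariant (fst (p i)) (snd (p i)) \<nu>' a' Z' \<longrightarrow>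
    nrm M (\<lambda>x. avg \<nu> a ?F x - avg \<nu>' a' ?F x) < 1 / real (Suc i))" by (elim exE)
  define L where "L i = (\<Union>k\<le>i. fst (p k))" for i
  define \<delta> where "\<delta> i = Min ((\<lambda>k. snd (p k)) ` {..i})" for i
  have L: "compact (L i)" for i unfolding L_def using p by (intro compact_UN) simp_all
  have \<delta>: "0 < \<delta> i" for i unfolding \<delta>_def using p by (subst Min_gr_iff) auto
  have sub: "fst (p k) \<subseteq> L i" "\<delta> i \<le> snd (p k)" if "k \<le> i" for i k
    unfolding L_def \<delta>_def using that by (auto intro: Min_le)
  have "\<forall>i. \<exists>q. nearly_invariant (L i) (\<delta> i) (fst q) (fst (snd q)) (snd (snd q))"
  proof
    fix i
    from True L \<delta> obtain \<nu> a Z where "nearly_invariant (L i) (\<delta> i) \<nu> a Z" by blast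
    then show "\<exists>q. nearly_invariant (L i) (\<delta> i) (fst q) (fst (snd q)) (snd (snd q))" by (intro exI[of _ "(\<nu>, a, Z)"]) simp
  qed
  from choice[OF this] obtain q where q: "\<forall>i. nearly_invariant (L i) (\<delta> i) (fst (q i)) (fst (snd (q i))) (snd (snd (q i)))"
    by (elim exE)
  define X where "X i = avg (fst (q i)) (fst (snd (q i))) ?F" for i
  have cF: "cont_bdd M ?F 1" by (rule prodF_cont_bdd[OF S]) (use f in blast)
  have sq: "avg \<nu> a ?F \<in> sq_int M" if "nearly_invariant L \<delta> \<nu> a Z" for L \<delta> \<nu> a Z
    using that avg_is_mean[OF cF, of \<nu> a Z] is_meanD(1) by (simp add: nearly_invariant_def)
  have Xs: "X i \<in> sq_int M" for i unfolding X_def using q sq by blast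
  have close: "nrm M (\<lambda>x. avg \<nu> a ?F x - X i x) < 1 / real (Suc k)"
    if n: "nearly_invariant (fst (p k)) (snd (p k)) \<nu> a Z" and "k \<le> i" for \<nu> a Z k i
  proof -
    have "nearly_invariant (fst (p k)) (snd (p k)) (fst (q i)) (fst (snd (q i))) (snd (snd (q i)))"
      by (rule nearly_invariant_mono[OF spec[OF q] sub[OF \<open>k \<le> i\<close>]])
    then show ?thesis using n p unfolding X_def by blast
  qed
  have "\<exists>v\<in>sq_int M. (\<lambda>n. nrm M (\<lambda>x. X n x - v x)) \<longlonglongrightarrow> 0"
  proof (rule L2_complete[OF Xs])
    fix e :: real assume "0 < e"
    then obtain N where N: "1 / real (Suc N) < e" using nat_approx_posE by blast
    have "nrm M (\<lambda>x. X i x - X k x) < e" if "N \<le> i" "N \<le> k" for i k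
    proof -
      have "nearly_invariant (fst (p N)) (snd (p N)) (fst (q i)) (fst (snd (q i))) (snd (snd (q i)))"
        by (rule nearly_invariant_mono[OF spec[OF q] sub[OF \<open>N \<le> i\<close>]])
      from close[OF this \<open>N \<le> k\<close>] N show ?thesis unfolding X_def by simp
    qed
    then show "\<exists>N. \<forall>i\<ge>N. \<forall>k\<ge>N. nrm M (\<lambda>x. X i x - X k x) < e" by blast
  qed
  then obtain v where v: "v \<in> sq_int M" "(\<lambda>n. nrm M (\<lambda>x. X n x - v x)) \<longlonglongrightarrow> 0" by (elim bexE)
  have "\<exists>L. \<exists>\<delta>>0. compact L \<and> (\<forall>\<nu> a Z. nearly_invariant L \<delta> \<nu> a Z \<longrightarrow> nrm M (\<lambda>x. avg \<nu> a ?F x - v x) < \<epsilon>)"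
    if \<epsilon>: "0 < \<epsilon>" for \<epsilon>
  proof -
    obtain N where N: "1 / real (Suc N) < \<epsilon> / 2" using \<epsilon> nat_approx_posE[of "\<epsilon> / 2"] by auto
    have "\<forall>\<^sub>F n in sequentially. nrm M (\<lambda>x. X n x - v x) < \<epsilon> / 2"
      using order_tendstoD(2)[OF v(2), of "\<epsilon> / 2"] \<epsilon> by simp
    then obtain N' where N': "\<forall>n\<ge>N'. nrm M (\<lambda>x. X n x - v x) < \<epsilon> / 2" unfolding eventually_sequentially by (elim exE)
    let ?i = "max N N'"
    have "nrm M (\<lambda>x. avg \<nu> a ?F x - v x) < \<epsilon>" if n: "nearly_invariant (fst (p N)) (snd (p N)) \<nu> a Z" for \<nu> a Z
    proof -
      have "nrm M (\<lambda>x. avg \<nu> a ?F x - v x) \<le> nrm M (\<lambda>x. avg \<nu> a ?F x - X ?i x) + nrm M (\<lambda>x. X ?i x - v x)"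
        by (rule nrm_triangle_diff[OF sq[OF n] Xs v(1)])
      moreover have "nrm M (\<lambda>x. avg \<nu> a ?F x - X ?i x) < \<epsilon> / 2"
        using close[OF n max.cobounded1[of N N']] N by linarith
      moreover have "nrm M (\<lambda>x. X ?i x - v x) < \<epsilon> / 2" using N' by simp
      ultimately show ?thesis by linarith
    qed
    then show ?thesis using p by (intro exI[of _ "fst (p N)"] exI[of _ "snd (p N)"]) blast
  qed
  then show ?thesis using v(1) by blast
qed

end

section \<open>Averages over translates of compact sets\<close>

context haar
begin

lemma compact_sets: "compact (K :: 'g set) \<Longrightarrow> K \<in> sets borel"
  by (rule borel_closed[OF compact_imp_closed])

lemma compact_measure: "compact K \<Longrightarrow> emeasure \<mu> K = ennreal (measure \<mu> K)"
  using compact_finite[of K] by (simp add: emeasure_eq_ennreal_measure less_top)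

lemma uniform_averaging:
  assumes "compact \<Phi>" "0 < emeasure \<mu> \<Phi>"
  shows "averaging (uniform_measure \<mu> \<Phi>) a ((+) a ` \<Phi>)"
proof -
  have "prob_space (uniform_measure \<mu> \<Phi>)"
    using assms compact_finite[OF assms(1)] by (intro prob_space_uniform_measure) auto
  moreover have "AE n in uniform_measure \<mu> \<Phi>. a + n \<in> (+) a ` \<Phi>"
    by (rule AE_uniform_measureI) (use assms(1) in \<open>simp_all add: compact_sets\<close>)
  ultimately show ?thesis using assms(1) by (simp add: averaging_def compact_translate)
qed

lemma uniform_integral:
  fixes \<phi> :: "'g \<Rightarrow> complex"
  assumes "compact \<Phi>" "0 < emeasure \<mu> \<Phi>" and \<phi>: "\<phi> \<in> borel_measurable borel"
  shows "(\<integral>n. \<phi> n \<partial>uniform_measure \<mu> \<Phi>) = of_real (1 / measure \<mu> \<Phi>) * (\<integral>n. indicator \<Phi> n *\<^sub>R \<phi> n \<partial>\<mu>)"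
proof -
  have m: "0 < measure \<mu> \<Phi>" using assms(2) unfolding compact_measure[OF assms(1)] by simp
  have "indicator \<Phi> n / emeasure \<mu> \<Phi> = ennreal (indicator \<Phi> n / measure \<mu> \<Phi>)" for n
    unfolding compact_measure[OF assms(1)] using m by (simp add: divide_ennreal flip: ennreal_indicator)
  then have "uniform_measure \<mu> \<Phi> = density \<mu> (\<lambda>n. ennreal (indicator \<Phi> n / measure \<mu> \<Phi>))"
    by (simp add: uniform_measure_def)
  then have "(\<integral>n. \<phi> n \<partial>uniform_measure \<mu> \<Phi>) = (\<integral>n. (indicator \<Phi> n / measure \<mu> \<Phi>) *\<^sub>R \<phi> n \<partial>\<mu>)"
    using compact_sets[OF assms(1)] \<phi> by (simp add: integral_density)
  also have "\<dots> = (\<integral>n. of_real (1 / measure \<mu> \<Phi>) * (indicator \<Phi> n *\<^sub>R \<phi> n) \<partial>\<mu>)"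
    by (intro Bochner_Integration.integral_cong) (simp_all add: scaleR_conv_of_real)
  finally show ?thesis by (simp only: integral_mult_right_zero)
qed

lemma distr_translate: "distr \<mu> borel ((+) a) = \<mu>"
proof (rule measure_eqI)
  fix B assume "B \<in> sets (distr \<mu> borel ((+) a))"
  then have B: "B \<in> sets borel" by simp
  have "(+) a \<in> borel_measurable borel"
    by (intro borel_measurable_continuous_onI continuous_add_left)
  then have "emeasure (distr \<mu> borel ((+) a)) B = emeasure \<mu> ((+) a -` B \<inter> space \<mu>)"
    using B by (intro emeasure_distr) simp_all
  then show "emeasure (distr \<mu> borel ((+) a)) B = emeasure \<mu> B"
    using emeasure_vimage_translate(2)[OF B, of a] by (simp add: vimage_def)
qed simp

lemma integral_translate:
  fixes \<phi> :: "'g \<Rightarrow> complex"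
  assumes "compact \<Phi>" and \<phi>: "\<phi> \<in> borel_measurable borel"
  shows "(\<integral>n. indicator \<Phi> n *\<^sub>R \<phi> (a + n) \<partial>\<mu>) = (\<integral>n. indicator ((+) a ` \<Phi>) n *\<^sub>R \<phi> n \<partial>\<mu>)"
proof -
  let ?f = "\<lambda>n. indicator ((+) a ` \<Phi>) n *\<^sub>R \<phi> n"
  have c: "(+) a ` \<Phi> \<in> sets borel" by (intro compact_sets compact_translate assms(1))
  have f: "?f \<in> borel_measurable borel" using c \<phi> by measurable
  have t: "(+) a \<in> measurable \<mu> borel"
    using borel_measurable_continuous_onI[OF continuous_add_left, of a] by (simp cong: measurable_cong_sets)
  have "(\<integral>n. ?f n \<partial>\<mu>) = (\<integral>n. ?f n \<partial>distr \<mu> borel ((+) a))" by (simp only: distr_translate)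
  also have "\<dots> = (\<integral>n. ?f (a + n) \<partial>\<mu>)" by (rule integral_distr[OF t f])
  also have "(\<lambda>n. ?f (a + n)) = (\<lambda>n. indicator \<Phi> n *\<^sub>R \<phi> (a + n))"
    by (auto simp: indicator_def image_iff)
  finally show ?thesis by simp
qed

lemma integrable_compact:
  fixes \<phi> :: "'g \<Rightarrow> complex"
  assumes "compact K" "\<phi> \<in> borel_measurable borel" "\<And>n. cmod (\<phi> n) \<le> B"
  shows "integrable \<mu> (\<lambda>n. indicator K n *\<^sub>R \<phi> n)"
  using assms compact_finite[OF assms(1)]
  by (intro integrableI_bounded_set_indicator[where B=B]) (simp_all add: compact_sets)

lemma measure_translate: "compact \<Phi> \<Longrightarrow> measure \<mu> ((+) a ` \<Phi>) = measure \<mu> \<Phi>"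
  using invariant[of \<Phi> a] by (simp add: measure_def compact_sets)

text \<open>The two integrals differ only on the symmetric difference.\<close>

lemma uniform_translate_le:
  fixes \<phi> :: "'g \<Rightarrow> complex"
  assumes c: "compact \<Phi>" and pos: "0 < emeasure \<mu> \<Phi>" and \<phi>: "\<phi> \<in> borel_measurable borel" and B: "\<And>n. cmod (\<phi> n) \<le> B"
    and \<delta>: "emeasure \<mu> (sym_diff ((+) l ` \<Phi>) \<Phi>) / emeasure \<mu> \<Phi> \<le> ennreal \<delta>" "0 \<le> \<delta>"
  shows "cmod ((\<integral>n. \<phi> (l + n) \<partial>uniform_measure \<mu> \<Phi>) - (\<integral>n. \<phi> n \<partial>uniform_measure \<mu> \<Phi>)) \<le> \<delta> * B"
proof -
  let ?D = "sym_diff ((+) l ` \<Phi>) \<Phi>"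
  have m: "0 < measure \<mu> \<Phi>" using pos unfolding compact_measure[OF c] by simp
  have cl: "compact ((+) l ` \<Phi>)" by (rule compact_translate[OF c])
  have sets: "\<Phi> \<in> sets borel" "(+) l ` \<Phi> \<in> sets borel" by (intro compact_sets c cl)+
  have fin: "emeasure \<mu> ?D < \<infinity>"
  proof -
    have "emeasure \<mu> ?D \<le> emeasure \<mu> ((+) l ` \<Phi> \<union> \<Phi>)" using sets by (intro emeasure_mono) auto
    also have "\<dots> < \<infinity>" by (rule compact_finite[OF compact_Un[OF cl c]])
    finally show ?thesis .
  qed
  have "ennreal (measure \<mu> ?D / measure \<mu> \<Phi>) = emeasure \<mu> ?D / emeasure \<mu> \<Phi>"
    using fin m unfolding compact_measure[OF c] by (simp add: divide_ennreal[symmetric] emeasure_eq_ennreal_measure less_top)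
  also have "\<dots> \<le> ennreal \<delta>" by (rule \<delta>(1))
  finally have le: "measure \<mu> ?D / measure \<mu> \<Phi> \<le> \<delta>" using \<delta>(2) by (simp add: ennreal_le_iff)
  have B0: "0 \<le> B" using B[of 0] norm_ge_zero[of "\<phi> 0"] by linarith
  have \<phi>l: "(\<lambda>n. \<phi> (l + n)) \<in> borel_measurable borel"
    using measurable_compose[OF borel_measurable_continuous_onI[OF continuous_add_left, of l] \<phi>] .
  have i: "integrable \<mu> (\<lambda>n. indicator ((+) l ` \<Phi>) n *\<^sub>R \<phi> n)" "integrable \<mu> (\<lambda>n. indicator \<Phi> n *\<^sub>R \<phi> n)"
    by (intro integrable_compact[OF _ \<phi> B] c cl)+
  have "(\<integral>n. \<phi> (l + n) \<partial>uniform_measure \<mu> \<Phi>) - (\<integral>n. \<phi> n \<partial>uniform_measure \<mu> \<Phi>) = of_real (1 / measure \<mu> \<Phi>) *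
      ((\<integral>n. indicator ((+) l ` \<Phi>) n *\<^sub>R \<phi> n \<partial>\<mu>) - (\<integral>n. indicator \<Phi> n *\<^sub>R \<phi> n \<partial>\<mu>))"
    unfolding uniform_integral[OF c pos \<phi>] uniform_integral[OF c pos \<phi>l] integral_translate[OF c \<phi>] right_diff_distrib ..
  also have "(\<integral>n. indicator ((+) l ` \<Phi>) n *\<^sub>R \<phi> n \<partial>\<mu>) - (\<integral>n. indicator \<Phi> n *\<^sub>R \<phi> n \<partial>\<mu>) =
      (\<integral>n. indicator ((+) l ` \<Phi>) n *\<^sub>R \<phi> n - indicator \<Phi> n *\<^sub>R \<phi> n \<partial>\<mu>)"
    by (rule Bochner_Integration.integral_diff[OF i, symmetric])
  finally have eq: "cmod ((\<integral>n. \<phi> (l + n) \<partial>uniform_measure \<mu> \<Phi>) - (\<integral>n. \<phi> n \<partial>uniform_measure \<mu> \<Phi>)) = 1 / measure \<mu> \<Phi> *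
      cmod (\<integral>n. indicator ((+) l ` \<Phi>) n *\<^sub>R \<phi> n - indicator \<Phi> n *\<^sub>R \<phi> n \<partial>\<mu>)"
    using m by (simp add: norm_mult norm_divide)
  have iD: "integrable \<mu> (\<lambda>n. B * indicator ?D n)" using fin sets by (simp add: integrable_indicator_iff)
  have "cmod (\<integral>n. indicator ((+) l ` \<Phi>) n *\<^sub>R \<phi> n - indicator \<Phi> n *\<^sub>R \<phi> n \<partial>\<mu>) \<le>
      (\<integral>n. cmod (indicator ((+) l ` \<Phi>) n *\<^sub>R \<phi> n - indicator \<Phi> n *\<^sub>R \<phi> n) \<partial>\<mu>)"
    by (rule integral_norm_bound)
  also have "\<dots> \<le> (\<integral>n. B * indicator ?D n \<partial>\<mu>)"
  proof (rule integral_mono[OF integrable_norm[OF Bochner_Integration.integrable_diff[OF i]] iD])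
    show "cmod (indicator ((+) l ` \<Phi>) n *\<^sub>R \<phi> n - indicator \<Phi> n *\<^sub>R \<phi> n) \<le> B * indicator ?D n" for n
      using B[of n] B0 by (cases "n \<in> \<Phi>"; cases "n \<in> (+) l ` \<Phi>") simp_all
  qed
  also have "\<dots> = B * measure \<mu> ?D" using sets by simp
  finally have "1 / measure \<mu> \<Phi> * cmod (\<integral>n. indicator ((+) l ` \<Phi>) n *\<^sub>R \<phi> n - indicator \<Phi> n *\<^sub>R \<phi> n \<partial>\<mu>)
      \<le> 1 / measure \<mu> \<Phi> * (B * measure \<mu> ?D)" using m by (intro mult_left_mono) simp_all
  also have "\<dots> = (measure \<mu> ?D / measure \<mu> \<Phi>) * B" by simp
  also have "\<dots> \<le> \<delta> * B" using le B0 by (rule mult_right_mono)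
  finally show ?thesis unfolding eq .
qed

end

lemma is_average_unique:
  assumes "is_average M \<mu> I F v" "is_average M \<mu> I F w"
  shows "v = w"
proof -
  have vw: "v \<in> L2 M" "w \<in> L2 M" using assms by (simp_all add: is_average_def)
  have "AE x in M. rep v x = rep w x"
  proof (rule ip_eq_imp_AE[OF L2_rep(1)[OF vw(1)] L2_rep(1)[OF vw(2)]])
    fix h assume h: "h \<in> sq_int M"
    have "L2_inner M v (ae_class M h) = L2_inner M w (ae_class M h)"
      using assms class_L2[OF h] by (simp add: is_average_def)
    then have "L2_inner M (ae_class M (rep v)) (ae_class M h) = L2_inner M (ae_class M (rep w)) (ae_class M h)"
      by (simp only: L2_rep(2)[OF vw(1)] L2_rep(2)[OF vw(2)])
    then show "ip M (rep v) h = ip M (rep w) h"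
      by (simp only: L2_inner_class[OF sq_intD[OF L2_rep(1)[OF vw(1)]] sq_intD[OF h]]
        L2_inner_class[OF sq_intD[OF L2_rep(1)[OF vw(2)]] sq_intD[OF h]])
  qed
  from ae_class_cong[OF this] show ?thesis by (simp only: L2_rep(2)[OF vw(1)] L2_rep(2)[OF vw(2)])
qed

context polynomial_system
begin

text \<open>
  The completion of the Haar measure disappears here, because the averaged pairings are continuous.
\<close>

lemma average_class:
  assumes c: "compact \<Phi>" and pos: "0 < emeasure \<mu> \<Phi>" and P: "cont_bdd M P B" and F: "\<And>n. F n = ae_class M (P n)"
    and v: "is_mean M (uniform_measure \<mu> \<Phi>) a P v"
  shows "average M \<mu> ((+) a ` \<Phi>) F = ae_class M v"
  unfolding average_def
proof (rule the_equality)
  have vs: "v \<in> sq_int M" by (rule is_meanD(1)[OF v])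
  have ca: "compact ((+) a ` \<Phi>)" by (rule compact_translate[OF c])
  show avv: "is_average M \<mu> ((+) a ` \<Phi>) F (ae_class M v)"
    unfolding is_average_def
  proof (intro conjI ballI class_L2[OF vs])
    fix h assume "h \<in> L2 M"
    note h = L2_rep[OF this]
    let ?\<phi> = "\<lambda>n. ip M (P n) (rep h)"
    have inner: "L2_inner M (ae_class M f) h = ip M f (rep h)" if "f \<in> sq_int M" for f
      using L2_inner_class[OF sq_intD[OF that] sq_intD[OF h(1)]] by (simp only: h(2))
    have \<phi>: "L2_inner M (F n) h = ?\<phi> n" for n unfolding F by (rule inner[OF cont_bdd_sq_int[OF P]])
    have m: "?\<phi> \<in> borel_measurable borel" by (rule borel_measurable_continuous_onI[OF cont_bdd_ip_cont[OF P h(1)]])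
    have ma: "(\<lambda>n. ?\<phi> (a + n)) \<in> borel_measurable borel"
      by (rule borel_measurable_continuous_onI[OF cont_bdd_ip_cont[OF cont_bdd_translate_left[OF P] h(1)]])
    let ?I = "\<lambda>n. indicator ((+) a ` \<Phi>) n *\<^sub>R ?\<phi> n"
    have I: "?I \<in> borel_measurable \<mu>" using m compact_sets[OF ca] by measurable
    have "integrable \<mu> ?I" by (rule integrable_compact[OF ca m cont_bdd_ip_bound[OF P h(1)]])
    then show "set_integrable (completion \<mu>) ((+) a ` \<Phi>) (\<lambda>n. L2_inner M (F n) h)"
      unfolding set_integrable_def \<phi> using integrable_completion[OF I] by simp
    have "L2_inner M (ae_class M v) h = (\<integral>n. ?\<phi> (a + n) \<partial>uniform_measure \<mu> \<Phi>)"
      unfolding inner[OF vs] by (rule is_meanD(2)[OF v h(1)])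
    also have "\<dots> = of_real (1 / measure \<mu> \<Phi>) * (\<integral>n. ?I n \<partial>\<mu>)"
      unfolding uniform_integral[OF c pos ma] integral_translate[OF c m] ..
    also have "(\<integral>n. ?I n \<partial>\<mu>) = (\<integral>n. ?I n \<partial>completion \<mu>)" by (rule integral_completion[OF I, symmetric])
    finally show "L2_inner M (ae_class M v) h = of_real (1 / measure \<mu> ((+) a ` \<Phi>)) *
        set_lebesgue_integral (completion \<mu>) ((+) a ` \<Phi>) (\<lambda>n. L2_inner M (F n) h)"
      unfolding set_lebesgue_integral_def \<phi> measure_translate[OF c] .
  qed
  show "w = ae_class M v" if "is_average M \<mu> ((+) a ` \<Phi>) F w" for w
    by (rule is_average_unique[OF that avv])
qed

text \<open>
  Equal maps are collected, with the identity attached to \<open>f 0\<close>, and the functions are scaled to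
  have bound 1.
\<close>

lemma multi_product_prodF:
  assumes gs: "\<forall>i. 1 \<le> i \<longrightarrow> i \<le> j \<longrightarrow> g i \<in> cpm 0" and fs: "\<forall>i\<le>j. f i \<in> Linf M"
  shows "\<exists>c S u. finite S \<and> S \<subseteq> cpm 0 \<and> (\<forall>h\<in>S. u h \<in> bdd M 1) \<and>
    (\<forall>n. multi_product M f g j n = ae_class M (\<lambda>x. c * prodF S u n x))"
proof -
  note g = gs[rule_format] and f = fs[rule_format]
  have "\<forall>i\<in>{..j}. \<exists>C>0. rep (f i) \<in> bdd M C \<and> ae_class M (rep (f i)) = f i"
    using Linf_bdd[OF f] by (metis atMost_iff)
  from bchoice[OF this] obtain C where C: "\<forall>i\<in>{..j}. 0 < C i \<and> rep (f i) \<in> bdd M (C i) \<and> ae_class M (rep (f i)) = f i"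
    by (elim exE)
  define w where "w i = (\<lambda>x. of_real (1 / C i) * rep (f i) x)" for i
  have w: "w i \<in> bdd M 1" "f i = ae_class M (\<lambda>x. of_real (C i) * w i x)" if "i \<le> j" for i
  proof -
    have Ci: "0 < C i" "rep (f i) \<in> bdd M (C i)" "ae_class M (rep (f i)) = f i" using C that by simp_all
    show "w i \<in> bdd M 1" using bdd_cmult[OF Ci(2), of "of_real (1 / C i)"] Ci(1) unfolding w_def by (simp add: norm_divide)
    show "f i = ae_class M (\<lambda>x. of_real (C i) * w i x)" using Ci(1,3) by (simp add: w_def)
  qed
  define gg where "gg i = (if i = 0 then fone else g i)" for i
  have gg: "gg i \<in> cpm 0" if "i \<le> j" for i using that g[of i] cpm_one by (simp add: gg_def)
  define S where "S = gg ` {..j}"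
  have S: "finite S" "S \<subseteq> cpm 0" using gg by (auto simp: S_def)
  define u where "u h = (\<lambda>x. \<Prod>i\<in>{i\<in>{..j}. gg i = h}. w i x)" for h
  have u: "\<forall>h\<in>S. u h \<in> bdd M 1" unfolding u_def by (intro ballI bdd_prod w(1)) simp
  have step: "g i n (f i) = ae_class M (\<lambda>x. of_real (C i) * act M (gg i n) (w i) x)" if i: "i \<le> j" "1 \<le> i" for i n
  proof -
    have T: "g i n \<in> G" by (rule cpm_G[OF g[OF i(2,1)]])
    have ws: "w i \<in> sq_int M" by (rule bdd_sq_int(1)[OF w(1)[OF i(1)]])
    have "g i n (f i) = ae_class M (act M (g i n) (\<lambda>x. of_real (C i) * w i x))"
      unfolding class_act[OF T sq_int_cmult[OF ws]] w(2)[OF i(1), symmetric] ..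
    also have "\<dots> = ae_class M (\<lambda>x. of_real (C i) * act M (g i n) (w i) x)"
      by (rule ae_class_cong[OF act_cmult[OF T ws]])
    finally show ?thesis using i by (simp add: gg_def)
  qed
  have am: "act M (gg i n) (w i) \<in> borel_measurable M" if "i \<le> j" for i n
    by (rule bddD[OF act_bdd[OF cpm_G[OF gg[OF that]] w(1)[OF that]]])
  have mp: "multi_product M f g k n = ae_class M (\<lambda>x. \<Prod>i\<le>k. of_real (C i) * act M (gg i n) (w i) x)" if "k \<le> j" for k n
    using that
  proof (induction k)
    case 0
    have "AE x in M. of_real (C 0) * w 0 x = of_real (C 0) * act M fone_val (w 0) x" if "fone_val = \<one>\<^bsub>H\<^esub>" for fone_val
      using act_one[OF bdd_sq_int(1)[OF w(1)[OF le0]]] unfolding that by eventually_elim simp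
    from ae_class_cong[OF this[OF refl]] show ?case using w(2)[of 0] by (simp add: gg_def)
  next
    case (Suc k)
    have meas: "(\<lambda>x. \<Prod>i\<le>k. of_real (C i) * act M (gg i n) (w i) x) \<in> borel_measurable M"
      using Suc.prems am by (intro borel_measurable_prod borel_measurable_times borel_measurable_const) simp_all
    have "multi_product M f g (Suc k) n =
        cl_mult M (ae_class M (\<lambda>x. \<Prod>i\<le>k. of_real (C i) * act M (gg i n) (w i) x))
          (ae_class M (\<lambda>x. of_real (C (Suc k)) * act M (gg (Suc k) n) (w (Suc k)) x))"
      using Suc step[of "Suc k" n] by simp
    also have "\<dots> = ae_class M (\<lambda>x. (\<Prod>i\<le>k. of_real (C i) * act M (gg i n) (w i) x) *
        (of_real (C (Suc k)) * act M (gg (Suc k) n) (w (Suc k)) x))"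
      by (rule cl_mult_class[OF meas borel_measurable_times[OF borel_measurable_const am[OF Suc.prems]]])
    finally show ?case by simp
  qed
  define c :: complex where "c = (\<Prod>i\<le>j. of_real (C i))"
  have "multi_product M f g j n = ae_class M (\<lambda>x. c * prodF S u n x)" for n
    unfolding mp[OF order_refl]
  proof (rule ae_class_cong)
    have "AE x in M. \<forall>h\<in>S. act M (h n) (u h) x = (\<Prod>i\<in>{i\<in>{..j}. gg i = h}. act M (h n) (w i) x)"
    proof (rule AE_finite_allI[OF S(1)])
      fix h assume "h \<in> S"
      then have T: "h n \<in> G" using S(2) cpm_G by blast
      show "AE x in M. act M (h n) (u h) x = (\<Prod>i\<in>{i\<in>{..j}. gg i = h}. act M (h n) (w i) x)"
        unfolding u_def by (rule act_prod[OF T]) (use w(1) in simp)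
    qed
    then show "AE x in M. (\<Prod>i\<le>j. of_real (C i) * act M (gg i n) (w i) x) = c * prodF S u n x"
    proof eventually_elim
      case (elim x)
      have "prodF S u n x = (\<Prod>h\<in>S. \<Prod>i\<in>{i\<in>{..j}. gg i = h}. act M (gg i n) (w i) x)"
        unfolding prodF_def using elim by (intro prod.cong) simp_all
      also have "\<dots> = (\<Prod>i\<le>j. act M (gg i n) (w i) x)"
        unfolding S_def by (rule prod.image_gen[symmetric]) simp
      finally show ?case by (simp add: c_def prod.distrib)
    qed
  qed
  then show ?thesis using S u by (intro exI[of _ c] exI[of _ S] exI[of _ u]) simp
qed

lemma limit_over_compact_sets:
  assumes gs: "\<forall>i. 1 \<le> i \<longrightarrow> i \<le> j \<longrightarrow> g i \<in> cpm 0" and fs: "\<forall>i\<le>j. f i \<in> Linf M"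
  shows "\<exists>V\<in>L2 M. \<forall>\<epsilon>>0. \<exists>L. \<exists>\<delta>>0. compact L \<and> (\<forall>\<Phi> a. compact \<Phi> \<longrightarrow> 0 < emeasure \<mu> \<Phi> \<longrightarrow>
    (\<forall>l\<in>L. emeasure \<mu> (sym_diff ((+) l ` \<Phi>) \<Phi>) / emeasure \<mu> \<Phi> \<le> ennreal \<delta>) \<longrightarrow>
    L2_dist M (average M \<mu> ((+) a ` \<Phi>) (multi_product M f g j)) V < \<epsilon>)"
proof -
  from multi_product_prodF[OF gs fs] obtain c S u where S: "finite S" "S \<subseteq> cpm 0" and u: "\<forall>h\<in>S. u h \<in> bdd M 1"
    and mp: "\<forall>n. multi_product M f g j n = ae_class M (\<lambda>x. c * prodF S u n x)" by (elim exE conjE)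
  from averages_limit[OF S u] obtain v where v: "v \<in> sq_int M" and
    lim: "\<forall>\<epsilon>>0. \<exists>L. \<exists>\<delta>>0. compact L \<and> (\<forall>\<nu> a Z. nearly_invariant L \<delta> \<nu> a Z \<longrightarrow>
    nrm M (\<lambda>x. avg \<nu> a (prodF S u) x - v x) < \<epsilon>)" by (elim bexE)
  have cF: "cont_bdd M (prodF S u) 1" by (rule prodF_cont_bdd[OF S]) (use u in blast)
  let ?P = "\<lambda>n x. c * prodF S u n x"
  have cP: "cont_bdd M ?P (cmod c * 1)" by (rule cont_bdd_cmult[OF cF])
  have "\<exists>L. \<exists>\<delta>>0. compact L \<and> (\<forall>\<Phi> a. compact \<Phi> \<longrightarrow> 0 < emeasure \<mu> \<Phi> \<longrightarrow>
    (\<forall>l\<in>L. emeasure \<mu> (sym_diff ((+) l ` \<Phi>) \<Phi>) / emeasure \<mu> \<Phi> \<le> ennreal \<delta>) \<longrightarrow>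
    L2_dist M (average M \<mu> ((+) a ` \<Phi>) (multi_product M f g j)) (ae_class M (\<lambda>x. c * v x)) < \<epsilon>)"
    if \<epsilon>: "0 < \<epsilon>" for \<epsilon>
  proof -
    have e: "0 < \<epsilon> / (cmod c + 1)" using \<epsilon> norm_ge_zero[of c] by (intro divide_pos_pos) linarith+
    from lim[rule_format, OF e] obtain L \<delta> where L: "0 < \<delta>" "compact L" and
      lim': "\<forall>\<nu> a Z. nearly_invariant L \<delta> \<nu> a Z \<longrightarrow> nrm M (\<lambda>x. avg \<nu> a (prodF S u) x - v x) < \<epsilon> / (cmod c + 1)"
      by (elim exE conjE)
    show ?thesis
    proof (intro exI[of _ L] exI[of _ \<delta>] conjI allI impI L)
      fix \<Phi> a
      assume \<Phi>: "compact \<Phi>" "0 < emeasure \<mu> \<Phi>"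
        and fol: "\<forall>l\<in>L. emeasure \<mu> (sym_diff ((+) l ` \<Phi>) \<Phi>) / emeasure \<mu> \<Phi> \<le> ennreal \<delta>"
      let ?\<nu> = "uniform_measure \<mu> \<Phi>"
      have av: "averaging ?\<nu> a ((+) a ` \<Phi>)" by (rule uniform_averaging[OF \<Phi>])
      have "inv_under ?\<nu> \<delta> l" if "l \<in> L" for l
        unfolding inv_under_def
      proof (intro allI impI)
        fix \<phi> :: "'g \<Rightarrow> complex" and B
        assume \<phi>: "continuous_on UNIV \<phi>" "\<forall>n. cmod (\<phi> n) \<le> B"
        show "cmod ((\<integral>n. \<phi> (l + n) \<partial>?\<nu>) - (\<integral>n. \<phi> n \<partial>?\<nu>)) \<le> \<delta> * B"
          by (rule uniform_translate_le[OF \<Phi> borel_measurable_continuous_onI[OF \<phi>(1)] spec[OF \<phi>(2)] bspec[OF fol that] less_imp_le[OF L(1)]])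
      qed
      then have n: "nearly_invariant L \<delta> ?\<nu> a ((+) a ` \<Phi>)" using av by (simp add: nearly_invariant_def)
      let ?w = "avg ?\<nu> a (prodF S u)"
      have mean: "is_mean M ?\<nu> a (prodF S u) ?w" by (rule avg_is_mean[OF cF av])
      have ws: "?w \<in> sq_int M" by (rule is_meanD(1)[OF mean])
      have "is_mean M ?\<nu> a (\<lambda>n x. \<Sum>t\<in>{()}. c * prodF S u n x) (\<lambda>x. \<Sum>t\<in>{()}. c * ?w x)"
        by (rule is_mean_sum[OF av cF mean])
      then have "is_mean M ?\<nu> a ?P (\<lambda>x. c * ?w x)" by simp
      from average_class[where F="multi_product M f g j", OF \<Phi> cP spec[OF mp] this]
      have "L2_dist M (average M \<mu> ((+) a ` \<Phi>) (multi_product M f g j)) (ae_class M (\<lambda>x. c * v x)) =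
          nrm M (\<lambda>x. c * ?w x - c * v x)"
        using L2_dist_class[OF sq_intD[OF sq_int_cmult[OF ws, of c]] sq_intD[OF sq_int_cmult[OF v, of c]]] by simp
      also have "\<dots> = cmod c * nrm M (\<lambda>x. ?w x - v x)"
        using nrm_cmult[of M c "\<lambda>x. ?w x - v x"] by (simp add: right_diff_distrib)
      also have "\<dots> \<le> cmod c * (\<epsilon> / (cmod c + 1))" using lim'[rule_format, OF n] by (intro mult_left_mono) simp_all
      also have "\<dots> < \<epsilon>"
      proof -
        have "cmod c * \<epsilon> < (cmod c + 1) * \<epsilon>" using \<epsilon> by (intro mult_strict_right_mono) simp_all
        moreover have "0 < cmod c + 1" using norm_ge_zero[of c] by linarith
        ultimately show ?thesis by (simp add: pos_divide_less_eq mult.commute)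
      qed
      finally show "L2_dist M (average M \<mu> ((+) a ` \<Phi>) (multi_product M f g j)) (ae_class M (\<lambda>x. c * v x)) < \<epsilon>" .
    qed
  qed
  moreover have "ae_class M (\<lambda>x. c * v x) \<in> L2 M" by (rule class_L2[OF sq_int_cmult[OF v]])
  ultimately show ?thesis by blast
qed

end

section \<open>Convergence along Foelner nets\<close>

lemma folner_net_converge:
  fixes A :: "'i set" and \<mu> :: "'g::{topological_group_add, t2_space} measure"
  assumes fol: "folner_net \<mu> A rel \<Phi>"
    and lim: "\<forall>\<epsilon>>0. \<exists>L. \<exists>\<delta>>0. compact L \<and> (\<forall>\<Phi> a. compact \<Phi> \<longrightarrow> 0 < emeasure \<mu> \<Phi> \<longrightarrow>
    (\<forall>l\<in>L. emeasure \<mu> (sym_diff ((+) l ` \<Phi>) \<Phi>) / emeasure \<mu> \<Phi> \<le> ennreal \<delta>) \<longrightarrow>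
    L2_dist M (average M \<mu> ((+) a ` \<Phi>) F) V < \<epsilon>)"
  shows "averages_converge M \<mu> F A rel \<Phi> a V"
  unfolding averages_converge_def
proof (rule tendstoI)
  fix \<epsilon> :: real assume "0 < \<epsilon>"
  from lim[rule_format, OF this] obtain L \<delta> where L: "0 < \<delta>" "compact L" and
    le: "\<forall>\<Phi> a. compact \<Phi> \<longrightarrow> 0 < emeasure \<mu> \<Phi> \<longrightarrow>
      (\<forall>l\<in>L. emeasure \<mu> (sym_diff ((+) l ` \<Phi>) \<Phi>) / emeasure \<mu> \<Phi> \<le> ennreal \<delta>) \<longrightarrow>
      L2_dist M (average M \<mu> ((+) a ` \<Phi>) F) V < \<epsilon>" by (elim exE conjE)
  obtain \<alpha>0 where "\<alpha>0 \<in> A" using fol by (auto simp: folner_net_def directed_set_def)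
  then have "\<forall>\<^sub>F \<alpha> in net_filter A rel. \<alpha> \<in> A"
    unfolding net_filter_def by (rule eventually_INF1) (simp add: eventually_principal)
  moreover have "\<forall>\<^sub>F \<alpha> in net_filter A rel.
      (SUP l\<in>L. emeasure \<mu> (sym_diff ((+) l ` \<Phi> \<alpha>) (\<Phi> \<alpha>)) / emeasure \<mu> (\<Phi> \<alpha>)) < ennreal \<delta>"
    using fol L by (intro order_tendstoD(2)[of _ 0]) (simp_all add: folner_net_def)
  ultimately show "\<forall>\<^sub>F \<alpha> in net_filter A rel. dist (L2_dist M (average M \<mu> ((+) (a \<alpha>) ` \<Phi> \<alpha>) F) V) 0 < \<epsilon>"
  proof eventually_elim
    case (elim \<alpha>)
    have "emeasure \<mu> (sym_diff ((+) l ` \<Phi> \<alpha>) (\<Phi> \<alpha>)) / emeasure \<mu> (\<Phi> \<alpha>) \<le> ennreal \<delta>" if "l \<in> L" for l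
      using elim(2) SUP_upper[OF that, of "\<lambda>l. emeasure \<mu> (sym_diff ((+) l ` \<Phi> \<alpha>) (\<Phi> \<alpha>)) / emeasure \<mu> (\<Phi> \<alpha>)"]
      by (meson less_imp_le order_trans)
    moreover have "compact (\<Phi> \<alpha>)" "0 < emeasure \<mu> (\<Phi> \<alpha>)" using fol elim(1) by (simp_all add: folner_net_def)
    ultimately have "L2_dist M (average M \<mu> ((+) (a \<alpha>) ` \<Phi> \<alpha>) F) V < \<epsilon>" using le by blast
    moreover have "0 \<le> L2_dist M (average M \<mu> ((+) (a \<alpha>) ` \<Phi> \<alpha>) F) V" by (simp add: L2_dist_nrm)
    ultimately show ?case by (simp add: dist_real_def)
  qed
qed

theorem theorem2p2:
  fixes \<mu> :: "'g::{topological_group_add, t2_space} measure"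
    and M :: "'x measure"
    and G :: "'x operator set"
    and Gs :: "nat \<Rightarrow> 'x operator set"
    and g :: "nat \<Rightarrow> 'g \<Rightarrow> 'x operator"
    and f :: "nat \<Rightarrow> ('x \<Rightarrow> complex) set"
    and j :: nat
  assumes "locally_compact_space (euclidean :: 'g topology)"
    and "left_haar_measure \<mu>"
    and "amenable \<mu>"
    and "prob_space M"
    and "operator_group M G"
    and "group_filtration (BijGroup (L2 M)) G Gs"
    and "finite_length (BijGroup (L2 M)) Gs"
    and "\<And>i. 1 \<le> i \<Longrightarrow> i \<le> j \<Longrightarrow> polynomial_map (BijGroup (L2 M)) Gs (g i)"
    and "\<And>i. 1 \<le> i \<Longrightarrow> i \<le> j \<Longrightarrow> operator_measurable M \<mu> (g i)"
    and "\<And>i. i \<le> j \<Longrightarrow> f i \<in> Linf M"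
  shows "\<exists>L \<in> L2 M.
    (\<forall>(A :: 'i set) rel \<Phi> a. folner_net \<mu> A rel \<Phi> \<longrightarrow>
        averages_converge M \<mu> (multi_product M f g j) A rel \<Phi> a L) \<and>
    (\<forall>(B :: 'k set) rel \<Phi> a. folner_net \<mu> B rel \<Phi> \<longrightarrow>
        averages_converge M \<mu> (multi_product M f g j) B rel \<Phi> a L)"
proof -
  obtain len where len: "Gs len = {\<one>\<^bsub>BijGroup (L2 M)\<^esub>}" using assms(7) unfolding finite_length_def by blast
  interpret prob_space M by (rule assms(4))
  interpret operator_system M G by unfold_locales (rule assms(5))
  interpret polynomial_system M G \<mu> Gs len
    using assms(1,2,6) len group_BijGroup
    by unfold_locales (simp_all add: group_filtration_def)
  have g: "\<forall>i. 1 \<le> i \<longrightarrow> i \<le> j \<longrightarrow> g i \<in> cpm 0"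
  proof (intro allI impI)
    fix i assume i: "1 \<le> i" "i \<le> j"
    have p: "g i \<in> pmap 0" using assms(8)[OF i] by (simp add: pmap_def)
    from measurable_polynomial_strongly_continuous[OF p assms(9)[OF i]] p show "g i \<in> cpm 0" by (simp add: cpm_def)
  qed
  have "\<forall>i\<le>j. f i \<in> Linf M" using assms(10) by blast
  from limit_over_compact_sets[OF g this] obtain V where V: "V \<in> L2 M" and
    lim: "\<forall>\<epsilon>>0. \<exists>L. \<exists>\<delta>>0. compact L \<and> (\<forall>\<Phi> a. compact \<Phi> \<longrightarrow> 0 < emeasure \<mu> \<Phi> \<longrightarrow>
    (\<forall>l\<in>L. emeasure \<mu> (sym_diff ((+) l ` \<Phi>) \<Phi>) / emeasure \<mu> \<Phi> \<le> ennreal \<delta>) \<longrightarrow>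
    L2_dist M (average M \<mu> ((+) a ` \<Phi>) (multi_product M f g j)) V < \<epsilon>)" by (elim bexE)
  show ?thesis
    by (rule bexI[OF _ V]) (intro conjI allI impI folner_net_converge[OF _ lim])
qed

end
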